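(* For every integer $m\geq 2$ and every positive integer $k$, there exists a connected finite simple graph $G_k$, on the vertex set $[n]$ for some $n$, such that $$\mathrm{depth}(S/\mathcal{J}_{K_m,G_k})=(m-2)+f(G_k)+d(G_k)=m+n-\kappa(G_k)-k.$$
   Context: Let $K$ be a field, $[n]=\{1,\dots,n\}$, and $S=K[x_{ij}: i\in[m],\, j\in[n]]$. For a finite simple graph $G$ on $[n]$ with edge set $E(G)$, the generalized binomial edge ideal of $G$ is $$\mathcal{J}_{K_m,G}=\big(x_{ik}x_{jl}-x_{il}x_{jk} : 1\le i<j\le m,\ \{k,l\}\in E(G),\ k<l\big)\subseteq S.$$ Depth is taken with respect to the homogeneous maximal ideal of $S$. A vertex $v$ of $G$ is free if the induced subgraph of $G$ on the set of neighbours of $v$ is complete; $f(G)$ is the number of free vertices of $G$. $d(G)=i(G)+\sum_j\mathrm{diam}(G_j)$, where $i(G)$ is the number of isolated vertices of $G$, the sum is over the connected components $G_j$ of $G$, and $\mathrm{diam}$ is the maximum distance between two vertices. The vertex-connectivity $\kappa(G)$ of a connected graph $G$ is the minimum cardinality of a set $T\subseteq V(G)$ such that the induced subgraph on $V(G)\setminus T$ is disconnected; by convention $\kappa(K_n)=n-1$ for the complete graph $K_n$. *)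

theory Defs
  imports
    "HOL-Library.Poly_Mapping"
    "HOL-Library.Extended_Nat"
    "Graph_Theory.Kuratowski"
    "HOL-Algebra.QuotRing"
    "HOL-Algebra.Module"
begin

section \<open>Depth\<close>

text \<open>
  The submodule \<open>(f\<^sub>1, \<dots>, f\<^sub>r) M\<close> of a module \<open>M\<close> over \<open>R\<close>.
\<close>
definition seq_submodule :: "('a, 'r) ring_scheme \<Rightarrow> ('a, 'b, 'q) module_scheme \<Rightarrow> 'a list \<Rightarrow> 'b set"
  where "seq_submodule R M fs =
    \<Inter> {H. submodule H R M \<and> {f \<odot>\<^bsub>M\<^esub> u | f u. f \<in> set fs \<and> u \<in> carrier M} \<subseteq> H}"

text \<open>
  The implication below says that \<open>fs ! i\<close> is a nonzerodivisor on
  \<open>M / (f\<^sub>0, \<dots>, f\<^bsub>i-1\<^esub>) M\<close>, with the vanishing of a residue class written as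
  membership of its representative in the submodule.
\<close>
definition regular_sequence :: "('a, 'r) ring_scheme \<Rightarrow> ('a, 'b, 'q) module_scheme \<Rightarrow> 'a list \<Rightarrow> bool"
  where "regular_sequence R M fs \<longleftrightarrow>
    set fs \<subseteq> carrier R \<and>
    (\<forall>i < length fs. \<forall>u \<in> carrier M.
       (fs ! i) \<odot>\<^bsub>M\<^esub> u \<in> seq_submodule R M (take i fs) \<longrightarrow> u \<in> seq_submodule R M (take i fs)) \<and>
    seq_submodule R M fs \<noteq> carrier M"

text \<open>
  Depth of \<open>M\<close> with respect to the ideal \<open>I\<close>: the supremum of the lengths of the
  \<open>M\<close>-regular sequences contained in \<open>I\<close>.
\<close>
definition depth :: "('a, 'r) ring_scheme \<Rightarrow> 'a set \<Rightarrow> ('a, 'b, 'q) module_scheme \<Rightarrow> enat"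
  where "depth R I M =
    Sup {enat (length fs) | fs. set fs \<subseteq> I \<and> regular_sequence R M fs}"

text \<open>The cyclic \<open>R\<close>-module \<open>R / J\<close>; a scalar acts through its residue class.\<close>
definition quot_module :: "('a, 'r) ring_scheme \<Rightarrow> 'a set \<Rightarrow> ('a, 'a set) module"
  where "quot_module R J =
    \<lparr>carrier = carrier (R Quot J), monoid.mult = monoid.mult (R Quot J), one = one (R Quot J),
     zero = zero (R Quot J), add = add (R Quot J),
     smult = (\<lambda>a X. (J +>\<^bsub>R\<^esub> a) \<otimes>\<^bsub>R Quot J\<^esub> X)\<rparr>"

lemma quot_module_is_module:
  assumes "cring R" "ideal J R"
  shows "module R (quot_module R J)"
proof -
  interpret R: cring R by fact
  interpret J: ideal J R by fact
  interpret Q: cring "R Quot J" by (rule J.quotient_is_cring[OF \<open>cring R\<close>])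
  interpret h: ring_hom_cring R "R Quot J" "(+>\<^bsub>R\<^esub>) J"
    by (rule J.rcos_ring_hom_cring[OF \<open>cring R\<close>])
  have carr: "J +>\<^bsub>R\<^esub> a \<in> carrier (R Quot J)" if "a \<in> carrier R" for a
    using that by (rule h.hom_closed)
  show ?thesis
  proof (rule moduleI)
    show "cring R" by fact
    show "abelian_group (quot_module R J)"
    proof (rule abelian_groupI)
      fix Y assume "Y \<in> carrier (quot_module R J)"
      then show "\<exists>Z \<in> carrier (quot_module R J). Z \<oplus>\<^bsub>quot_module R J\<^esub> Y = \<zero>\<^bsub>quot_module R J\<^esub>"
        using Q.l_neg[of Y] Q.a_inv_closed[of Y] by (force simp: quot_module_def)
    qed (simp_all add: quot_module_def Q.a_ac)
  qed (simp_all add: quot_module_def carr h.hom_add h.hom_mult h.hom_one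
        Q.l_distr Q.r_distr Q.m_assoc del: h.hom_closed)
qed


section \<open>Generalized binomial edge ideals\<close>

text \<open>
  A monomial is a finitely supported exponent vector on the variables \<open>x\<^sub>i\<^sub>j\<close>, which are
  named by pairs \<open>(i, j)\<close>. The type has infinitely many variables; \<open>poly_ring m n\<close> is
  the polynomial ring in the variables with \<open>1 \<le> i \<le> m\<close> and \<open>1 \<le> j \<le> n\<close>.
\<close>
type_synonym 'k mpoly = "((nat \<times> nat) \<Rightarrow>\<^sub>0 nat) \<Rightarrow>\<^sub>0 'k"

definition xvar :: "nat \<Rightarrow> nat \<Rightarrow> 'k::field mpoly"
  where "xvar i j = Poly_Mapping.single (Poly_Mapping.single (i, j) 1) 1"

definition poly_ring :: "nat \<Rightarrow> nat \<Rightarrow> 'k::field mpoly ring"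
  where "poly_ring m n =
    \<lparr>carrier = {p. \<forall>t \<in> Poly_Mapping.keys p. Poly_Mapping.keys t \<subseteq> {1..m} \<times> {1..n}},
     monoid.mult = (*), one = 1, zero = 0, add = (+)\<rparr>"

definition max_ideal :: "nat \<Rightarrow> nat \<Rightarrow> 'k::field mpoly set"
  where "max_ideal m n = Idl\<^bsub>poly_ring m n\<^esub> {xvar i j | i j. i \<in> {1..m} \<and> j \<in> {1..n}}"

text \<open>
  A finite simple graph is a \<^locale>\<open>pair_graph\<close>: a symmetric loop-free digraph in which
  the edge \<open>{k, l}\<close> is the pair of arcs \<open>(k, l)\<close>, \<open>(l, k)\<close>.
\<close>
definition gen_binomial_edge_ideal :: "nat \<Rightarrow> nat \<Rightarrow> nat pair_pre_digraph \<Rightarrow> 'k::field mpoly set"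
  where "gen_binomial_edge_ideal m n G = Idl\<^bsub>poly_ring m n\<^esub>
    {xvar i k * xvar j l - xvar i l * xvar j k | i j k l.
       1 \<le> i \<and> i < j \<and> j \<le> m \<and> (k, l) \<in> parcs G \<and> k < l}"

lemma poly_ring_simps [simp]:
  "p \<in> carrier (poly_ring m n) \<longleftrightarrow>
    (\<forall>t \<in> Poly_Mapping.keys p. Poly_Mapping.keys t \<subseteq> {1..m} \<times> {1..n})"
  "monoid.mult (poly_ring m n) = (*)" "one (poly_ring m n) = 1"
  "zero (poly_ring m n) = 0" "add (poly_ring m n) = (+)"
  by (simp_all add: poly_ring_def)

lemma poly_ring_mult_closed:
  assumes "p \<in> carrier (poly_ring m n)" "q \<in> carrier (poly_ring m n)"
  shows "p * q \<in> carrier (poly_ring m n)"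
proof -
  have "Poly_Mapping.keys t \<subseteq> {1..m} \<times> {1..n}" if "t \<in> Poly_Mapping.keys (p * q)" for t
  proof -
    from that keys_mult[of p q] obtain a b
      where "t = a + b" "a \<in> Poly_Mapping.keys p" "b \<in> Poly_Mapping.keys q" by blast
    with assms Poly_Mapping.keys_add[of a b] show ?thesis unfolding poly_ring_simps by blast
  qed
  then show ?thesis by simp
qed

lemma poly_ring_add_closed:
  assumes "p \<in> carrier (poly_ring m n)" "q \<in> carrier (poly_ring m n)"
  shows "p + q \<in> carrier (poly_ring m n)"
  using assms Poly_Mapping.keys_add[of p q] unfolding poly_ring_simps by blast

lemma poly_ring_cring: "cring (poly_ring m n :: 'k::field mpoly ring)"
proof (rule cringI)
  show "abelian_group (poly_ring m n :: 'k mpoly ring)"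
  proof (rule abelian_groupI)
    fix p :: "'k mpoly" assume p: "p \<in> carrier (poly_ring m n)"
    show "\<exists>q \<in> carrier (poly_ring m n). q \<oplus>\<^bsub>poly_ring m n\<^esub> p = \<zero>\<^bsub>poly_ring m n\<^esub>"
    proof (rule bexI)
      show "- p \<oplus>\<^bsub>poly_ring m n\<^esub> p = \<zero>\<^bsub>poly_ring m n\<^esub>" by simp
      show "- p \<in> carrier (poly_ring m n)" using p by simp
    qed
  next
    fix p q :: "'k mpoly"
    assume "p \<in> carrier (poly_ring m n)" "q \<in> carrier (poly_ring m n)"
    then show "p \<oplus>\<^bsub>poly_ring m n\<^esub> q \<in> carrier (poly_ring m n)"
      using poly_ring_add_closed by (simp del: poly_ring_simps(1))
  qed (simp_all add: algebra_simps)
  show "Group.comm_monoid (poly_ring m n :: 'k mpoly ring)"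
  proof (rule comm_monoidI)
    fix p q :: "'k mpoly"
    assume "p \<in> carrier (poly_ring m n)" "q \<in> carrier (poly_ring m n)"
    then show "p \<otimes>\<^bsub>poly_ring m n\<^esub> q \<in> carrier (poly_ring m n)"
      using poly_ring_mult_closed by (simp del: poly_ring_simps(1))
  qed (simp_all add: algebra_simps)
qed (simp_all add: algebra_simps)

lemma xvar_in_poly_ring:
  assumes "i \<in> {1..m}" "j \<in> {1..n}"
  shows "xvar i j \<in> carrier (poly_ring m n)"
  using assms by (simp add: xvar_def)

lemma max_ideal_ideal: "ideal (max_ideal m n) (poly_ring m n)"
proof -
  interpret cring "poly_ring m n" by (rule poly_ring_cring)
  show ?thesis
    unfolding max_ideal_def using xvar_in_poly_ring[of _ m _ n] by (intro genideal_ideal) blast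
qed

lemma gen_binomial_edge_ideal_ideal:
  assumes "pair_graph G" "pverts G = {1..n}"
  shows "ideal (gen_binomial_edge_ideal m n G) (poly_ring m n :: 'k::field mpoly ring)"
proof -
  interpret R: cring "poly_ring m n :: 'k mpoly ring" by (rule poly_ring_cring)
  interpret G: pair_graph G by fact
  have diff: "p - q \<in> carrier (poly_ring m n)"
    if "p \<in> carrier (poly_ring m n)" "q \<in> carrier (poly_ring m n)" for p q :: "'k mpoly"
    unfolding diff_conv_add_uminus
    by (rule poly_ring_add_closed) (use that in \<open>simp_all only: poly_ring_simps keys_minus\<close>)
  show ?thesis
    unfolding gen_binomial_edge_ideal_def
  proof (intro R.genideal_ideal subsetI)
    fix p :: "'k mpoly"
    assume "p \<in> {xvar i k * xvar j l - xvar i l * xvar j k | i j k l.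
       1 \<le> i \<and> i < j \<and> j \<le> m \<and> (k, l) \<in> parcs G \<and> k < l}"
    then obtain i j k l where p: "p = xvar i k * xvar j l - xvar i l * xvar j k"
      and ij: "1 \<le> i" "i < j" "j \<le> m" and kl: "(k, l) \<in> parcs G" by blast
    have "i \<in> {1..m}" "j \<in> {1..m}" using ij by simp_all
    moreover have "k \<in> {1..n}" "l \<in> {1..n}"
      using G.in_arcsD1[OF kl] G.in_arcsD2[OF kl] unfolding assms(2) .
    ultimately show "p \<in> carrier (poly_ring m n)"
      unfolding p by (intro diff poly_ring_mult_closed xvar_in_poly_ring)
  qed
qed


section \<open>Graph invariants\<close>

definition neighbours :: "('v, 'e) pre_digraph \<Rightarrow> 'v \<Rightarrow> 'v set"
  where "neighbours G v = {u. v \<rightarrow>\<^bsub>G\<^esub> u}"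

abbreviation complete :: "('v, 'e) pre_digraph \<Rightarrow> bool"
  where "complete G \<equiv> complete_digraph (card (verts G)) G"

definition free_vertices :: "('v, 'e) pre_digraph \<Rightarrow> 'v set"
  where "free_vertices G = {v \<in> verts G. complete (G \<restriction> neighbours G v)}"

definition isolated_vertices :: "('v, 'e) pre_digraph \<Rightarrow> 'v set"
  where "isolated_vertices G = {v \<in> verts G. neighbours G v = {}}"

definition distance :: "('v, 'e) pre_digraph \<Rightarrow> 'v \<Rightarrow> 'v \<Rightarrow> nat"
  where "distance G u v = (LEAST l. \<exists>p. pre_digraph.awalk G u p v \<and> length p = l)"

definition diam :: "('v, 'e) pre_digraph \<Rightarrow> nat"
  where "diam G = Max {distance G u v | u v. u \<in> verts G \<and> v \<in> verts G}"

definition f_inv :: "('v, 'e) pre_digraph \<Rightarrow> nat"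
  where "f_inv G = card (free_vertices G)"

text \<open>
  For a symmetric digraph the strongly connected components \<^const>\<open>pre_digraph.sccs\<close> are the
  connected components of the graph.
\<close>
definition d_inv :: "('v, 'e) pre_digraph \<Rightarrow> nat"
  where "d_inv G = card (isolated_vertices G) + (\<Sum>H \<in> pre_digraph.sccs G. diam H)"

text \<open>
  Since \<^const>\<open>Digraph_Component.connected\<close> excludes the null graph, the separators \<open>T\<close>
  range over proper subsets of the vertex set, so that the null graph is not counted as
  disconnected.
\<close>
definition vertex_connectivity :: "('v, 'e) pre_digraph \<Rightarrow> nat"
  where "vertex_connectivity G =
    (if complete G then card (verts G) - 1
     else Min {card T | T. T \<subset> verts G \<and> \<not> Digraph_Component.connected (G \<restriction> (verts G - T))})"

end

theory Submission
  imports Defs "HOL-Library.Product_Lexorder"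
begin

text \<open>
  The graph \<open>G\<^sub>k\<close> has \<open>n = k + 4\<close> vertices: \<open>1\<close>, \<open>2\<close>, \<open>3\<close> and a set \<open>T\<close> of \<open>k + 1\<close> further ones. It is
  the union of the three cliques \<open>{1, 2}\<close>, \<open>{2} \<union> T\<close> and \<open>T \<union> {3}\<close>. Its free vertices are \<open>1\<close>
  and \<open>3\<close>, its diameter is their distance \<open>3\<close>, and \<open>2\<close> is a cut vertex. So \<open>f + d = 5\<close> and
  \<open>\<kappa> = 1\<close>, and both combinatorial expressions are equal to \<open>m + 3\<close> for every \<open>k\<close>. What takes work
  is that the depth is \<open>m + 3\<close>.

  The depth is read off from the Koszul cohomology of \<open>R / J\<close> on all variables: it is the least
  degree in which this does not vanish (\<open>depth_quot_module\<close>). That no regular sequence is longer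
  follows from the cohomology sequence of the multiplication by a regular element
  (\<open>koszul_vanish_regular_step_converse\<close>). That a regular sequence of this length exists follows,
  over a Noetherian ring, from prime avoidance (\<open>regular_element_exists\<close>, \<open>hilbert_basis\<close>).

  The cohomology is computed by decomposing ideals. If \<open>J = J\<^sub>1 \<inter> J\<^sub>2\<close>, the sequence
  \<open>0 \<rightarrow> R / J \<rightarrow> R / J\<^sub>1 \<oplus> R / J\<^sub>2 \<rightarrow> R / (J\<^sub>1 + J\<^sub>2) \<rightarrow> 0\<close> shows that \<open>R / J\<close> has depth exactly
  \<open>e + 1\<close> when \<open>R / (J\<^sub>1 + J\<^sub>2)\<close> has depth \<open>e\<close> and the other two have larger depth
  (\<open>koszul_vanish_Int\<close>, \<open>koszul_vanish_ideal_sum\<close>). Two kinds of intersections occur. One deletes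
  a set of cut vertices from a graph, or else completes part of its neighbourhood
  (\<open>edge_ideal_cut\<close>). The other takes a variable of a complete graph and deletes its row or its
  column (\<open>edge_ideal_corner\<close>). Both are instances of one argument with a substitution
  that sets some variables to zero (\<open>edge_ideal_Int\<close>).

  After the cuts only disjoint unions of cliques remain. Their ideals are the kernels of
  \<open>x\<^sub>i\<^sub>j \<mapsto> s\<^sub>i t\<^sub>j\<close> with separate \<open>s\<^sub>i\<close> for each clique, hence prime, so each variable is regular
  (\<open>live_var_regular\<close>), and the depth \<open>m + r - 1\<close> of a clique with \<open>r\<close> vertices follows
  by induction from the corner decomposition (\<open>depth_eq_segre\<close>). The clique \<open>{1, 3}\<close> without \<open>2\<close>
  and \<open>T\<close> has depth \<open>m + 1\<close>; two cuts, at \<open>T\<close> and at \<open>2\<close>, raise it to \<open>m + 3\<close>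
  (\<open>depth_cliques_graph\<close>).
\<close>

section \<open>Ideals of a subring\<close>

text \<open>
  All polynomial rings below are subrings \<open>R\<close> of one type, so that the arithmetic of the type
  class is available; ideals and generated ideals are relative to \<open>R\<close>.
\<close>
locale subring_of =
  fixes R :: "'a::comm_ring_1 set"
  assumes one_mem: "1 \<in> R"
    and diff_mem: "a \<in> R \<Longrightarrow> b \<in> R \<Longrightarrow> a - b \<in> R"
    and mult_mem: "a \<in> R \<Longrightarrow> b \<in> R \<Longrightarrow> a * b \<in> R"
begin

lemma zero_mem: "0 \<in> R" using diff_mem[OF one_mem one_mem] by simp
lemma uminus_mem: "a \<in> R \<Longrightarrow> - a \<in> R" using diff_mem[OF zero_mem, of a] by simp
lemma add_mem: "a \<in> R \<Longrightarrow> b \<in> R \<Longrightarrow> a + b \<in> R"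
  using diff_mem[of a "- b"] uminus_mem by simp

lemmas ring_mem = one_mem diff_mem mult_mem zero_mem uminus_mem add_mem

definition is_ideal :: "'a set \<Rightarrow> bool" where
  "is_ideal J \<longleftrightarrow> J \<subseteq> R \<and> 0 \<in> J \<and> (\<forall>a\<in>J. \<forall>b\<in>J. a + b \<in> J) \<and> (\<forall>r\<in>R. \<forall>a\<in>J. r * a \<in> J)"

inductive_set gen :: "'a set \<Rightarrow> 'a set" for A where
  gen_zero: "0 \<in> gen A"
| gen_step: "a \<in> A \<Longrightarrow> r \<in> R \<Longrightarrow> p \<in> gen A \<Longrightarrow> r * a + p \<in> gen A"

lemma is_idealD:
  assumes "is_ideal J"
  shows "J \<subseteq> R" "0 \<in> J" "\<And>a b. a \<in> J \<Longrightarrow> b \<in> J \<Longrightarrow> a + b \<in> J"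
    "\<And>r a. r \<in> R \<Longrightarrow> a \<in> J \<Longrightarrow> r * a \<in> J" "\<And>r a. r \<in> R \<Longrightarrow> a \<in> J \<Longrightarrow> a * r \<in> J"
    "\<And>a. a \<in> J \<Longrightarrow> - a \<in> J" "\<And>a b. a \<in> J \<Longrightarrow> b \<in> J \<Longrightarrow> a - b \<in> J" "\<And>a. a \<in> J \<Longrightarrow> a \<in> R"
proof -
  show *: "J \<subseteq> R" "0 \<in> J" "\<And>a b. a \<in> J \<Longrightarrow> b \<in> J \<Longrightarrow> a + b \<in> J"
    "\<And>r a. r \<in> R \<Longrightarrow> a \<in> J \<Longrightarrow> r * a \<in> J"
    using assms unfolding is_ideal_def by auto
  show "\<And>r a. r \<in> R \<Longrightarrow> a \<in> J \<Longrightarrow> a * r \<in> J" using *(4) by (simp add: mult.commute)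
  show m: "\<And>a. a \<in> J \<Longrightarrow> - a \<in> J" using *(4)[OF uminus_mem[OF one_mem]] by simp
  show "\<And>a b. a \<in> J \<Longrightarrow> b \<in> J \<Longrightarrow> a - b \<in> J"
    using *(3)[OF _ m] by fastforce
  show "\<And>a. a \<in> J \<Longrightarrow> a \<in> R" using *(1) by auto
qed

lemma is_ideal_sum_mem:
  "is_ideal J \<Longrightarrow> (\<And>i. i \<in> F \<Longrightarrow> f i \<in> J) \<Longrightarrow> sum f F \<in> J"
  by (induction F rule: infinite_finite_induct) (auto intro: is_idealD(2,3))

lemma gen_add: "p \<in> gen A \<Longrightarrow> q \<in> gen A \<Longrightarrow> p + q \<in> gen A"
  by (induction rule: gen.induct) (auto simp: add.assoc intro: gen_step)

lemma gen_ideal: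
  assumes "A \<subseteq> R"
  shows "is_ideal (gen A)"
proof -
  have "p \<in> R" if "p \<in> gen A" for p
    using that by induction (use assms in \<open>auto intro!: ring_mem\<close>)
  moreover have "r * p \<in> gen A" if "p \<in> gen A" "r \<in> R" for r p
    using that(1)
  proof induction
    case (gen_step a s p)
    then have "(r * s) * a + r * p \<in> gen A"
      using that(2) by (intro gen.gen_step) (auto intro: ring_mem)
    then show ?case by (simp add: algebra_simps)
  qed (simp add: gen_zero)
  ultimately show ?thesis
    unfolding is_ideal_def by (auto intro: gen_add gen_zero)
qed

lemma gen_incl: "a \<in> A \<Longrightarrow> a \<in> gen A"
  using gen_step[OF _ one_mem gen_zero] by fastforce

lemma gen_least: "is_ideal J \<Longrightarrow> A \<subseteq> J \<Longrightarrow> gen A \<subseteq> J"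
proof
  fix p assume J: "is_ideal J" "A \<subseteq> J" and "p \<in> gen A"
  from this(3) show "p \<in> J"
    by induction (use J is_idealD[OF J(1)] in auto)
qed

lemma gen_mono: "A \<subseteq> gen B \<Longrightarrow> B \<subseteq> R \<Longrightarrow> gen A \<subseteq> gen B"
  by (rule gen_least[OF gen_ideal])

definition ideal_sum :: "'a set \<Rightarrow> 'a set \<Rightarrow> 'a set" where
  "ideal_sum J J' = {a + b | a b. a \<in> J \<and> b \<in> J'}"

lemma ideal_sumI: "a \<in> J \<Longrightarrow> b \<in> J' \<Longrightarrow> a + b \<in> ideal_sum J J'"
  unfolding ideal_sum_def by blast

lemma ideal_sum_ideal:
  assumes "is_ideal J" "is_ideal J'"
  shows "is_ideal (ideal_sum J J')"
proof -
  note J = is_idealD[OF assms(1)] is_idealD[OF assms(2)]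
  have "(a + b) + (c + d) \<in> ideal_sum J J'" if "a \<in> J" "b \<in> J'" "c \<in> J" "d \<in> J'" for a b c d
    using ideal_sumI[OF J(3)[OF that(1,3)] J(11)[OF that(2,4)]] by (simp add: algebra_simps)
  moreover have "0 \<in> ideal_sum J J'" using ideal_sumI[OF J(2) J(10)] by simp
  moreover have "r * (a + b) \<in> ideal_sum J J'" if "r \<in> R" "a \<in> J" "b \<in> J'" for r a b
    using ideal_sumI[OF J(4)[OF that(1,2)] J(12)[OF that(1,3)]] by (simp add: distrib_left)
  moreover have "ideal_sum J J' \<subseteq> R"
    using J(1,9) unfolding ideal_sum_def by (auto intro!: add_mem)
  ultimately show ?thesis
    unfolding is_ideal_def by (auto simp: ideal_sum_def)
qed

lemma ideal_sum_gen:
  assumes "A \<subseteq> R" "B \<subseteq> R"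
  shows "ideal_sum (gen A) (gen B) = gen (A \<union> B)"
proof
  have AB: "is_ideal (gen (A \<union> B))" using assms by (intro gen_ideal) auto
  have "gen A \<subseteq> gen (A \<union> B)" "gen B \<subseteq> gen (A \<union> B)"
    by (rule gen_least[OF AB], blast intro: gen_incl)+
  then show "ideal_sum (gen A) (gen B) \<subseteq> gen (A \<union> B)"
    unfolding ideal_sum_def using is_idealD(3)[OF AB] by blast
  show "gen (A \<union> B) \<subseteq> ideal_sum (gen A) (gen B)"
  proof (rule gen_least)
    show "is_ideal (ideal_sum (gen A) (gen B))"
      using assms by (intro ideal_sum_ideal gen_ideal)
    show "A \<union> B \<subseteq> ideal_sum (gen A) (gen B)"
      using ideal_sumI[OF gen_incl gen_zero, of _ A B] ideal_sumI[OF gen_zero gen_incl, of _ B A]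
      by auto
  qed
qed

text \<open>\<open>f\<close> is a nonzerodivisor on \<open>R / J\<close>.\<close>
definition regular_on :: "'a set \<Rightarrow> 'a \<Rightarrow> bool" where
  "regular_on J f \<longleftrightarrow> (\<forall>u\<in>R. f * u \<in> J \<longrightarrow> u \<in> J)"

abbreviation adjoin :: "'a set \<Rightarrow> 'a \<Rightarrow> 'a set" where
  "adjoin J f \<equiv> ideal_sum J (gen {f})"

lemma gen_single: "gen {f} = {r * f | r. r \<in> R}"
proof
  have "\<exists>r. p = r * f \<and> r \<in> R" if "p \<in> gen {f}" for p
    using that
  proof induction
    case gen_zero
    show ?case using zero_mem by (intro exI[of _ 0]) auto
  next
    case (gen_step a r p)
    then obtain s where "p = s * f" "s \<in> R" by blast
    then show ?case using gen_step
      by (intro exI[of _ "r + s"]) (auto simp: algebra_simps intro: ring_mem)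
  qed
  then show "gen {f} \<subseteq> {r * f | r. r \<in> R}" by blast
  show "{r * f | r. r \<in> R} \<subseteq> gen {f}"
    using gen_step[OF _ _ gen_zero, of f "{f}"] by auto
qed

lemma adjoinD:
  assumes "p \<in> adjoin J f"
  shows "\<exists>r. r \<in> R \<and> p - f * r \<in> J"
  using assms unfolding ideal_sum_def gen_single by (auto simp: mult.commute)

lemma adjoinI:
  assumes "r \<in> R" "p - f * r \<in> J"
  shows "p \<in> adjoin J f"
proof -
  have "r * f \<in> gen {f}" using assms(1) unfolding gen_single by blast
  from ideal_sumI[OF assms(2) this] show ?thesis by (simp add: mult.commute)
qed

section \<open>Koszul cohomology of a cyclic module\<close>

text \<open>
  The Koszul complex \<open>K(x\<^sub>1, \<dots>, x\<^sub>p; R)\<close> is the exterior algebra on \<open>p\<close> generators; a cochain is a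
  function of the \<open>0/1\<close>-vectors of length \<open>p\<close> (the basis of the exterior algebra), and its
  cohomological degree is the number of ones. The recursion builds it as an iterated mapping cone
  of the multiplications by the \<open>x\<^sub>i\<close>.
\<close>
fun koszul :: "'a list \<Rightarrow> (bool list \<Rightarrow> 'a) \<Rightarrow> bool list \<Rightarrow> 'a" where
  "koszul (x # xs) c (False # A) = koszul xs (\<lambda>B. c (False # B)) A"
| "koszul (x # xs) c (True # A) = x * c (False # A) - koszul xs (\<lambda>B. c (True # B)) A"
| "koszul _ c _ = 0"

text \<open>
  Contraction with the vector \<open>(a\<^sub>1, \<dots>, a\<^sub>p)\<close>, an antiderivation of degree \<open>-1\<close>.
\<close>
fun contract :: "'a list \<Rightarrow> (bool list \<Rightarrow> 'a) \<Rightarrow> bool list \<Rightarrow> 'a" where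
  "contract (a # as) c (False # A) = a * c (True # A) + contract as (\<lambda>B. c (False # B)) A"
| "contract (a # as) c (True # A) = - contract as (\<lambda>B. c (True # B)) A"
| "contract _ c _ = 0"

definition cells :: "'a list \<Rightarrow> nat \<Rightarrow> bool list set" where
  "cells xs i = {A. length A = length xs \<and> count_list A True = i}"

lemma cells_Nil: "A \<in> cells [] i \<longleftrightarrow> A = [] \<and> i = 0"
  by (auto simp: cells_def)

lemma cells_Cons_iff:
  "A \<in> cells (x # xs) i \<longleftrightarrow>
     (\<exists>B\<in>cells xs i. A = False # B) \<or> (\<exists>B j. B\<in>cells xs j \<and> i = Suc j \<and> A = True # B)"
  by (cases A) (auto simp: cells_def)

lemma koszul_linear:
  "koszul xs (\<lambda>A. r * c A + s * c' A) A = r * koszul xs c A + s * koszul xs c' A"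
  by (induction xs c A arbitrary: c' rule: koszul.induct) (simp_all, simp_all (no_asm) add: algebra_simps)

lemma koszul_add: "koszul xs (\<lambda>A. c A + c' A) A = koszul xs c A + koszul xs c' A"
  using koszul_linear[of xs 1 c 1 c'] by simp
lemma koszul_diff: "koszul xs (\<lambda>A. c A - c' A) A = koszul xs c A - koszul xs c' A"
  using koszul_linear[of xs 1 c "-1" c'] by simp
lemma koszul_uminus: "koszul xs (\<lambda>A. - c A) A = - koszul xs c A"
  using koszul_linear[of xs 0 c "-1" c] by simp
lemma koszul_scale: "koszul xs (\<lambda>A. r * c A) A = r * koszul xs c A"
  using koszul_linear[of xs r c 0 c] by simp
lemma koszul_zero: "koszul xs (\<lambda>A. 0) A = 0"
  using koszul_linear[of xs 0 "\<lambda>_. 0" 0 "\<lambda>_. 0"] by simp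

lemma koszul_koszul: "koszul xs (koszul xs c) A = 0"
  by (induction xs c A rule: koszul.induct)
     (simp_all add: koszul_diff koszul_scale koszul_zero)

lemma contract_linear:
  "contract xs (\<lambda>A. r * c A + s * c' A) A = r * contract xs c A + s * contract xs c' A"
  by (induction xs c A arbitrary: c' rule: contract.induct) (simp_all, simp_all (no_asm) add: algebra_simps)
lemma contract_diff: "contract xs (\<lambda>A. c A - c' A) A = contract xs c A - contract xs c' A"
  using contract_linear[of xs 1 c "-1" c'] by simp
lemma contract_scale: "contract xs (\<lambda>A. r * c A) A = r * contract xs c A"
  using contract_linear[of xs r c 0 c] by simp

text \<open>
  Cartan's formula. It makes multiplication by any element \<open>\<Sum> a\<^sub>i x\<^sub>i\<close> of the ideal
  \<open>(x\<^sub>1, \<dots>, x\<^sub>p)\<close> null-homotopic, so that this ideal annihilates the cohomology.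
\<close>
lemma koszul_homotopy:
  assumes "length as = length xs" "length A = length xs"
  shows "koszul xs (contract as c) A + contract as (koszul xs c) A
    = (\<Sum>(a, x)\<leftarrow>zip as xs. a * x) * c A"
  using assms
proof (induction xs arbitrary: as A c)
  case (Cons x xs)
  obtain a as' where as: "as = a # as'" using Cons.prems by (cases as) auto
  obtain b B where A: "A = b # B" using Cons.prems by (cases A) auto
  note IH = Cons.IH[of as' B]
  show ?case
  proof (cases b)
    case True
    show ?thesis
      using IH[of "\<lambda>B. c (True # B)"] Cons.prems
      by (simp add: as A True koszul_uminus contract_diff contract_scale algebra_simps)
  next
    case False
    show ?thesis
      using IH[of "\<lambda>B. c (False # B)"] Cons.prems
      by (simp add: as A False koszul_add koszul_scale algebra_simps)
  qed
qed simp

definition coch :: "(bool list \<Rightarrow> 'a) \<Rightarrow> bool" where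
  "coch c \<longleftrightarrow> (\<forall>A. c A \<in> R)"

lemma coch_intros:
  "coch c \<Longrightarrow> coch c' \<Longrightarrow> coch (\<lambda>A. c A + c' A)"
  "coch c \<Longrightarrow> coch c' \<Longrightarrow> coch (\<lambda>A. c A - c' A)"
  "coch c \<Longrightarrow> r \<in> R \<Longrightarrow> coch (\<lambda>A. r * c A)"
  by (auto simp: coch_def intro: ring_mem)

lemma koszul_coch: "set xs \<subseteq> R \<Longrightarrow> coch c \<Longrightarrow> coch (koszul xs c)"
  unfolding coch_def
proof
  fix A assume "set xs \<subseteq> R" "\<forall>A. c A \<in> R"
  then show "koszul xs c A \<in> R"
    by (induction xs c A rule: koszul.induct) (auto intro: ring_mem)
qed

lemma contract_coch: "set xs \<subseteq> R \<Longrightarrow> coch c \<Longrightarrow> coch (contract xs c)"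
  unfolding coch_def
proof
  fix A assume "set xs \<subseteq> R" "\<forall>A. c A \<in> R"
  then show "contract xs c A \<in> R"
    by (induction xs c A rule: contract.induct) (auto intro: ring_mem)
qed

text \<open>
  The next lemmas say that the differential and the contraction respect congruence modulo \<open>J\<close>
  degree by degree; this is all that is needed to compute with representatives.
\<close>
lemma koszul_mem:
  assumes "is_ideal J" "set xs \<subseteq> R" "\<forall>A\<in>cells xs i. c A \<in> J"
  shows "\<forall>A\<in>cells xs (Suc i). koszul xs c A \<in> J"
  using assms(2,3)
proof (induction xs arbitrary: c i)
  case (Cons x xs)
  note J = is_idealD[OF assms(1)]
  show ?case
  proof
    fix A assume A: "A \<in> cells (x # xs) (Suc i)"
    have 1: "\<forall>B\<in>cells xs (Suc i). koszul xs (\<lambda>B. c (False # B)) B \<in> J"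
      using Cons by (intro Cons.IH) (auto simp: cells_Cons_iff)
    have 2: "koszul xs (\<lambda>B. c (True # B)) B \<in> J" if "B \<in> cells xs i" for B
    proof (cases i)
      case 0
      have "koszul xs c B = 0" if "B \<in> cells xs 0" for B xs c
        using that
      proof (induction xs arbitrary: B c)
        case (Cons x xs)
        then show ?case by (auto simp: cells_Cons_iff)
      qed simp
      then show ?thesis using that J by (auto simp: 0)
    next
      case (Suc j)
      have "\<forall>B\<in>cells xs (Suc j). koszul xs (\<lambda>B. c (True # B)) B \<in> J"
        using Cons by (intro Cons.IH) (auto simp: cells_Cons_iff Suc)
      then show ?thesis using that Suc by auto
    qed
    show "koszul (x # xs) c A \<in> J"
      using A 1 2 Cons.prems by (auto simp: cells_Cons_iff intro!: J(4) J(7))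
  qed
qed (simp add: cells_Nil)

lemma koszul_cells_0: "A \<in> cells xs 0 \<Longrightarrow> koszul xs c A = 0"
proof (induction xs arbitrary: A c)
  case (Cons x xs)
  then show ?case by (auto simp: cells_Cons_iff)
qed simp

lemma contract_mem:
  assumes "is_ideal J" "set as \<subseteq> R" "length as = length xs" "\<forall>A\<in>cells xs (Suc i). c A \<in> J"
  shows "\<forall>A\<in>cells xs i. contract as c A \<in> J"
  using assms(2-)
proof (induction xs arbitrary: c i as)
  case (Cons x xs)
  note J = is_idealD[OF assms(1)]
  obtain a as' where as: "as = a # as'" using Cons.prems by (cases as) auto
  show ?case
  proof
    fix A assume A: "A \<in> cells (x # xs) i"
    have 1: "\<forall>B\<in>cells xs i. contract as' (\<lambda>B. c (False # B)) B \<in> J"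
      using Cons by (intro Cons.IH) (auto simp: cells_Cons_iff as)
    have 2: "\<forall>B\<in>cells xs j. contract as' (\<lambda>B. c (True # B)) B \<in> J" if "i = Suc j" for j
      using Cons by (intro Cons.IH) (auto simp: cells_Cons_iff as that)
    have 3: "\<forall>B\<in>cells xs i. c (True # B) \<in> J"
      using Cons.prems by (auto simp: cells_Cons_iff)
    show "contract as c A \<in> J"
      using A 1 2 3 Cons.prems by (auto simp: cells_Cons_iff as intro!: J(3) J(4) J(6))
  qed
qed (simp add: cells_Nil is_idealD[OF assms(1)])

text \<open>
  Vanishing of the Koszul cohomology of \<open>R / J\<close> in all degrees below \<open>e\<close>. Residue classes are
  represented by elements of \<open>R\<close>.
\<close>
definition koszul_vanish :: "'a list \<Rightarrow> 'a set \<Rightarrow> nat \<Rightarrow> bool" where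
  "koszul_vanish xs J e \<longleftrightarrow> (\<forall>i<e. \<forall>c. coch c \<longrightarrow> (\<forall>A\<in>cells xs (Suc i). koszul xs c A \<in> J) \<longrightarrow>
     (\<exists>b. coch b \<and> (\<forall>A\<in>cells xs i. c A - koszul xs b A \<in> J)))"

lemma koszul_vanishD:
  assumes "koszul_vanish xs J e" "i < e" "coch c" "\<forall>A\<in>cells xs (Suc i). koszul xs c A \<in> J"
  obtains b where "coch b" "\<forall>A\<in>cells xs i. c A - koszul xs b A \<in> J"
  using assms unfolding koszul_vanish_def by blast

lemma koszul_vanish_0 [simp]: "koszul_vanish xs J 0"
  by (simp add: koszul_vanish_def)

lemma koszul_vanish_antimono: "koszul_vanish xs J e \<Longrightarrow> e' \<le> e \<Longrightarrow> koszul_vanish xs J e'"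
  unfolding koszul_vanish_def by (meson less_le_trans)

text \<open>
  In degree zero the cocycles are the elements of \<open>R / J\<close> killed by all \<open>x\<^sub>i\<close>, and there are no
  coboundaries.
\<close>
lemma socle_free_if_koszul_vanish:
  assumes J: "is_ideal J" and V: "koszul_vanish xs J 1"
    and u: "u \<in> R" "\<And>x. x \<in> set xs \<Longrightarrow> x * u \<in> J"
  shows "u \<in> J"
proof -
  have "koszul xs (\<lambda>_. u) A \<in> J" if "A \<in> cells xs 1" for A
    using that u(2)
  proof (induction xs arbitrary: A)
    case (Cons x xs)
    then show ?case by (auto simp: cells_Cons_iff koszul_cells_0)
  qed (simp add: cells_Nil)
  then obtain b where b: "\<forall>A\<in>cells xs 0. u - koszul xs b A \<in> J"
    using koszul_vanishD[OF V, of 0 "\<lambda>_. u"] u(1) by (simp add: coch_def) metis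
  have "replicate (length xs) False \<in> cells xs 0"
    by (simp add: cells_def)
  from b[rule_format, OF this] koszul_cells_0[OF this, of b] show ?thesis by simp
qed

text \<open>
  The cohomology sequence of \<open>0 \<rightarrow> R / J \<rightarrow> R / J \<rightarrow> R / (J + f) \<rightarrow> 0\<close>, whose first map is the
  multiplication by \<open>f\<close>, traced on cochains. A cocycle \<open>c\<close> modulo \<open>J + f\<close> satisfies
  \<open>d c = f w\<close> modulo \<open>J\<close>; then \<open>w\<close> is a cocycle one degree higher, hence \<open>w = d b\<close>, and
  \<open>c - f b\<close> is a cocycle modulo \<open>J\<close>.
\<close>
lemma koszul_vanish_regular_step:
  assumes J: "is_ideal J" and xs: "set xs \<subseteq> R" and f: "f \<in> R" and reg: "regular_on J f"
    and V: "koszul_vanish xs J (Suc e)"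
  shows "koszul_vanish xs (adjoin J f) e"
  unfolding koszul_vanish_def
proof (intro allI impI)
  note I = is_idealD[OF J]
  fix i c assume i: "i < e" and c: "coch c" and dc: "\<forall>A\<in>cells xs (Suc i). koszul xs c A \<in> adjoin J f"
  have "\<exists>r. r \<in> R \<and> (A \<in> cells xs (Suc i) \<longrightarrow> koszul xs c A - f * r \<in> J)" for A
    using dc zero_mem adjoinD[of "koszul xs c A" J f] by (cases "A \<in> cells xs (Suc i)") auto
  then obtain w where w: "\<And>A. w A \<in> R" "\<And>A. A \<in> cells xs (Suc i) \<Longrightarrow> koszul xs c A - f * w A \<in> J"
    by metis
  have cw: "coch w" using w by (simp add: coch_def)
  have "koszul xs w A \<in> J" if A: "A \<in> cells xs (Suc (Suc i))" for A
  proof -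
    have "koszul xs (\<lambda>A. koszul xs c A - f * w A) A \<in> J"
      using koszul_mem[OF J xs, of "Suc i" "\<lambda>A. koszul xs c A - f * w A"] w(2) A by simp
    then have "- (f * koszul xs w A) \<in> J"
      by (simp add: koszul_diff koszul_koszul koszul_scale)
    from I(6)[OF this] have "f * koszul xs w A \<in> J" by simp
    moreover have "koszul xs w A \<in> R" using koszul_coch[OF xs cw] by (simp add: coch_def)
    ultimately show ?thesis using reg by (simp add: regular_on_def)
  qed
  then obtain b where b: "coch b" "\<forall>A\<in>cells xs (Suc i). w A - koszul xs b A \<in> J"
    using koszul_vanishD[OF V, of "Suc i" w] i cw by auto
  let ?c = "\<lambda>A. c A - f * b A"
  have "koszul xs ?c A \<in> J" if A: "A \<in> cells xs (Suc i)" for A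
  proof -
    have "(koszul xs c A - f * w A) + f * (w A - koszul xs b A) \<in> J"
      using w(2)[OF A] b(2) A f by (intro I(3) I(4)) auto
    then show ?thesis by (simp add: koszul_diff koszul_scale algebra_simps)
  qed
  moreover have "coch ?c" using c b(1) f by (intro coch_intros)
  ultimately obtain a where a: "coch a" "\<forall>A\<in>cells xs i. ?c A - koszul xs a A \<in> J"
    using koszul_vanishD[OF V, of i ?c] i by auto
  have "c A - koszul xs a A \<in> adjoin J f" if "A \<in> cells xs i" for A
    using a(2) that b(1) by (intro adjoinI[of "b A"]) (auto simp: coch_def algebra_simps)
  then show "\<exists>b. coch b \<and> (\<forall>A\<in>cells xs i. c A - koszul xs b A \<in> adjoin J f)"
    using a(1) by blast
qed

lemma gen_coeffs:
  assumes "f \<in> gen (set xs)"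
  shows "\<exists>as. length as = length xs \<and> set as \<subseteq> R \<and> (\<Sum>(a, x)\<leftarrow>zip as xs. a * x) = f"
  using assms
proof induction
  case gen_zero
  have "(\<Sum>(a, x)\<leftarrow>zip (replicate (length xs) 0) xs. a * x) = 0"
    by (induction xs) auto
  then show ?case using zero_mem
    by (intro exI[of _ "replicate (length xs) 0"]) auto
next
  case (gen_step y r p)
  then obtain as where as: "length as = length xs" "set as \<subseteq> R" "(\<Sum>(a, x)\<leftarrow>zip as xs. a * x) = p"
    by blast
  obtain k where k: "k < length xs" "xs ! k = y"
    using gen_step by (meson in_set_conv_nth)
  let ?as = "as[k := as ! k + r]"
  have "(\<Sum>(a, x)\<leftarrow>zip ?as xs. a * x) = (\<Sum>i<length xs. ?as ! i * xs ! i)"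
    using as(1) by (simp add: sum_list_sum_nth atLeast0LessThan)
  also have "\<dots> = (\<Sum>i<length xs. as ! i * xs ! i + (if i = k then r * y else 0))"
    using as(1) k by (intro sum.cong) (auto simp: nth_list_update algebra_simps)
  also have "\<dots> = (\<Sum>(a, x)\<leftarrow>zip as xs. a * x) + r * y"
    using as(1) k by (simp add: sum.distrib sum_list_sum_nth atLeast0LessThan)
  finally have "(\<Sum>(a, x)\<leftarrow>zip ?as xs. a * x) = r * y + p" using as by simp
  moreover have "set ?as \<subseteq> R"
    using as(1,2) k gen_step(2) add_mem[of "as ! k" r] subsetD[OF as(2) nth_mem, of k]
    by (intro set_update_subsetI) auto
  ultimately show ?case using as(1) by (metis length_list_update)
qed

text \<open>
  Conversely, when \<open>f\<close> lies in the ideal of the \<open>x\<^sub>i\<close>, a cocycle \<open>c\<close> modulo \<open>J\<close> satisfies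
  \<open>f c = d h\<close> by Cartan's formula. So \<open>h\<close> is a cocycle modulo \<open>J + f\<close> of lower degree,
  \<open>h = d a + f b\<close>, and cancelling \<open>f\<close> in \<open>f c = f d b\<close> gives \<open>c = d b\<close>.
\<close>
lemma koszul_vanish_regular_step_converse:
  assumes J: "is_ideal J" and xs: "set xs \<subseteq> R" and f: "f \<in> gen (set xs)" and reg: "regular_on J f"
    and V: "koszul_vanish xs (adjoin J f) e"
  shows "koszul_vanish xs J (Suc e)"
  unfolding koszul_vanish_def
proof (intro allI impI)
  note I = is_idealD[OF J]
  have fR: "f \<in> R" using f is_idealD(8)[OF gen_ideal[OF xs]] by blast
  obtain as where as: "length as = length xs" "set as \<subseteq> R" "(\<Sum>(a, x)\<leftarrow>zip as xs. a * x) = f"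
    using gen_coeffs[OF f] by blast
  fix i c assume i: "i < Suc e" and c: "coch c" and dc: "\<forall>A\<in>cells xs (Suc i). koszul xs c A \<in> J"
  let ?h = "contract as c"
  have h: "coch ?h" using contract_coch[OF as(2) c] .
  have dh: "koszul xs ?h A - f * c A \<in> J" if A: "A \<in> cells xs i" for A
  proof -
    have "contract as (koszul xs c) A \<in> J"
      using contract_mem[OF J as(2,1) dc] A by blast
    moreover have "koszul xs ?h A + contract as (koszul xs c) A = f * c A"
      using koszul_homotopy[OF as(1), of A c] A as(3) by (simp add: cells_def)
    then have "koszul xs ?h A - f * c A = - contract as (koszul xs c) A"
      by (simp flip: \<open>_ = f * c A\<close>)
    ultimately show ?thesis using I(6) by simp
  qed
  obtain b where b: "coch b" "\<forall>A\<in>cells xs i. koszul xs ?h A - f * koszul xs b A \<in> J"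
  proof (cases i)
    case 0
    then have "\<forall>A\<in>cells xs i. koszul xs ?h A - f * koszul xs ?h A \<in> J"
      using I(2) by (auto simp: koszul_cells_0)
    then show ?thesis using that h by blast
  next
    case (Suc j)
    have "koszul xs ?h A \<in> adjoin J f" if "A \<in> cells xs (Suc j)" for A
      using dh[of A] that Suc c by (intro adjoinI[of "c A"]) (auto simp: coch_def)
    then obtain a where a: "coch a" "\<forall>A\<in>cells xs j. ?h A - koszul xs a A \<in> adjoin J f"
      using koszul_vanishD[OF V, of j ?h] i Suc h by auto
    have "\<exists>r. r \<in> R \<and> (A \<in> cells xs j \<longrightarrow> ?h A - koszul xs a A - f * r \<in> J)" for A
      using a zero_mem adjoinD[of "?h A - koszul xs a A" J f] by (cases "A \<in> cells xs j") auto
    then obtain b where b: "\<And>A. b A \<in> R"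
        "\<And>A. A \<in> cells xs j \<Longrightarrow> ?h A - koszul xs a A - f * b A \<in> J"
      by metis
    have "\<forall>A\<in>cells xs (Suc j). koszul xs (\<lambda>A. ?h A - koszul xs a A - f * b A) A \<in> J"
      using koszul_mem[OF J xs, of j "\<lambda>A. ?h A - koszul xs a A - f * b A"] b(2) by simp
    then show ?thesis
      using that[of b] b(1) Suc by (simp add: coch_def koszul_diff koszul_koszul koszul_scale)
  qed
  have "c A - koszul xs b A \<in> J" if A: "A \<in> cells xs i" for A
  proof -
    have "(koszul xs ?h A - f * koszul xs b A) - (koszul xs ?h A - f * c A) \<in> J"
      using b(2) dh A by (intro I(7)[of "_ - _" "_ - _"]) auto
    then have "f * (c A - koszul xs b A) \<in> J" by (simp add: algebra_simps)
    moreover have "c A - koszul xs b A \<in> R"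
      using c koszul_coch[OF xs b(1)] by (auto simp: coch_def intro: ring_mem)
    ultimately show ?thesis using reg by (simp add: regular_on_def)
  qed
  then show "\<exists>b. coch b \<and> (\<forall>A\<in>cells xs i. c A - koszul xs b A \<in> J)" using b(1) by blast
qed

text \<open>
  The two stretches of the cohomology sequence of
  \<open>0 \<rightarrow> R / (J \<inter> J') \<rightarrow> R / J \<oplus> R / J' \<rightarrow> R / (J + J') \<rightarrow> 0\<close> that are used. The first one bounds
  the depth of \<open>R / (J \<inter> J')\<close> from below. The second one bounds it from above: if the middle
  term has no cohomology in degrees below \<open>e\<close> and \<open>R / (J + J')\<close> has some, then this reappears
  one degree higher in \<open>R / (J \<inter> J')\<close>.
\<close>
lemma koszul_vanish_Int:
  assumes J: "is_ideal J" "is_ideal J'" and xs: "set xs \<subseteq> R"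
    and V: "koszul_vanish xs J e" "koszul_vanish xs J' e" "koszul_vanish xs (ideal_sum J J') (e - 1)"
  shows "koszul_vanish xs (J \<inter> J') e"
  unfolding koszul_vanish_def
proof (intro allI impI)
  note I = is_idealD[OF J(1)] and I' = is_idealD[OF J(2)]
  note S = is_idealD[OF ideal_sum_ideal[OF J]]
  fix i c assume i: "i < e" and c: "coch c" and dc: "\<forall>A\<in>cells xs (Suc i). koszul xs c A \<in> J \<inter> J'"
  obtain b where b: "coch b" "\<forall>A\<in>cells xs i. c A - koszul xs b A \<in> J"
    using koszul_vanishD[OF V(1) i c] dc by blast
  obtain b' where b': "coch b'" "\<forall>A\<in>cells xs i. c A - koszul xs b' A \<in> J'"
    using koszul_vanishD[OF V(2) i c] dc by blast
  show "\<exists>b. coch b \<and> (\<forall>A\<in>cells xs i. c A - koszul xs b A \<in> J \<inter> J')"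
  proof (cases i)
    case 0
    then have "\<forall>A\<in>cells xs i. c A - koszul xs b A \<in> J \<inter> J'"
      using b(2) b'(2) by (simp add: koszul_cells_0)
    then show ?thesis using b(1) by blast
  next
    case (Suc j)
    have "koszul xs (\<lambda>A. b A - b' A) A \<in> ideal_sum J J'" if A: "A \<in> cells xs (Suc j)" for A
    proof -
      have "- (c A - koszul xs b A) \<in> J" "c A - koszul xs b' A \<in> J'"
        using b b' A Suc by (blast intro: I(6))+
      from ideal_sumI[OF this] show ?thesis by (simp add: koszul_diff)
    qed
    moreover have "coch (\<lambda>A. b A - b' A)" using b b' by (intro coch_intros)
    ultimately obtain a where a: "coch a"
        "\<forall>A\<in>cells xs j. b A - b' A - koszul xs a A \<in> ideal_sum J J'"
      using koszul_vanishD[OF V(3), of j "\<lambda>A. b A - b' A"] i Suc less_diff_conv[of j e 1]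
      by (metis Suc_eq_plus1)
    have "\<exists>u. u \<in> J \<and> (A \<in> cells xs j \<longrightarrow> b A - b' A - koszul xs a A - u \<in> J')" for A
      using a(2) I(2) unfolding ideal_sum_def
      by (cases "A \<in> cells xs j") (auto, metis add_diff_cancel_left')
    then obtain u where u: "\<And>A. u A \<in> J"
        "\<And>A. A \<in> cells xs j \<Longrightarrow> b A - b' A - koszul xs a A - u A \<in> J'" by metis
    have cu: "coch u" using u I(8) by (auto simp: coch_def)
    let ?b = "\<lambda>A. b A - u A - koszul xs a A"
    have cb: "coch ?b" using b cu a koszul_coch[OF xs] by (intro coch_intros) auto
    have "c A - koszul xs ?b A \<in> J \<inter> J'" if A: "A \<in> cells xs i" for A
    proof
      have "koszul xs u A \<in> J" using koszul_mem[OF J(1) xs, of j u] u A Suc by simp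
      then have "(c A - koszul xs b A) + koszul xs u A \<in> J" using b A by (intro I(3)) auto
      then show "c A - koszul xs ?b A \<in> J" by (simp add: koszul_diff koszul_koszul) (simp add: algebra_simps)
      have "koszul xs (\<lambda>A. b A - b' A - koszul xs a A - u A) A \<in> J'"
        using koszul_mem[OF J(2) xs, of j "\<lambda>A. b A - b' A - koszul xs a A - u A"] u(2) A Suc by simp
      then have "(c A - koszul xs b' A)
          - koszul xs (\<lambda>A. b A - b' A - koszul xs a A - u A) A \<in> J'"
        using b' A by (intro I'(7)[of "_ - _" "koszul _ _ _"]) auto
      then show "c A - koszul xs ?b A \<in> J'" by (simp add: koszul_diff koszul_koszul) (simp add: algebra_simps)
    qed
    then show ?thesis using cb by blast
  qed
qed

lemma koszul_vanish_ideal_sum: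
  assumes J: "is_ideal J" "is_ideal J'" and xs: "set xs \<subseteq> R"
    and V: "koszul_vanish xs J e" "koszul_vanish xs J' e" "koszul_vanish xs (J \<inter> J') (Suc e)"
  shows "koszul_vanish xs (ideal_sum J J') e"
  unfolding koszul_vanish_def
proof (intro allI impI)
  note I = is_idealD[OF J(1)] and I' = is_idealD[OF J(2)]
  fix i c assume i: "i < e" and c: "coch c"
    and dc: "\<forall>A\<in>cells xs (Suc i). koszul xs c A \<in> ideal_sum J J'"
  have "\<exists>u. u \<in> J \<and> (A \<in> cells xs (Suc i) \<longrightarrow> koszul xs c A - u \<in> J')" for A
    using dc I(2) unfolding ideal_sum_def
    by (cases "A \<in> cells xs (Suc i)") (auto, metis add_diff_cancel_left')
  then obtain u where u: "\<And>A. u A \<in> J"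
      "\<And>A. A \<in> cells xs (Suc i) \<Longrightarrow> koszul xs c A - u A \<in> J'" by metis
  have cu: "coch u" using u I(8) by (auto simp: coch_def)
  have "koszul xs u A \<in> J \<inter> J'" if A: "A \<in> cells xs (Suc (Suc i))" for A
  proof
    show "koszul xs u A \<in> J" using koszul_mem[OF J(1) xs, of "Suc i" u] u A by simp
    have "koszul xs (\<lambda>A. koszul xs c A - u A) A \<in> J'"
      using koszul_mem[OF J(2) xs, of "Suc i" "\<lambda>A. koszul xs c A - u A"] u(2) A by simp
    from I'(6)[OF this] show "koszul xs u A \<in> J'" by (simp add: koszul_diff koszul_koszul)
  qed
  then obtain b where b: "coch b" "\<forall>A\<in>cells xs (Suc i). u A - koszul xs b A \<in> J \<inter> J'"
    using koszul_vanishD[OF V(3), of "Suc i" u] i cu by auto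
  have "koszul xs b A \<in> J" if "A \<in> cells xs (Suc i)" for A
    using I(7)[OF u(1)[of A], of "u A - koszul xs b A"] b(2) that by auto
  then obtain a where a: "coch a" "\<forall>A\<in>cells xs i. b A - koszul xs a A \<in> J"
    using koszul_vanishD[OF V(1) i b(1)] by blast
  have "koszul xs (\<lambda>A. c A - b A) A \<in> J'" if A: "A \<in> cells xs (Suc i)" for A
    using I'(3)[OF u(2)[OF A], of "u A - koszul xs b A"] b(2) A by (auto simp: koszul_diff)
  then obtain a' where a': "coch a'" "\<forall>A\<in>cells xs i. c A - b A - koszul xs a' A \<in> J'"
    using koszul_vanishD[OF V(2) i, of "\<lambda>A. c A - b A"] c b(1) by (auto intro: coch_intros)
  have "c A - koszul xs (\<lambda>A. a A + a' A) A \<in> ideal_sum J J'" if A: "A \<in> cells xs i" for A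
    using ideal_sumI[of "b A - koszul xs a A" J "c A - b A - koszul xs a' A" J'] a a' A
    by (simp add: koszul_add algebra_simps)
  then show "\<exists>b. coch b \<and> (\<forall>A\<in>cells xs i. c A - koszul xs b A \<in> ideal_sum J J')"
    using a(1) a'(1) coch_intros(1) by blast
qed

end

section \<open>Regular sequences over Noetherian rings\<close>

context subring_of
begin

definition noetherian :: bool where
  "noetherian \<longleftrightarrow> (\<forall>A\<subseteq>R. \<exists>B\<subseteq>A. finite B \<and> A \<subseteq> gen B)"

lemma noetherian_maximal:
  assumes N: noetherian and F: "F \<noteq> {}" "\<And>I. I \<in> F \<Longrightarrow> is_ideal I"
  shows "\<exists>M\<in>F. \<forall>I\<in>F. M \<subseteq> I \<longrightarrow> I = M"
proof (rule subset_Zorn_nonempty[OF F(1)])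
  fix C assume C: "C \<noteq> {}" "subset.chain F C"
  have CF: "C \<subseteq> F" using C(2) by (simp add: subset.chain_def)
  then have "\<Union>C \<subseteq> R" using F(2) is_idealD(1) by blast
  then obtain B where B: "B \<subseteq> \<Union>C" "finite B" "\<Union>C \<subseteq> gen B"
    using N unfolding noetherian_def by blast
  obtain I where I: "I \<in> C" "B \<subseteq> I"
    using finite_subset_Union_chain[OF B(2,1) C] by blast
  then have "gen B \<subseteq> I" using gen_least F(2) CF by blast
  then have "\<Union>C = I" using B(3) I(1) by blast
  then show "\<Union>C \<in> F" using I(1) CF by blast
qed

definition prime_set :: "'a set \<Rightarrow> bool" where
  "prime_set P \<longleftrightarrow> 1 \<notin> P \<and> (\<forall>a\<in>R. \<forall>b\<in>R. a * b \<in> P \<longrightarrow> a \<in> P \<or> b \<in> P)"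

lemma prime_set_avoids_common:
  assumes P: "prime_set P" and "finite B"
    and "\<And>b. b \<in> B \<Longrightarrow> is_ideal (I b)" "\<And>b. b \<in> B \<Longrightarrow> \<not> I b \<subseteq> P"
  shows "\<exists>r\<in>R. r \<notin> P \<and> (\<forall>b\<in>B. r \<in> I b)"
  using assms(2-)
proof (induction B rule: finite_induct)
  case empty
  show ?case using P one_mem by (auto simp: prime_set_def)
next
  case (insert b B)
  then obtain r where r: "r \<in> R" "r \<notin> P" "\<forall>b\<in>B. r \<in> I b" by auto
  obtain s where s: "s \<in> I b" "s \<notin> P" using insert.prems(2) by blast
  have "s \<in> R" using is_idealD(8)[OF insert.prems(1)] s(1) by blast
  then have "r * s \<notin> P" using P r s by (auto simp: prime_set_def)
  moreover have "r * s \<in> I c" if "c \<in> insert b B" for c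
    using that r s(1) \<open>s \<in> R\<close> is_idealD(4,5)[OF insert.prems(1)[OF that]] by auto
  ultimately show ?case using mult_mem[OF r(1) \<open>s \<in> R\<close>] by blast
qed

text \<open>
  Prime avoidance for an antichain of primes. The antichain makes the induction step immediate:
  if the element \<open>f\<close> found so far lies in the new prime \<open>P\<close>, add to it an element of \<open>I\<close> and of
  all the old primes that is outside \<open>P\<close>.
\<close>
lemma prime_avoidance:
  assumes "finite Ps" and I: "is_ideal I"
    and "\<And>P. P \<in> Ps \<Longrightarrow> is_ideal P \<and> prime_set P \<and> \<not> I \<subseteq> P"
    and "\<And>P Q. P \<in> Ps \<Longrightarrow> Q \<in> Ps \<Longrightarrow> Q \<subseteq> P \<Longrightarrow> Q = P"
  shows "\<exists>f\<in>I. \<forall>P\<in>Ps. f \<notin> P"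
  using assms(1,3,4)
proof (induction Ps rule: finite_induct)
  case empty
  show ?case using is_idealD(2)[OF I] by auto
next
  case (insert P Ps)
  note D = is_idealD
  have "\<exists>f\<in>I. \<forall>Q\<in>Ps. f \<notin> Q"
  proof (rule insert.IH)
    fix Q Q' assume "Q \<in> Ps" "Q' \<in> Ps" "Q' \<subseteq> Q"
    then show "Q' = Q" using insert.prems(2)[of Q Q'] by simp
  qed (simp add: insert.prems(1))
  then obtain f where f: "f \<in> I" "\<forall>Q\<in>Ps. f \<notin> Q" by blast
  have P: "is_ideal P" "prime_set P" "\<not> I \<subseteq> P" using insert.prems(1)[of P] by auto
  show ?case
  proof (cases "f \<in> P")
    case True
    have "\<exists>r\<in>R. r \<notin> P \<and> (\<forall>b\<in>insert I Ps. r \<in> id b)"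
    proof (rule prime_set_avoids_common[OF P(2)])
      fix Q assume Q: "Q \<in> insert I Ps"
      then show "is_ideal (id Q)" using I insert.prems(1) by auto
      show "\<not> id Q \<subseteq> P"
      proof (cases "Q \<in> Ps")
        case True
        then show ?thesis using insert.prems(2)[of P Q] insert.hyps(2) by auto
      qed (use Q P(3) in simp)
    qed (use insert.hyps in simp)
    then obtain g where g: "g \<notin> P" "g \<in> I" "\<forall>Q\<in>Ps. g \<in> Q" by auto
    have "f + g \<in> I" using D(3)[OF I] f g by blast
    moreover have "f + g \<notin> P"
      using D(7)[of P "f + g" f] P(1) True g(1) by auto
    moreover have "f + g \<notin> Q" if "Q \<in> Ps" for Q
      using D(7)[of Q "f + g" g] insert.prems(1)[of Q] that f(2) g(3) by auto
    ultimately show ?thesis by blast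
  qed (use f in blast)
qed

text \<open>
  The zerodivisors on \<open>R / J\<close> are covered by the maximal ones among the annihilators of nonzero
  elements. These are prime, and there are finitely many of them: the elements with a maximal
  annihilator generate an ideal that is already generated by finitely many of them, and the
  annihilator of a combination of \<open>u\<^sub>1, \<dots>, u\<^sub>k\<close> contains the intersection of the annihilators of
  the \<open>u\<^sub>i\<close>. Without a socle, the ideal generated by \<open>X\<close> is in none of these primes, so prime
  avoidance gives an element of it that is not a zerodivisor.
\<close>
lemma regular_element_exists:
  assumes N: noetherian and J: "is_ideal J" and X: "X \<subseteq> R"
    and socle: "\<And>u. u \<in> R \<Longrightarrow> (\<And>x. x \<in> X \<Longrightarrow> x * u \<in> J) \<Longrightarrow> u \<in> J"
  shows "\<exists>f\<in>gen X. regular_on J f"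
proof -
  note ID = is_idealD[OF J]
  define ann where "ann u = {r \<in> R. r * u \<in> J}" for u
  have ann_ideal: "is_ideal (ann u)" if "u \<in> R" for u
    using ID unfolding is_ideal_def ann_def
    by (auto simp: distrib_right mult.assoc intro: ring_mem)
  define maximal where "maximal u \<longleftrightarrow> u \<in> R - J \<and> (\<forall>v\<in>R - J. ann u \<subseteq> ann v \<longrightarrow> ann v = ann u)" for u
  \<comment> \<open>every zerodivisor lies in a maximal annihilator\<close>
  have above: "\<exists>v. maximal v \<and> ann u \<subseteq> ann v" if u: "u \<in> R - J" for u
  proof -
    let ?F = "{ann v | v. v \<in> R - J \<and> ann u \<subseteq> ann v}"
    have "\<exists>M\<in>?F. \<forall>I\<in>?F. M \<subseteq> I \<longrightarrow> I = M"
      using u by (intro noetherian_maximal[OF N]) (auto intro: ann_ideal)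
    then obtain v where v: "v \<in> R - J" "ann u \<subseteq> ann v"
        "\<forall>I\<in>?F. ann v \<subseteq> I \<longrightarrow> I = ann v" by blast
    have "ann w = ann v" if "w \<in> R - J" "ann v \<subseteq> ann w" for w
    proof -
      have "ann w \<in> ?F" using that v(2) by blast
      then show ?thesis using v(3) that(2) by blast
    qed
    then show ?thesis using v(1,2) unfolding maximal_def by blast
  qed
  have prime: "prime_set (ann u)" if u: "maximal u" for u
    unfolding prime_set_def
  proof (intro conjI ballI impI)
    show "1 \<notin> ann u" using u by (auto simp: ann_def maximal_def)
    fix a b assume ab: "a \<in> R" "b \<in> R" "a * b \<in> ann u"
    show "a \<in> ann u \<or> b \<in> ann u"
    proof (cases "b * u \<in> J")
      case False
      have "ann u \<subseteq> ann (b * u)"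
        using ID(4)[OF ab(2)] by (auto simp: ann_def) (metis mult.left_commute)
      then have "ann (b * u) = ann u"
        using u False ab(2) unfolding maximal_def by (auto intro: mult_mem)
      then show ?thesis using ab by (auto simp: ann_def mult.assoc)
    qed (use ab in \<open>simp add: ann_def\<close>)
  qed
  obtain B where B: "B \<subseteq> {u. maximal u}" "finite B" "{u. maximal u} \<subseteq> gen B"
    using N unfolding noetherian_def maximal_def
    by (metis (no_types, lifting) Diff_iff mem_Collect_eq subsetI)
  have BR: "B \<subseteq> R" using B(1) by (auto simp: maximal_def)
  \<comment> \<open>the finitely many elements of \<open>B\<close> realize all maximal annihilators\<close>
  have in_B: "ann u \<in> ann ` B" if u: "maximal u" for u
  proof (rule ccontr)
    assume no: "ann u \<notin> ann ` B"
    have "\<not> ann b \<subseteq> ann u" if "b \<in> B" for b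
      using no that B(1) u unfolding maximal_def by blast
    then obtain r where r: "r \<in> R" "r \<notin> ann u" "\<forall>b\<in>B. r \<in> ann b"
      using prime_set_avoids_common[OF prime[OF u] B(2), of ann] ann_ideal BR by blast
    have "r * p \<in> J" if "p \<in> gen B" for p
      using that
    proof induction
      case (gen_step a s p)
      then have "s * (r * a) + r * p \<in> J"
        using r by (intro ID(3)[of "s * _"] ID(4)[of s]) (auto simp: ann_def)
      then show ?case by (simp add: algebra_simps)
    qed (simp add: ID(2))
    then show False using r B(3) u by (auto simp: ann_def)
  qed
  have "\<exists>f\<in>gen X. \<forall>P\<in>ann ` B. f \<notin> P"
  proof (rule prime_avoidance)
    fix P assume "P \<in> ann ` B"
    then obtain b where b: "P = ann b" "maximal b" using B(1) by auto
    have "\<not> X \<subseteq> ann b" using socle[of b] b(2) by (auto simp: maximal_def ann_def)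
    then have "\<not> gen X \<subseteq> P" using gen_incl[of _ X] b(1) by blast
    then show "is_ideal P \<and> prime_set P \<and> \<not> gen X \<subseteq> P"
      using b ann_ideal prime by (auto simp: maximal_def)
  next
    fix P Q assume "P \<in> ann ` B" "Q \<in> ann ` B" "Q \<subseteq> P"
    then show "Q = P" using B(1) unfolding maximal_def by blast
  qed (use B(2) gen_ideal[OF X] in auto)
  then obtain f where f: "f \<in> gen X" "\<forall>b\<in>B. f \<notin> ann b" by blast
  have "u \<in> J" if u: "u \<in> R" "f * u \<in> J" for u
  proof (rule ccontr)
    assume "u \<notin> J"
    then obtain v where v: "maximal v" "ann u \<subseteq> ann v" using above u(1) by blast
    have "f \<in> ann u" using f(1) u is_idealD(8)[OF gen_ideal[OF X]] by (simp add: ann_def)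
    then show False using v in_B[OF v(1)] f(2) by auto
  qed
  then show ?thesis using f(1) by (auto simp: regular_on_def)
qed

fun reg_seq :: "'a set \<Rightarrow> 'a list \<Rightarrow> bool" where
  "reg_seq J [] \<longleftrightarrow> True"
| "reg_seq J (f # fs) \<longleftrightarrow> regular_on J f \<and> reg_seq (adjoin J f) fs"

text \<open>
  The next two lemmas together say that the maximal length of a regular sequence in
  \<open>(x\<^sub>1, \<dots>, x\<^sub>p)\<close> is the least degree in which the Koszul cohomology does not vanish.
\<close>
lemma reg_seq_exists:
  assumes N: noetherian and xs: "set xs \<subseteq> R"
    and "is_ideal J" "koszul_vanish xs J e"
  shows "\<exists>fs. length fs = e \<and> set fs \<subseteq> gen (set xs) \<and> reg_seq J fs"
  using assms(3,4)
proof (induction e arbitrary: J)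
  case (Suc e)
  obtain f where f: "f \<in> gen (set xs)" "regular_on J f"
    using regular_element_exists[OF N Suc.prems(1) xs]
      socle_free_if_koszul_vanish[OF Suc.prems(1) koszul_vanish_antimono[OF Suc.prems(2), of 1]]
    by auto
  have fR: "f \<in> R" using f(1) is_idealD(8)[OF gen_ideal[OF xs]] by blast
  obtain fs where "length fs = e" "set fs \<subseteq> gen (set xs)" "reg_seq (adjoin J f) fs"
    using Suc.IH[OF ideal_sum_ideal[OF Suc.prems(1) gen_ideal]
        koszul_vanish_regular_step[OF Suc.prems(1) xs fR f(2) Suc.prems(2)]] fR by auto
  then show ?case using f by (intro exI[of _ "f # fs"]) auto
qed simp

lemma koszul_vanish_reg_seq:
  assumes xs: "set xs \<subseteq> R" and "is_ideal J" "set fs \<subseteq> gen (set xs)" "reg_seq J fs"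
  shows "koszul_vanish xs J (length fs)"
  using assms(2-)
proof (induction fs arbitrary: J)
  case (Cons f fs)
  have fR: "f \<in> R" using Cons.prems(2) is_idealD(8)[OF gen_ideal[OF xs]] by auto
  have "koszul_vanish xs (adjoin J f) (length fs)"
    using Cons fR by (intro Cons.IH ideal_sum_ideal gen_ideal) auto
  then show ?case
    using koszul_vanish_regular_step_converse[OF Cons.prems(1) xs, of f "length fs"] Cons.prems
    by auto
qed simp

end

section \<open>Hilbert's basis theorem\<close>

definition monomials :: "'v set \<Rightarrow> ('v \<Rightarrow>\<^sub>0 nat) set" where
  "monomials V = {t. Poly_Mapping.keys t \<subseteq> V}"

definition polys :: "'v set \<Rightarrow> (('v \<Rightarrow>\<^sub>0 nat) \<Rightarrow>\<^sub>0 'k::field) set" where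
  "polys V = {p. Poly_Mapping.keys p \<subseteq> monomials V}"

lemma monomials_add: "s \<in> monomials V \<Longrightarrow> t \<in> monomials V \<Longrightarrow> s + t \<in> monomials V"
  using Poly_Mapping.keys_add[of s t] by (auto simp: monomials_def)

lemma single_in_polys: "t \<in> monomials V \<Longrightarrow> Poly_Mapping.single t c \<in> polys V"
  by (simp add: polys_def)

lemma subring_of_polys: "subring_of (polys V :: (('v \<Rightarrow>\<^sub>0 nat) \<Rightarrow>\<^sub>0 'k::field) set)"
proof
  fix p q :: "('v \<Rightarrow>\<^sub>0 nat) \<Rightarrow>\<^sub>0 'k" assume pq: "p \<in> polys V" "q \<in> polys V"
  show "p - q \<in> polys V"
    using pq Poly_Mapping.keys_add[of p "- q"] by (auto simp: polys_def)
  show "p * q \<in> polys V"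
    using pq keys_mult[of p q] monomials_add[of _ V] by (fastforce simp: polys_def)
qed (simp add: polys_def monomials_def)

lemma poly_mapping_expand: "p = (\<Sum>t\<in>Poly_Mapping.keys p. Poly_Mapping.single t (Poly_Mapping.lookup p t))"
proof (rule poly_mapping_eqI)
  fix t
  show "Poly_Mapping.lookup p t = Poly_Mapping.lookup (\<Sum>t\<in>Poly_Mapping.keys p. Poly_Mapping.single t (Poly_Mapping.lookup p t)) t"
    by (simp add: lookup_sum lookup_single when_def in_keys_iff)
qed

lemma lookup_single_mult:
  fixes p :: "('v \<Rightarrow>\<^sub>0 nat) \<Rightarrow>\<^sub>0 'k::field"
  shows "Poly_Mapping.lookup (Poly_Mapping.single s c * p) (s + t) = c * Poly_Mapping.lookup p t"
proof -
  have "Poly_Mapping.single s c * p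
      = (\<Sum>u\<in>Poly_Mapping.keys p. Poly_Mapping.single (s + u) (c * Poly_Mapping.lookup p u))"
    by (subst poly_mapping_expand[of p]) (simp add: sum_distrib_left mult_single)
  then show ?thesis
    by (simp add: lookup_sum lookup_single when_def in_keys_iff)
qed

lemma nat_seq_mono_subseq: "\<exists>r::nat \<Rightarrow> nat. strict_mono r \<and> mono (\<lambda>i. f (r i) :: nat)"
proof -
  obtain r where r: "strict_mono r" "monoseq (\<lambda>n. f (r n))" using seq_monosub by blast
  show ?thesis
  proof (cases "mono (\<lambda>i. f (r i))")
    case False
    then have dec: "f (r j) \<le> f (r i)" if "i \<le> j" for i j
      using r(2) that by (auto simp: monoseq_def mono_def)
    obtain N where N: "\<And>n. f (r N) \<le> f (r n)"
      using ex_has_least_nat[of "\<lambda>_. True" 0 "\<lambda>n. f (r n)"] by auto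
    have "f (r (N + i)) = f (r N)" for i using dec[of N "N + i"] N[of "N + i"] by simp
    then have "mono (\<lambda>i. f (r (N + i)))" by (simp add: mono_def)
    moreover have "strict_mono (\<lambda>i. r (N + i))" using r(1) by (simp add: strict_mono_def)
    ultimately show ?thesis by blast
  qed (use r in blast)
qed

lemma dickson_subseq:
  fixes f :: "nat \<Rightarrow> 'v \<Rightarrow> nat"
  assumes "finite V"
  shows "\<exists>r::nat \<Rightarrow> nat. strict_mono r \<and> (\<forall>v\<in>V. mono (\<lambda>i. f (r i) v))"
  using assms
proof (induction V rule: finite_induct)
  case empty
  show ?case by (auto intro: exI[of _ id] simp: strict_mono_def)
next
  case (insert w V)
  then obtain r :: "nat \<Rightarrow> nat" where r: "strict_mono r" "\<forall>v\<in>V. mono (\<lambda>i. f (r i) v)" by blast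
  obtain q :: "nat \<Rightarrow> nat" where q: "strict_mono q" "mono (\<lambda>i. f (r (q i)) w)"
    using nat_seq_mono_subseq[of "\<lambda>i. f (r i) w"] by blast
  have "mono (\<lambda>i. f (r (q i)) v)" if "v \<in> V" for v
    using r(2) that strict_mono_mono[OF q(1)] by (auto simp: mono_def)
  moreover have "strict_mono (\<lambda>i. r (q i))" using r(1) q(1) by (simp add: strict_mono_def)
  ultimately show ?case using q(2) by (intro exI[of _ "\<lambda>i. r (q i)"]) auto
qed

text \<open>Divisibility of monomials is a well-quasi-order.\<close>
lemma dickson_pair:
  assumes "finite V" "\<And>i. f i \<in> monomials V"
  shows "\<exists>i j u. i < (j::nat) \<and> f j = f i + u"
proof -
  obtain r :: "nat \<Rightarrow> nat" where r: "strict_mono r" "\<forall>v\<in>V. mono (\<lambda>i. Poly_Mapping.lookup (f (r i)) v)"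
    using dickson_subseq[OF assms(1), of "\<lambda>i. Poly_Mapping.lookup (f i)"] by blast
  have "Poly_Mapping.lookup (f (r 0)) v \<le> Poly_Mapping.lookup (f (r 1)) v" for v
  proof (cases "v \<in> V")
    case True
    then show ?thesis using r(2) by (auto simp: mono_def)
  next
    case False
    then have "Poly_Mapping.lookup (f (r 0)) v = 0"
      using assms(2)[of "r 0"] by (auto simp: monomials_def in_keys_iff)
    then show ?thesis by simp
  qed
  then have "f (r 1) = f (r 0) + (f (r 1) - f (r 0))"
    by (intro poly_mapping_eqI) (simp add: lookup_add lookup_minus)
  moreover have "r 0 < r 1" using r(1) by (simp add: strict_mono_def)
  ultimately show ?thesis by blast
qed

text \<open>
  The order on exponent vectors is the lexicographic one; a divisor is smaller.
\<close>
lemma monomial_le_add: "s \<le> s + (u :: 'v::linorder \<Rightarrow>\<^sub>0 nat)"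
proof -
  have "\<not> u < 0" by (simp add: less_poly_mapping.rep_eq less_fun_def)
  then have "s + 0 \<le> s + u" by (intro add_left_mono) simp
  then show ?thesis by simp
qed

lemma wf_monomials:
  assumes "finite (V :: 'v::linorder set)"
  shows "wf {(s, t). s \<in> monomials V \<and> t \<in> monomials V \<and> s < t}"
  unfolding wf_iff_no_infinite_down_chain
proof
  assume "\<exists>f. \<forall>i. (f (Suc i), f i) \<in> {(s, t). s \<in> monomials V \<and> t \<in> monomials V \<and> s < t}"
  then obtain f where f: "\<And>i. f i \<in> monomials V" "\<And>i. f (Suc i) < f i" by blast
  obtain i j u where ij: "i < j" "f j = f i + u" using dickson_pair[OF assms f(1)] by blast
  have "f j < f i" using ij(1) by (induction rule: less_Suc_induct) (auto intro: f(2) less_trans)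
  then show False using monomial_le_add[of "f i" u] ij(2) by simp
qed

text \<open>Dickson's lemma: the minimal elements form an antichain, which is finite.\<close>
lemma dickson:
  assumes V: "finite (V :: 'v::linorder set)" and L: "L \<subseteq> monomials V"
  shows "\<exists>M\<subseteq>L. finite M \<and> (\<forall>t\<in>L. \<exists>s\<in>M. \<exists>u. t = s + u)"
proof -
  define M where "M = {t\<in>L. \<forall>s\<in>L. \<forall>u. t = s + u \<longrightarrow> s = t}"
  have "finite M"
  proof (rule ccontr)
    assume "infinite M"
    then obtain f :: "nat \<Rightarrow> _" where f: "inj f" "range f \<subseteq> M"
      using infinite_countable_subset by blast
    then have "\<And>i. f i \<in> monomials V" using L by (auto simp: M_def)
    from dickson_pair[OF V this] obtain i j u where "i < j" "f j = f i + u" by blast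
    moreover have "f i \<in> L" "f j \<in> M" using f(2) by (auto simp: M_def)
    ultimately have "i < j" "f i = f j" unfolding M_def by blast+
    then show False using f(1) by (auto dest: injD)
  qed
  moreover have "\<exists>s\<in>M. \<exists>u. t = s + u" if "t \<in> L" for t
    using that
  proof (induction t rule: wf_induct_rule[OF wf_monomials[OF V]])
    case (1 t)
    show ?case
    proof (cases "t \<in> M")
      case True
      then show ?thesis by (intro bexI[of _ t] exI[of _ 0]) auto
    next
      case False
      then obtain s u where s: "s \<in> L" "t = s + u" "s \<noteq> t" using 1(2) by (auto simp: M_def)
      then have "s < t" using monomial_le_add[of s u] order_le_imp_less_or_eq by blast
      then obtain s' u' where "s' \<in> M" "s = s' + u'" using 1 s(1) L by blast
      then show ?thesis using s(2) by (auto simp: add.assoc)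
    qed
  qed
  ultimately show ?thesis by (intro exI[of _ M]) (auto simp: M_def)
qed

definition lead :: "(('v::linorder \<Rightarrow>\<^sub>0 nat) \<Rightarrow>\<^sub>0 'k::field) \<Rightarrow> 'v \<Rightarrow>\<^sub>0 nat" where
  "lead p = Max (Poly_Mapping.keys p)"

lemma lead_in_keys: "p \<noteq> 0 \<Longrightarrow> lead p \<in> Poly_Mapping.keys p"
  unfolding lead_def by (intro Max_in) auto

lemma keys_le_lead: "t \<in> Poly_Mapping.keys p \<Longrightarrow> t \<le> lead p"
  unfolding lead_def by (intro Max_ge) auto

text \<open>One step of the division algorithm lowers the leading monomial.\<close>
lemma lead_reduction:
  fixes p g :: "('v::linorder \<Rightarrow>\<^sub>0 nat) \<Rightarrow>\<^sub>0 'k::field"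
  assumes p: "p \<noteq> 0" and g: "g \<noteq> 0" and l: "lead p = s + lead g"
    and u: "u \<in> Poly_Mapping.keys (p - Poly_Mapping.single s
      (Poly_Mapping.lookup p (lead p) / Poly_Mapping.lookup g (lead g)) * g)"
  shows "u < lead p"
proof -
  let ?c = "Poly_Mapping.lookup p (lead p) / Poly_Mapping.lookup g (lead g)"
  let ?q = "p - Poly_Mapping.single s ?c * g"
  have "Poly_Mapping.lookup g (lead g) \<noteq> 0" using lead_in_keys[OF g] by (simp add: in_keys_iff)
  then have "Poly_Mapping.lookup ?q (lead p) = 0"
    by (simp add: lookup_minus l lookup_single_mult)
  then have "u \<noteq> lead p" using u by (auto simp: in_keys_iff)
  moreover have "u \<le> lead p"
  proof -
    have "u \<in> Poly_Mapping.keys p \<or> u \<in> Poly_Mapping.keys (Poly_Mapping.single s ?c * g)"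
      using u by (auto simp: in_keys_iff lookup_minus)
    then show ?thesis
    proof
      assume "u \<in> Poly_Mapping.keys (Poly_Mapping.single s ?c * g)"
      then obtain v where "v \<in> Poly_Mapping.keys g" "u = s + v"
        using keys_mult[of "Poly_Mapping.single s ?c" g] by (auto split: if_splits)
      then show ?thesis unfolding l using add_left_mono[OF keys_le_lead] by blast
    qed (rule keys_le_lead)
  qed
  ultimately show ?thesis by simp
qed

lemma (in subring_of) gen_finite_support:
  assumes "p \<in> gen A"
  shows "\<exists>B\<subseteq>A. finite B \<and> p \<in> gen B"
  using assms
proof induction
  case gen_zero
  show ?case by (intro exI[of _ "{}"]) (auto intro: gen.gen_zero)
next
  case (gen_step a r p)
  then obtain B where B: "B \<subseteq> A" "finite B" "p \<in> gen B" by blast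
  have "q \<in> gen (insert a B)" if "q \<in> gen B" for q
    using that by induction (auto intro: gen.intros)
  then have "r * a + p \<in> gen (insert a B)" using B gen_step by (intro gen.gen_step) auto
  then show ?case using B gen_step by (intro exI[of _ "insert a B"]) auto
qed

text \<open>
  Finitely many elements \<open>B\<close> of the ideal have leading monomials dividing all the others
  (Dickson), and the division algorithm shows that \<open>B\<close> generates the ideal.
\<close>
theorem hilbert_basis:
  assumes V: "finite (V :: 'v::linorder set)"
  shows "subring_of.noetherian (polys V :: (('v \<Rightarrow>\<^sub>0 nat) \<Rightarrow>\<^sub>0 'k::field) set)"
proof -
  interpret subring_of "polys V :: (('v \<Rightarrow>\<^sub>0 nat) \<Rightarrow>\<^sub>0 'k) set" by (rule subring_of_polys)
  show ?thesis
    unfolding noetherian_def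
  proof (intro allI impI)
    fix A :: "(('v \<Rightarrow>\<^sub>0 nat) \<Rightarrow>\<^sub>0 'k) set" assume A: "A \<subseteq> polys V"
    note I = is_idealD[OF gen_ideal[OF A]]
    let ?L = "lead ` (gen A - {0})"
    have lead_mon: "lead p \<in> monomials V" if "p \<in> gen A" "p \<noteq> 0" for p
      using I(8)[OF that(1)] lead_in_keys[OF that(2)] by (auto simp: polys_def)
    obtain M where M: "M \<subseteq> ?L" "finite M" "\<forall>t\<in>?L. \<exists>s\<in>M. \<exists>u. t = s + u"
      using dickson[OF V, of ?L] lead_mon by auto
    obtain B where B: "B \<subseteq> gen A - {0}" "finite B" "lead ` B = M"
      using finite_subset_image[OF M(2,1)] by blast
    have BR: "B \<subseteq> polys V" using B(1) I(8) by auto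
    note IB = is_idealD[OF gen_ideal[OF BR]]
    have gen_B: "p \<in> gen B" if "p \<in> gen A" "p \<noteq> 0" for p
      using that
    proof (induction "lead p" arbitrary: p rule: wf_induct_rule[OF wf_monomials[OF V]])
      case (1 p)
      obtain g s where g: "g \<in> B" "lead p = lead g + s" using M(3) B(3) 1(2,3) by blast
      let ?c = "Poly_Mapping.lookup p (lead p) / Poly_Mapping.lookup g (lead g)"
      let ?h = "Poly_Mapping.single s ?c"
      let ?q = "p - ?h * g"
      have "s \<in> monomials V"
        using lead_mon[OF 1(2,3)] g(2) by (auto simp: monomials_def in_keys_iff lookup_add)
      then have h: "?h \<in> polys V" by (rule single_in_polys)
      have q: "?q \<in> gen A" using 1(2) B(1) g(1) h by (intro I(7) I(4)) auto
      have "?q \<in> gen B"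
      proof (cases "?q = 0")
        case False
        have "lead ?q < lead p"
          using lead_reduction[of p g s "lead ?q"] lead_in_keys[OF False] 1(3) g B(1)
          by (auto simp: add.commute)
        then show ?thesis using 1(1)[of ?q] lead_mon 1(2,3) q False by blast
      qed (simp add: IB(2))
      moreover have "?h * g \<in> gen B" using h gen_incl[OF g(1)] by (rule IB(4))
      ultimately have "?q + ?h * g \<in> gen B" by (rule IB(3))
      then show ?case by simp
    qed
    have "\<forall>b\<in>B. \<exists>C\<subseteq>A. finite C \<and> b \<in> gen C" using gen_finite_support B(1) by blast
    then obtain C where C: "\<And>b. b \<in> B \<Longrightarrow> C b \<subseteq> A \<and> finite (C b) \<and> b \<in> gen (C b)" by metis
    let ?C = "\<Union>b\<in>B. C b"
    have CA: "?C \<subseteq> A" "finite ?C" using C B(2) by auto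
    then have CR: "?C \<subseteq> polys V" using A by blast
    have "b \<in> gen ?C" if "b \<in> B" for b
      using C[OF that] gen_least[OF gen_ideal[OF CR], of "C b"] gen_incl[of _ ?C] that by blast
    then have "gen B \<subseteq> gen ?C" by (intro gen_least gen_ideal CR) blast
    moreover have "A \<subseteq> gen B"
      using gen_B gen_incl[of _ A] IB(2) by (metis subsetI)
    ultimately show "\<exists>B\<subseteq>A. finite B \<and> A \<subseteq> gen B" using CA by blast
  qed
qed

section \<open>Depth from Koszul cohomology\<close>

definition grid :: "nat \<Rightarrow> nat \<Rightarrow> (nat \<times> nat) set" where
  "grid m n = {1..m} \<times> {1..n}"

abbreviation grid_polys :: "nat \<Rightarrow> nat \<Rightarrow> 'k::field mpoly set" where
  "grid_polys m n \<equiv> polys (grid m n)"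

lemma finite_grid: "finite (grid m n)"
  by (simp add: grid_def)

lemma carrier_poly_ring: "carrier (poly_ring m n) = grid_polys m n"
  by (auto simp: poly_ring_def polys_def monomials_def grid_def)

global_interpretation P: subring_of "grid_polys m n :: 'k::field mpoly set" for m n
  by (rule subring_of_polys)

context subring_of
begin

lemma ideal_sum_assoc: "ideal_sum (ideal_sum J A) B = ideal_sum J (ideal_sum A B)"
  unfolding ideal_sum_def by (auto; metis add.assoc)

lemma gen_empty: "gen {} = {0}"
  by (auto elim: gen.cases intro: gen_zero)

lemma ideal_sum_zero: "ideal_sum J {0} = J"
  unfolding ideal_sum_def by auto

lemma reg_seq_iff:
  assumes "set fs \<subseteq> R"
  shows "reg_seq J fs \<longleftrightarrow>
    (\<forall>i<length fs. regular_on (ideal_sum J (gen (set (take i fs)))) (fs ! i))"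
  using assms
proof (induction fs arbitrary: J)
  case (Cons f fs)
  have "set (take i fs) \<subseteq> R" for i using Cons.prems set_take_subset[of i fs] by auto
  then show ?case
    using Cons by (simp add: All_less_Suc2 gen_empty ideal_sum_zero ideal_sum_assoc ideal_sum_gen)
qed simp

end

lemma a_inv_poly_ring:
  assumes "p \<in> carrier (poly_ring m n)"
  shows "\<ominus>\<^bsub>poly_ring m n\<^esub> p = - (p :: 'k::field mpoly)"
proof -
  interpret R: cring "poly_ring m n :: 'k mpoly ring" by (rule poly_ring_cring)
  show ?thesis
    by (rule R.minus_equality) (use assms in \<open>simp_all del: poly_ring_simps(1) add: carrier_poly_ring P.uminus_mem\<close>)
qed

lemma ideal_poly_ring_iff:
  "ideal J (poly_ring m n :: 'k::field mpoly ring) \<longleftrightarrow> P.is_ideal m n J"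
proof
  interpret R: cring "poly_ring m n :: 'k mpoly ring" by (rule poly_ring_cring)
  show "P.is_ideal m n J" if "ideal J (poly_ring m n)"
  proof -
    interpret ideal J "poly_ring m n" by fact
    show ?thesis
      unfolding P.is_ideal_def using a_subset zero_closed a_closed I_l_closed
      by (simp add: carrier_poly_ring[symmetric] del: poly_ring_simps(1))
  qed
  show "ideal J (poly_ring m n)" if J: "P.is_ideal m n J"
  proof (rule idealI)
    note I = P.is_idealD[OF J]
    show "ring (poly_ring m n :: 'k mpoly ring)" by (rule R.ring_axioms)
    show "subgroup J (add_monoid (poly_ring m n))"
    proof (rule R.add.subgroupI)
      fix a assume a: "a \<in> J"
      then have "a \<in> carrier (poly_ring m n)" using I(8) by (simp add: carrier_poly_ring del: poly_ring_simps(1))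
      then show "\<ominus>\<^bsub>poly_ring m n\<^esub> a \<in> J" using a_inv_poly_ring I(6)[OF a] by metis
    qed (use I(1-3) in \<open>auto simp: carrier_poly_ring simp del: poly_ring_simps(1)\<close>)
  qed (use P.is_idealD(4,5)[OF J] in \<open>simp_all add: carrier_poly_ring del: poly_ring_simps(1)\<close>)
qed

lemma genideal_poly_ring:
  assumes "A \<subseteq> grid_polys m n"
  shows "Idl\<^bsub>poly_ring m n\<^esub> A = P.gen m n (A :: 'k::field mpoly set)"
proof
  show "Idl\<^bsub>poly_ring m n\<^esub> A \<subseteq> P.gen m n A"
    unfolding genideal_def using P.gen_ideal[OF assms] P.gen_incl
    by (intro Inter_lower) (auto simp: ideal_poly_ring_iff)
  show "P.gen m n A \<subseteq> Idl\<^bsub>poly_ring m n\<^esub> A"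
    unfolding genideal_def by (intro Inter_greatest P.gen_least) (auto simp: ideal_poly_ring_iff)
qed

text \<open>
  The notions of depth are stated for modules over a ring with a carrier. For the module
  \<open>R / J\<close>, membership of a residue class in \<open>(f\<^sub>1, \<dots>, f\<^sub>r) (R / J)\<close> is membership of its
  representative in \<open>J + (f\<^sub>1, \<dots>, f\<^sub>r)\<close>.
\<close>
context
  fixes m n :: nat and J :: "'k::field mpoly set"
  assumes J: "P.is_ideal m n J"
begin

private abbreviation (input) "R \<equiv> poly_ring m n :: 'k mpoly ring"
private abbreviation (input) "M \<equiv> quot_module R J"
private abbreviation (input) "cls a \<equiv> J +>\<^bsub>R\<^esub> a"

lemma cls_eq_iff:
  assumes "a \<in> grid_polys m n" "b \<in> grid_polys m n"
  shows "cls a = cls b \<longleftrightarrow> a - b \<in> J"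
proof
  note I = P.is_idealD[OF J]
  assume "cls a = cls b"
  moreover have "a \<in> cls a" using I(2) by (auto simp: a_r_coset_def' intro: bexI[of _ 0])
  ultimately show "a - b \<in> J" by (auto simp: a_r_coset_def')
next
  note I = P.is_idealD[OF J]
  assume ab: "a - b \<in> J"
  have "\<exists>y\<in>J. x + a = y + b" if "x \<in> J" for x
    using I(3)[OF that ab] by (intro bexI[of _ "x + (a - b)"]) simp_all
  moreover have "\<exists>y\<in>J. x + b = y + a" if "x \<in> J" for x
    using I(7)[OF that ab] by (intro bexI[of _ "x - (a - b)"]) simp_all
  ultimately show "cls a = cls b" by (auto simp: a_r_coset_def')
qed

lemma quot_module_simps:
  "carrier M = cls ` grid_polys m n"
  "\<zero>\<^bsub>M\<^esub> = cls 0"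
  "\<lbrakk>a \<in> grid_polys m n; b \<in> grid_polys m n\<rbrakk> \<Longrightarrow> cls a \<oplus>\<^bsub>M\<^esub> cls b = cls (a + b)"
  "\<lbrakk>a \<in> grid_polys m n; b \<in> grid_polys m n\<rbrakk> \<Longrightarrow> a \<odot>\<^bsub>M\<^esub> cls b = cls (a * b)"
proof -
  interpret R: cring R by (rule poly_ring_cring)
  interpret J: ideal J R using J by (simp add: ideal_poly_ring_iff)
  interpret h: ring_hom_cring R "R Quot J" "\<lambda>a. cls a"
    by (rule J.rcos_ring_hom_cring[OF R.is_cring])
  show "carrier M = cls ` grid_polys m n"
    by (auto simp: quot_module_def FactRing_def A_RCOSETS_def' carrier_poly_ring simp del: poly_ring_simps(1))
  show "\<zero>\<^bsub>M\<^esub> = cls 0"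
    using h.hom_zero by (simp add: quot_module_def)
  show "cls a \<oplus>\<^bsub>M\<^esub> cls b = cls (a + b)" if "a \<in> grid_polys m n" "b \<in> grid_polys m n"
    using h.hom_add[of a b] that by (simp add: quot_module_def carrier_poly_ring del: poly_ring_simps(1))
  show "a \<odot>\<^bsub>M\<^esub> cls b = cls (a * b)" if "a \<in> grid_polys m n" "b \<in> grid_polys m n"
    using h.hom_mult[of a b] that by (simp add: quot_module_def carrier_poly_ring del: poly_ring_simps(1))
qed

lemma seq_submodule_quot_module:
  assumes fs: "set fs \<subseteq> grid_polys m n"
  shows "seq_submodule R M fs = cls ` P.ideal_sum J (P.gen m n (set fs))"
proof
  let ?I = "P.ideal_sum J (P.gen m n (set fs))"
  note IJ = P.is_idealD[OF J]
  have I: "P.is_ideal m n ?I" using P.ideal_sum_ideal[OF J P.gen_ideal[OF fs]] .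
  note D = P.is_idealD[OF I]
  interpret M: module R M
    using quot_module_is_module[OF poly_ring_cring] J by (simp add: ideal_poly_ring_iff)
  show "seq_submodule R M fs \<subseteq> cls ` ?I"
    unfolding seq_submodule_def
  proof (rule Inter_lower, rule CollectI, rule conjI)
    show "submodule (cls ` ?I) R M"
    proof (rule M.submoduleI)
      show "cls ` ?I \<subseteq> carrier M" using D(1) by (auto simp: quot_module_simps(1))
      show "\<zero>\<^bsub>M\<^esub> \<in> cls ` ?I" using D(2) by (auto simp: quot_module_simps(2))
      show "a \<oplus>\<^bsub>M\<^esub> b \<in> cls ` ?I" if "a \<in> cls ` ?I" "b \<in> cls ` ?I" for a b
        using that D(3) D(8) quot_module_simps(3) by (auto simp del: poly_ring_simps) 
      show "a \<odot>\<^bsub>M\<^esub> b \<in> cls ` ?I" if "a \<in> carrier R" "b \<in> cls ` ?I" for a b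
        using that D(4) D(8) quot_module_simps(4)
        by (auto simp: carrier_poly_ring simp del: poly_ring_simps)
      show "\<ominus>\<^bsub>M\<^esub> a \<in> cls ` ?I" if a: "a \<in> cls ` ?I" for a
      proof -
        obtain b where b: "b \<in> ?I" "a = cls b" using a by blast
        have bR: "b \<in> grid_polys m n" "- b \<in> grid_polys m n" using D(8) b(1) P.uminus_mem by auto
        have "cls (- b) \<oplus>\<^bsub>M\<^esub> cls b = \<zero>\<^bsub>M\<^esub>"
          using quot_module_simps(2,3) bR by simp
        then have "\<ominus>\<^bsub>M\<^esub> cls b = cls (- b)"
          using bR by (intro M.minus_equality) (auto simp: quot_module_simps(1))
        then show ?thesis using b D(6) by auto
      qed
    qed
    show "{f \<odot>\<^bsub>M\<^esub> u |f u. f \<in> set fs \<and> u \<in> carrier M} \<subseteq> cls ` ?I"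
    proof clarify
      fix f u assume f: "f \<in> set fs" and "u \<in> carrier M"
      then obtain a where a: "a \<in> grid_polys m n" "u = cls a" by (auto simp: quot_module_simps(1))
      have "f \<in> ?I" using P.ideal_sumI[OF IJ(2) P.gen_incl[OF f]] by simp
      then show "f \<odot>\<^bsub>M\<^esub> u \<in> cls ` ?I"
        using a f fs quot_module_simps(4)[of f a] D(5)[of a f] by auto
    qed
  qed
  show "cls ` ?I \<subseteq> seq_submodule R M fs"
    unfolding seq_submodule_def
  proof (clarsimp simp del: poly_ring_simps)
    fix a H assume a: "a \<in> ?I" and H: "submodule H R M"
      and incl: "{f \<odot>\<^bsub>M\<^esub> u |f u. f \<in> set fs \<and> u \<in> carrier M} \<subseteq> H"
    obtain j g where jg: "j \<in> J" "g \<in> P.gen m n (set fs)" "a = j + g"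
      using a unfolding P.ideal_sum_def by blast
    have gR: "g \<in> grid_polys m n" using P.is_idealD(8)[OF P.gen_ideal[OF fs] jg(2)] .
    have "cls a = cls g" using jg gR IJ(8) by (subst cls_eq_iff) (auto intro: P.add_mem)
    moreover have "cls p \<in> H" if "p \<in> P.gen m n (set fs)" for p
      using that
    proof induction
      case gen_zero
      have "\<zero>\<^bsub>M\<^esub> \<in> H"
        using subgroup.one_closed[OF submodule.axioms(1)[OF H]] by simp
      then show ?case by (simp add: quot_module_simps(2))
    next
      case (gen_step f r p)
      have pR: "p \<in> grid_polys m n" using P.is_idealD(8)[OF P.gen_ideal[OF fs] gen_step(3)] .
      have fR: "f \<in> grid_polys m n" using gen_step fs by auto
      have "cls r \<in> carrier M" using gen_step(2) by (auto simp: quot_module_simps(1))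
      then have "f \<odot>\<^bsub>M\<^esub> cls r \<in> H" using gen_step(1) incl by blast
      then have "cls (f * r) \<in> H" using quot_module_simps(4)[OF fR gen_step(2)] by simp
      then have "cls (f * r) \<oplus>\<^bsub>M\<^esub> cls p \<in> H"
        using M.submoduleE(5)[OF H] gen_step by blast
      then show ?case
        using quot_module_simps(3)[OF P.mult_mem[OF fR gen_step(2)] pR] by (simp add: mult.commute)
    qed
    ultimately show "cls a \<in> H" using jg(2) by simp
  qed
qed

lemma regular_sequence_quot_module:
  assumes fs: "set fs \<subseteq> grid_polys m n"
  shows "regular_sequence R M fs \<longleftrightarrow>
    P.reg_seq m n J fs \<and> 1 \<notin> P.ideal_sum J (P.gen m n (set fs))"
proof -
  let ?I = "\<lambda>gs. P.ideal_sum J (P.gen m n (set gs))"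
  have mem: "cls a \<in> seq_submodule R M gs \<longleftrightarrow> a \<in> ?I gs"
    if gs: "set gs \<subseteq> grid_polys m n" and a: "a \<in> grid_polys m n" for gs a
  proof -
    note D = P.is_idealD[OF P.ideal_sum_ideal[OF J P.gen_ideal[OF gs]]]
    have JI: "j \<in> ?I gs" if "j \<in> J" for j
      using P.ideal_sumI[OF that P.gen_zero] by simp
    have "a \<in> ?I gs" if b: "cls a = cls b" "b \<in> ?I gs" for b
    proof -
      have "a - b \<in> J" using b a D(8) cls_eq_iff by blast
      from D(3)[OF JI[OF this] b(2)] show ?thesis by simp
    qed
    then show ?thesis unfolding seq_submodule_quot_module[OF gs] by blast
  qed
  have "(\<forall>u\<in>carrier M. (fs ! i) \<odot>\<^bsub>M\<^esub> u \<in> seq_submodule R M (take i fs) \<longrightarrow> u \<in> seq_submodule R M (take i fs))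
      \<longleftrightarrow> P.regular_on m n (?I (take i fs)) (fs ! i)" if i: "i < length fs" for i
  proof -
    have gs: "set (take i fs) \<subseteq> grid_polys m n" using fs set_take_subset[of i fs] by auto
    have f: "fs ! i \<in> grid_polys m n" using fs i nth_mem[OF i] by auto
    show ?thesis
      unfolding P.regular_on_def quot_module_simps(1)
      by (simp add: ball_simps quot_module_simps(4) f mem[OF gs] P.mult_mem[OF f])
  qed
  moreover have "seq_submodule R M fs \<noteq> carrier M \<longleftrightarrow> 1 \<notin> ?I fs"
  proof -
    note D = P.is_idealD[OF P.ideal_sum_ideal[OF J P.gen_ideal[OF fs]]]
    have "?I fs = grid_polys m n" if "1 \<in> ?I fs"
      using D(4)[OF _ that] D(1) by auto
    then have "seq_submodule R M fs = carrier M" if "1 \<in> ?I fs"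
      using that by (simp add: seq_submodule_quot_module[OF fs] quot_module_simps(1))
    moreover have "1 \<in> ?I fs" if "seq_submodule R M fs = carrier M"
      using mem[OF fs P.one_mem] that by (simp add: quot_module_simps(1) P.one_mem)
    ultimately show ?thesis by blast
  qed
  ultimately show ?thesis
    unfolding regular_sequence_def P.reg_seq_iff[OF fs]
    using fs by (auto simp: carrier_poly_ring simp del: poly_ring_simps)
qed

end

definition variables :: "nat \<Rightarrow> nat \<Rightarrow> 'k::field mpoly set" where
  "variables m n = (\<lambda>(i, j). xvar i j) ` grid m n"

lemma variables_polys: "variables m n \<subseteq> grid_polys m n"
  by (auto simp: variables_def xvar_def polys_def monomials_def)

lemma max_ideal_eq_gen: "max_ideal m n = P.gen m n (variables m n :: 'k::field mpoly set)"
proof -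
  have "{xvar i j | i j. i \<in> {1..m} \<and> j \<in> {1..n}} = (variables m n :: 'k mpoly set)"
    by (auto simp: variables_def grid_def) blast
  then show ?thesis
    unfolding max_ideal_def using genideal_poly_ring[OF variables_polys] by simp
qed

text \<open>In particular \<open>1\<close> is not in the maximal ideal.\<close>
lemma constant_term_max_ideal:
  assumes "p \<in> P.gen m n (variables m n :: 'k::field mpoly set)"
  shows "0 \<notin> Poly_Mapping.keys p"
  using assms
proof induction
  case (gen_step x r p)
  obtain v where x: "x = Poly_Mapping.single (Poly_Mapping.single v 1) 1"
    using gen_step(1) by (auto simp: variables_def xvar_def)
  have "0 \<notin> Poly_Mapping.keys (r * x)"
  proof
    assume "0 \<in> Poly_Mapping.keys (r * x)"
    then obtain t where "0 = t + Poly_Mapping.single v (1::nat)"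
      using keys_mult[of r x] by (auto simp: x)
    then have "Poly_Mapping.lookup (t + Poly_Mapping.single v (1::nat)) v = 0" by (metis lookup_zero)
    then show False by (simp add: lookup_add)
  qed
  then show ?case using gen_step Poly_Mapping.keys_add[of "r * x" p] by auto
qed simp

text \<open>
  Depth sensitivity of the Koszul complex on the variables: depth is the least degree with
  nonzero cohomology. Longer regular sequences would make the cohomology vanish further, and one
  of the right length exists because the polynomial ring is Noetherian.
\<close>
lemma depth_quot_module:
  fixes J :: "'k::field mpoly set"
  assumes J: "P.is_ideal m n J" "J \<subseteq> max_ideal m n" and xs: "set xs = variables m n"
    and V: "P.koszul_vanish m n xs J e" "\<not> P.koszul_vanish m n xs J (Suc e)"
  shows "depth (poly_ring m n) (max_ideal m n) (quot_module (poly_ring m n) J) = enat e"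
proof -
  have xsR: "set xs \<subseteq> grid_polys m n" using xs variables_polys by simp
  have I: "P.is_ideal m n (P.gen m n (variables m n :: 'k mpoly set))"
    by (rule P.gen_ideal[OF variables_polys])
  note D = P.is_idealD[OF I]
  have reg: "regular_sequence (poly_ring m n) (quot_module (poly_ring m n) J) fs \<longleftrightarrow> P.reg_seq m n J fs"
    if fs: "set fs \<subseteq> max_ideal m n" for fs
  proof -
    have "P.gen m n (set fs) \<subseteq> P.gen m n (variables m n)"
      using P.gen_least[OF I] fs by (simp add: max_ideal_eq_gen)
    then have "P.ideal_sum J (P.gen m n (set fs)) \<subseteq> P.gen m n (variables m n)"
      using D(3) J(2) unfolding P.ideal_sum_def by (auto simp: max_ideal_eq_gen)
    moreover have "1 \<notin> P.gen m n (variables m n :: 'k mpoly set)"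
      using constant_term_max_ideal[of 1] by auto
    moreover have "set fs \<subseteq> grid_polys m n" using fs D(1) by (auto simp: max_ideal_eq_gen)
    ultimately show ?thesis using regular_sequence_quot_module[OF J(1)] by blast
  qed
  have "length fs \<le> e" if "set fs \<subseteq> max_ideal m n" "P.reg_seq m n J fs" for fs
  proof (rule ccontr)
    assume "\<not> length fs \<le> e"
    moreover have "P.koszul_vanish m n xs J (length fs)"
      using P.koszul_vanish_reg_seq[OF xsR J(1)] that by (simp add: max_ideal_eq_gen xs)
    ultimately show False using V(2) P.koszul_vanish_antimono[of m n xs J "length fs" "Suc e"] by auto
  qed
  moreover
  have "\<exists>fs. length fs = e \<and> set fs \<subseteq> max_ideal m n \<and> P.reg_seq m n J fs"
    using P.reg_seq_exists[OF hilbert_basis[OF finite_grid] xsR J(1) V(1)] by (simp add: max_ideal_eq_gen xs)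
  then obtain fs where fs: "length fs = e" "set fs \<subseteq> max_ideal m n" "P.reg_seq m n J fs"
    by blast
  ultimately show ?thesis
    unfolding depth_def
  proof (intro antisym Sup_least Sup_upper)
    show "enat e \<in> {enat (length fs) | fs. set fs \<subseteq> max_ideal m n \<and>
        regular_sequence (poly_ring m n) (quot_module (poly_ring m n) J) fs}"
      using fs reg by blast
  qed (use reg in auto)
qed

section \<open>Maps given on monomials\<close>

text \<open>
  The linear map with \<open>t \<mapsto> h t\<close> on monomials. It is a ring homomorphism when \<open>h\<close> is
  multiplicative, which covers all substitutions of monomials or zero for the variables.
\<close>
definition lin :: "(('v \<Rightarrow>\<^sub>0 nat) \<Rightarrow> (('w \<Rightarrow>\<^sub>0 nat) \<Rightarrow>\<^sub>0 'k::field)) \<Rightarrow> (('v \<Rightarrow>\<^sub>0 nat) \<Rightarrow>\<^sub>0 'k) \<Rightarrow> (('w \<Rightarrow>\<^sub>0 nat) \<Rightarrow>\<^sub>0 'k)" where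
  "lin h p = (\<Sum>t\<in>Poly_Mapping.keys p. Poly_Mapping.single 0 (Poly_Mapping.lookup p t) * h t)"

lemma lin_add: "lin h (p + q) = lin h p + lin h q"
  unfolding lin_def by (rule setsum_keys_plus_distrib) (simp_all add: single_add distrib_right)

lemma lin_zero [simp]: "lin h 0 = 0"
  by (simp add: lin_def)

lemma lin_diff: "lin h (p - q) = lin h p - lin h q"
  using lin_add[of h "p - q" q] by (simp add: algebra_simps)

lemma lin_sum: "lin h (\<Sum>i\<in>I. p i) = (\<Sum>i\<in>I. lin h (p i))"
  by (induction I rule: infinite_finite_induct) (simp_all add: lin_add)

lemma lin_single: "lin h (Poly_Mapping.single t c) = Poly_Mapping.single 0 c * h t"
  by (cases "c = 0") (simp_all add: lin_def)

lemma lin_mult: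
  assumes "\<And>s t. h (s + t) = h s * h t"
  shows "lin h (p * q) = lin h p * lin h q"
proof -
  let ?s = "\<lambda>p t. Poly_Mapping.single t (Poly_Mapping.lookup p t)"
  have "p * q = (\<Sum>s\<in>Poly_Mapping.keys p. ?s p s) * (\<Sum>t\<in>Poly_Mapping.keys q. ?s q t)"
    using poly_mapping_expand[of p] poly_mapping_expand[of q] by simp
  also have "lin h \<dots> = (\<Sum>s\<in>Poly_Mapping.keys p. \<Sum>t\<in>Poly_Mapping.keys q. lin h (?s p s * ?s q t))"
    by (simp add: sum_product lin_sum)
  also have "\<dots> = (\<Sum>s\<in>Poly_Mapping.keys p. \<Sum>t\<in>Poly_Mapping.keys q.
      (Poly_Mapping.single 0 (Poly_Mapping.lookup p s) * h s) * (Poly_Mapping.single 0 (Poly_Mapping.lookup q t) * h t))"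
    by (intro sum.cong refl) (simp add: mult_single lin_single assms mult_ac flip: mult.assoc)
  also have "\<dots> = lin h p * lin h q"
    by (simp add: lin_def sum_product)
  finally show ?thesis .
qed

lemma keys_add_nat: "Poly_Mapping.keys (s + t) = Poly_Mapping.keys s \<union> Poly_Mapping.keys (t :: 'v \<Rightarrow>\<^sub>0 nat)"
  by (auto simp: in_keys_iff lookup_add)

text \<open>The variables \<open>xvar i j\<close>, indexed by one argument.\<close>
definition var :: "nat \<times> nat \<Rightarrow> 'k::field mpoly" where
  "var v = Poly_Mapping.single (Poly_Mapping.single v 1) 1"

lemma grid_iff: "(i, k) \<in> grid m n \<longleftrightarrow> i \<in> {1..m} \<and> k \<in> {1..n}"
  by (simp add: grid_def)

lemma monomial_split:
  fixes t :: "'v \<Rightarrow>\<^sub>0 nat"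
  assumes "v \<in> Poly_Mapping.keys t"
  obtains u where "t = Poly_Mapping.single v 1 + u"
proof
  show "t = Poly_Mapping.single v 1 + (t - Poly_Mapping.single v 1)"
    using assms by (intro poly_mapping_eqI) (auto simp: lookup_add lookup_minus lookup_single in_keys_iff when_def)
qed

lemma var_polys: "v \<in> V \<Longrightarrow> var v \<in> polys V"
  unfolding var_def by (rule single_in_polys) (simp add: monomials_def)

lemma single_in_gen_vars:
  fixes c :: "'k::field"
  assumes "t \<in> monomials V" "v \<in> Poly_Mapping.keys t"
  shows "Poly_Mapping.single t c \<in> subring_of.gen (polys V) {var v}"
proof -
  interpret subring_of "polys V :: 'k mpoly set" by (rule subring_of_polys)
  obtain u where u: "t = Poly_Mapping.single v 1 + u" using monomial_split[OF assms(2)] .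
  then have "u \<in> monomials V" using assms(1) by (simp add: monomials_def keys_add_nat)
  then have "Poly_Mapping.single u c * var v + 0 \<in> gen {var v}"
    by (intro gen_step gen_zero single_in_polys) simp
  then show ?thesis by (simp add: var_def mult_single u add.commute)
qed

text \<open>Substitution of zero for the variables in \<open>X\<close>.\<close>
definition kill :: "(nat \<times> nat) set \<Rightarrow> 'k::field mpoly \<Rightarrow> 'k mpoly" where
  "kill X = lin (\<lambda>t. if Poly_Mapping.keys t \<inter> X = {} then Poly_Mapping.single t 1 else 0)"

lemma kill_add: "kill X (p + q) = kill X p + kill X q"
  and kill_diff: "kill X (p - q) = kill X p - kill X q"
  and kill_mult: "kill X (p * q) = kill X p * kill X q"
  and kill_zero: "kill X 0 = 0"
  unfolding kill_def
  by (rule lin_add lin_diff lin_mult lin_zero; auto simp: keys_add_nat mult_single)+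

lemma kill_var: "kill X (var v) = (if v \<in> X then 0 else var v)"
  by (simp add: kill_def var_def lin_single mult_single)

lemma kill_retracts:
  assumes p: "(p :: 'k::field mpoly) \<in> polys V"
  shows "kill X p \<in> polys V" "p - kill X p \<in> subring_of.gen (polys V) (var ` (X \<inter> V))"
proof -
  interpret subring_of "polys V :: 'k mpoly set" by (rule subring_of_polys)
  let ?X = "var ` (X \<inter> V) :: 'k mpoly set"
  have X: "?X \<subseteq> polys V" by (auto intro: var_polys)
  note I = is_idealD[OF gen_ideal[OF X]]
  let ?s = "\<lambda>t. Poly_Mapping.single t (Poly_Mapping.lookup p t)"
  let ?r = "\<lambda>t. ?s t - kill X (?s t)"
  have 1: "?r t \<in> gen ?X" if t: "t \<in> Poly_Mapping.keys p" for t
  proof (cases "Poly_Mapping.keys t \<inter> X = {}")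
    case True
    then show ?thesis by (simp add: kill_def lin_single mult_single gen_zero)
  next
    case False
    then obtain v where v: "v \<in> Poly_Mapping.keys t" "v \<in> X" by blast
    have tV: "t \<in> monomials V" using p t by (auto simp: polys_def)
    have "var v \<in> ?X" using v tV by (auto simp: monomials_def)
    then have "gen {var v} \<subseteq> gen ?X" by (intro gen_mono X) (auto intro: gen_incl)
    then have "?s t \<in> gen ?X" using single_in_gen_vars[OF tV v(1)] by blast
    then show ?thesis using False by (simp add: kill_def lin_single)
  qed
  have sum: "(\<Sum>t\<in>F. ?r t) \<in> gen ?X" if "F \<subseteq> Poly_Mapping.keys p" for F
    using that
    by (induction F rule: infinite_finite_induct) (auto intro: I(2,3) 1)
  have "p - kill X p = (\<Sum>t\<in>Poly_Mapping.keys p. ?s t) - kill X (\<Sum>t\<in>Poly_Mapping.keys p. ?s t)"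
    using poly_mapping_expand[of p] by simp
  also have "\<dots> = (\<Sum>t\<in>Poly_Mapping.keys p. ?r t)"
    by (simp add: kill_def lin_sum sum_subtractf)
  finally show 2: "p - kill X p \<in> gen ?X" using sum by simp
  show "kill X p \<in> polys V"
    using diff_mem[OF p I(8)[OF 2]] by simp
qed

text \<open>
  The source of all intersection formulas below. Typically \<open>\<pi>\<close> sets a set of variables \<open>X\<close> to
  zero and \<open>C\<close> contains \<open>X\<close>. An element \<open>p\<close> of the intersection is \<open>(p - \<pi> p) + \<pi> p\<close>. Its second
  part only depends on the generators \<open>C\<close> after the substitution; in its first part, each term
  \<open>r g\<close> contributes \<open>(r - \<pi> r) g + \<pi> r (g - \<pi> g)\<close>.
\<close>
lemma (in subring_of) gen_Int_retract:
  assumes A: "A \<subseteq> R" and J: "is_ideal J"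
    and hom: "\<And>p q. \<pi> (p + q) = \<pi> p + \<pi> q" "\<And>p q. \<pi> (p * q) = \<pi> p * \<pi> q" "\<pi> 0 = 0"
    and R: "\<And>r. r \<in> R \<Longrightarrow> \<pi> r \<in> R"
    and 1: "\<And>r g. r \<in> R \<Longrightarrow> g \<in> A \<Longrightarrow> (r - \<pi> r) * g \<in> J"
    and 2: "\<And>g. g \<in> A \<Longrightarrow> g - \<pi> g \<in> J"
    and 3: "\<And>c. c \<in> C \<Longrightarrow> \<pi> c \<in> J"
  shows "gen A \<inter> gen C \<subseteq> J"
proof
  note I = is_idealD[OF J]
  fix p assume p: "p \<in> gen A \<inter> gen C"
  have "p - \<pi> p \<in> J" if "p \<in> gen A"
    using that
  proof induction
    case (gen_step g r p)
    have "(r - \<pi> r) * g + \<pi> r * (g - \<pi> g) + (p - \<pi> p) \<in> J"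
      using gen_step 1 2 R by (intro I(3) I(4)[of "\<pi> r"]) auto
    then show ?case by (simp add: hom algebra_simps)
  qed (simp add: hom I(2))
  moreover have "\<pi> p \<in> J" if "p \<in> gen C"
    using that
  proof induction
    case (gen_step c r p)
    then show ?case using 3 R I(3) I(4) by (simp add: hom)
  qed (simp add: hom I(2))
  ultimately have "(p - \<pi> p) + \<pi> p \<in> J" using p by (intro I(3)) auto
  then show "p \<in> J" by simp
qed

section \<open>Edge ideals with some variables set to zero\<close>

definition minor :: "nat \<Rightarrow> nat \<Rightarrow> nat \<Rightarrow> nat \<Rightarrow> 'k::field mpoly" where
  "minor i j k l = var (i, k) * var (j, l) - var (i, l) * var (j, k)"

text \<open>
  All the rings that occur are quotients of the same polynomial ring: \<open>L\<close> is the set of live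
  variables, and the others are set to zero. The relation \<open>E\<close> says which pairs of columns have
  vanishing minors. It may contain the diagonal, whose minors are zero.
\<close>
definition edge_gens :: "nat \<Rightarrow> nat \<Rightarrow> (nat \<times> nat) set \<Rightarrow> (nat \<times> nat) set \<Rightarrow> 'k::field mpoly set" where
  "edge_gens m n L E = var ` (grid m n - L) \<union>
     {minor i j k l | i j k l. (i, k) \<in> grid m n \<and> (j, l) \<in> grid m n \<and> (k, l) \<in> E}"

abbreviation edge_ideal :: "nat \<Rightarrow> nat \<Rightarrow> (nat \<times> nat) set \<Rightarrow> (nat \<times> nat) set \<Rightarrow> 'k::field mpoly set" where
  "edge_ideal m n L E \<equiv> P.gen m n (edge_gens m n L E)"

lemma minor_polys:
  "(i, k) \<in> grid m n \<Longrightarrow> (j, l) \<in> grid m n \<Longrightarrow> minor i j k l \<in> grid_polys m n"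
  unfolding minor_def
  by (intro P.diff_mem P.mult_mem var_polys) (auto simp: grid_iff)

lemma edge_gens_polys: "edge_gens m n L E \<subseteq> grid_polys m n"
  unfolding edge_gens_def using minor_polys by (auto intro: var_polys)

lemma edge_ideal_ideal: "P.is_ideal m n (edge_ideal m n L E)"
  by (rule P.gen_ideal[OF edge_gens_polys])

lemma var_in_edge_ideal: "v \<in> grid m n \<Longrightarrow> v \<notin> L \<Longrightarrow> var v \<in> edge_ideal m n L E"
  by (rule P.gen_incl) (auto simp: edge_gens_def)

lemma minor_in_edge_ideal:
  assumes "(i, k) \<in> grid m n" "(j, l) \<in> grid m n" "(k, l) \<in> E"
  shows "minor i j k l \<in> edge_ideal m n L E"
  using assms by (intro P.gen_incl) (auto simp: edge_gens_def)

lemma minor_in_edge_ideal_dead: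
  assumes "(i, k) \<in> grid m n" "(j, l) \<in> grid m n" "(\<forall>i. (i, k) \<notin> L) \<or> (\<forall>i. (i, l) \<notin> L)"
  shows "minor i j k l \<in> edge_ideal m n L E"
proof -
  note I = P.is_idealD[OF edge_ideal_ideal[of m n L E]]
  have g: "(i, l) \<in> grid m n" "(j, k) \<in> grid m n" using assms(1,2) by (auto simp: grid_iff)
  have v: "var (i, k) \<in> grid_polys m n" "var (j, k) \<in> grid_polys m n"
      "var (i, l) \<in> grid_polys m n" "var (j, l) \<in> grid_polys m n"
    using assms(1,2) g by (auto intro: var_polys)
  from assms(3) show ?thesis
  proof
    assume "\<forall>i. (i, k) \<notin> L"
    then have "var (i, k) \<in> edge_ideal m n L E" "var (j, k) \<in> edge_ideal m n L E"
      using var_in_edge_ideal[of _ m n L E] assms(1) g by blast+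
    then show ?thesis unfolding minor_def using v by (intro I(7) I(4)[of "var (i, l)"] I(5)) auto
  next
    assume "\<forall>i. (i, l) \<notin> L"
    then have "var (i, l) \<in> edge_ideal m n L E" "var (j, l) \<in> edge_ideal m n L E"
      using var_in_edge_ideal[of _ m n L E] assms(2) g by blast+
    then show ?thesis unfolding minor_def using v by (intro I(7) I(4)[of "var (i, k)"] I(5)[of "var (j, k)"]) auto
  qed
qed

lemma edge_ideal_mono:
  assumes "L' \<subseteq> L"
    and "\<And>k l. k \<in> {1..n} \<Longrightarrow> l \<in> {1..n} \<Longrightarrow> (k, l) \<in> E \<Longrightarrow>
      (k, l) \<in> E' \<or> (\<forall>i. (i, k) \<notin> L') \<or> (\<forall>i. (i, l) \<notin> L')"
  shows "edge_ideal m n L E \<subseteq> (edge_ideal m n L' E' :: 'k::field mpoly set)"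
proof (rule P.gen_least[OF edge_ideal_ideal])
  have "minor i j k l \<in> (edge_ideal m n L' E' :: 'k mpoly set)"
    if "(i, k) \<in> grid m n" "(j, l) \<in> grid m n" "(k, l) \<in> E" for i j k l
  proof -
    have "k \<in> {1..n}" "l \<in> {1..n}" using that by (simp_all add: grid_iff)
    from assms(2)[OF this that(3)] show ?thesis
      using minor_in_edge_ideal[OF that(1,2)] minor_in_edge_ideal_dead[OF that(1,2)] by blast
  qed
  moreover have "var v \<in> (edge_ideal m n L' E' :: 'k mpoly set)" if "v \<in> grid m n" "v \<notin> L" for v
    using that assms(1) by (intro var_in_edge_ideal) auto
  ultimately show "edge_gens m n L E \<subseteq> (edge_ideal m n L' E' :: 'k mpoly set)"
    unfolding edge_gens_def[of m n L E] by blast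
qed

lemma edge_ideal_cong:
  assumes "\<And>k l. k \<in> {1..n} \<Longrightarrow> l \<in> {1..n} \<Longrightarrow>
      (\<forall>i. (i, k) \<notin> L) \<or> (\<forall>i. (i, l) \<notin> L) \<or> ((k, l) \<in> E \<longleftrightarrow> (k, l) \<in> E')"
  shows "edge_ideal m n L E = edge_ideal m n L E'"
  using assms by (intro equalityI edge_ideal_mono) blast+

lemma edge_ideal_sum:
  "P.ideal_sum (edge_ideal m n L E) (edge_ideal m n L' E') = (edge_ideal m n (L \<inter> L') (E \<union> E') :: 'k::field mpoly set)"
proof -
  have "edge_gens m n L E \<union> edge_gens m n L' E' = (edge_gens m n (L \<inter> L') (E \<union> E') :: 'k mpoly set)"
    unfolding edge_gens_def by auto
  then show ?thesis by (simp add: P.ideal_sum_gen edge_gens_polys)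
qed

lemma edge_ideal_adjoin:
  assumes "v \<in> grid m n"
  shows "P.adjoin m n (edge_ideal m n L E) (var v) = (edge_ideal m n (L - {v}) E :: 'k::field mpoly set)"
proof -
  have "edge_gens m n L E \<union> {var v} = (edge_gens m n (L - {v}) E :: 'k mpoly set)"
    using assms unfolding edge_gens_def by auto
  then show ?thesis using assms by (simp add: P.ideal_sum_gen edge_gens_polys var_polys)
qed

lemma kill_minor:
  "kill X (minor i j k l) =
    (if (i, k) \<in> X \<or> (j, l) \<in> X then 0 else var (i, k) * var (j, l)) -
    (if (i, l) \<in> X \<or> (j, k) \<in> X then 0 else var (i, l) * var (j, k))"
  by (simp add: minor_def kill_diff kill_mult kill_var)

text \<open>
  The retraction lemma for the substitution of zero for the variables in \<open>X\<close>. Condition \<open>1\<close>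
  says that \<open>X\<close> multiplies the first ideal into \<open>J\<close>.
\<close>
lemma edge_ideal_Int:
  fixes J :: "'k::field mpoly set"
  assumes J: "J = edge_ideal m n L0 E0"
    and 1: "\<And>v g. v \<in> X \<inter> grid m n \<Longrightarrow> g \<in> edge_gens m n L E \<Longrightarrow> var v * g \<in> J"
    and 2: "\<And>g. g \<in> edge_gens m n L E \<Longrightarrow> g - kill X g \<in> J"
    and 3: "\<And>g. g \<in> edge_gens m n L' E' \<Longrightarrow> kill X g \<in> J"
    and sub: "J \<subseteq> edge_ideal m n L E" "J \<subseteq> edge_ideal m n L' E'"
  shows "J = edge_ideal m n L E \<inter> edge_ideal m n L' E'"
proof
  have JI: "P.is_ideal m n J" unfolding J by (rule edge_ideal_ideal)
  note I = P.is_idealD[OF JI]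
  show "edge_ideal m n L E \<inter> edge_ideal m n L' E' \<subseteq> J"
  proof (rule P.gen_Int_retract[OF edge_gens_polys JI kill_add kill_mult kill_zero kill_retracts(1)])
    fix r g :: "'k mpoly" assume r: "r \<in> grid_polys m n" and g: "g \<in> edge_gens m n L E"
    have "q * g \<in> J" if "q \<in> P.gen m n (var ` (X \<inter> grid m n))" for q
      using that
    proof induction
      case (gen_step x s q)
      have "s * (x * g) + q * g \<in> J"
        using gen_step 1 g by (intro I(3)[of "s * _"] I(4)[of s]) auto
      then show ?case by (simp add: algebra_simps)
    qed (simp add: I(2))
    then show "(r - kill X r) * g \<in> J" using kill_retracts(2)[OF r] by blast
  qed (use 2 3 in auto)
qed (use sub in blast)

text \<open>
  Let \<open>E'\<close> arise from the graph \<open>E\<close> by joining some common neighbours of all vertices of \<open>T\<close>.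
  Then the ideal of \<open>E\<close> is the intersection of the ideal of \<open>E'\<close> with the ideal in which the
  vertices of \<open>T\<close> are deleted, that is, their variables are set to zero. The reason is that a
  variable in a column of \<open>T\<close> multiplies each new minor into the ideal of \<open>E\<close>.
\<close>
lemma edge_ideal_cut:
  assumes "E \<subseteq> E'"
    and T: "\<And>a b. a \<in> {1..n} \<Longrightarrow> b \<in> {1..n} \<Longrightarrow> (a, b) \<in> E' \<Longrightarrow> (a, b) \<notin> E \<Longrightarrow>
      a \<notin> T \<and> b \<notin> T \<and> (\<forall>t\<in>T \<inter> {1..n}. (t, a) \<in> E \<and> (t, b) \<in> E)"
  shows "edge_ideal m n L E
    = (edge_ideal m n L E' \<inter> edge_ideal m n (L - UNIV \<times> T) E :: 'k::field mpoly set)"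
proof (rule edge_ideal_Int[OF refl, where X = "UNIV \<times> T"])
  let ?J = "edge_ideal m n L E :: 'k mpoly set"
  note I = P.is_idealD[OF edge_ideal_ideal[of m n L E, where 'a = 'k]]
  have kill_gen: "kill (UNIV \<times> T) g = 0 \<or> kill (UNIV \<times> T) g = g"
    if "g \<in> edge_gens m n L E'" for g :: "'k mpoly" and L E'
    using that unfolding edge_gens_def
    by (auto simp: kill_var kill_minor) (auto simp: minor_def)
  show "var v * g \<in> ?J" if v: "v \<in> UNIV \<times> T \<inter> grid m n" and g: "g \<in> edge_gens m n L E'" for v and g :: "'k mpoly"
  proof -
    obtain h t where ht: "v = (h, t)" "t \<in> T" "(h, t) \<in> grid m n" using v by auto
    have vR: "var v \<in> grid_polys m n" using v by (auto intro: var_polys)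
    consider (in_J) "g \<in> ?J"
      | (new) i j a b where "g = minor i j a b" "(i, a) \<in> grid m n" "(j, b) \<in> grid m n"
          "(a, b) \<in> E'" "(a, b) \<notin> E"
      using g minor_in_edge_ideal[of _ _ m n _ _ E L] var_in_edge_ideal[of _ m n L E]
      unfolding edge_gens_def by blast
    then show ?thesis
    proof cases
      case in_J
      then show ?thesis using I(4) vR by blast
    next
      case (new i j a b)
      have "a \<in> {1..n}" "b \<in> {1..n}" "t \<in> {1..n}" using new ht by (simp_all add: grid_iff)
      then have ab: "(t, a) \<in> E" "(t, b) \<in> E" using T[of a b] new(4,5) ht(2) by blast+
      have g: "(h, t) \<in> grid m n" "(i, t) \<in> grid m n" "(j, t) \<in> grid m n" "(h, a) \<in> grid m n"
          "(i, a) \<in> grid m n" "(i, b) \<in> grid m n" "(j, b) \<in> grid m n"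
        using new ht by (auto simp: grid_iff)
      \<comment> \<open>three exchanges with column \<open>t\<close> perform the exchange between the columns \<open>a\<close> and \<open>b\<close>\<close>
      have "minor h i t a * var (j, b) + minor i j t b * var (h, a) + minor j h t a * var (i, b) \<in> ?J"
        using g ab by (intro I(3) I(5) minor_in_edge_ideal var_polys)
      then show ?thesis unfolding new ht minor_def by (simp add: algebra_simps)
    qed
  qed
  show "g - kill (UNIV \<times> T) g \<in> ?J" if g: "g \<in> edge_gens m n L E'" for g :: "'k mpoly"
  proof (cases "g \<in> ?J")
    case True
    then show ?thesis using kill_gen[OF g] I(2) by auto
  next
    case False
    then obtain i j a b where new: "g = minor i j a b" "(i, a) \<in> grid m n" "(j, b) \<in> grid m n"
          "(a, b) \<in> E'" "(a, b) \<notin> E"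
      using g minor_in_edge_ideal[of _ _ m n _ _ E L] var_in_edge_ideal[of _ m n L E]
      unfolding edge_gens_def by blast
    then have "a \<in> {1..n}" "b \<in> {1..n}" by (simp_all add: grid_iff)
    then have "a \<notin> T" "b \<notin> T" using T[of a b] new(4,5) by blast+
    then have "kill (UNIV \<times> T) g = g" unfolding new(1) by (subst kill_minor) (simp add: minor_def)
    then show ?thesis using I(2) by simp
  qed
  show "kill (UNIV \<times> T) g \<in> ?J" if g: "g \<in> edge_gens m n (L - UNIV \<times> T) E" for g :: "'k mpoly"
  proof (cases "g \<in> ?J")
    case True
    then show ?thesis using kill_gen[OF g] I(2) by auto
  next
    case False
    then obtain v where "g = var v" "v \<in> UNIV \<times> T"
      using g minor_in_edge_ideal[of _ _ m n _ _ E L] var_in_edge_ideal[of _ m n L E]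
      unfolding edge_gens_def by blast
    then show ?thesis by (simp add: kill_var I(2))
  qed
  show "?J \<subseteq> edge_ideal m n L E'" "?J \<subseteq> edge_ideal m n (L - UNIV \<times> T) E"
    by (rule edge_ideal_mono; use assms(1) in blast)+
qed

text \<open>
  For the complete graph, with \<open>x\<^sub>i\<^sub>j = s\<^sub>i t\<^sub>j\<close> in mind: \<open>x\<^sub>r\<^sub>c = 0\<close> means \<open>s\<^sub>r = 0\<close> or \<open>t\<^sub>c = 0\<close>, so
  setting one variable to zero is the intersection of deleting its row and deleting its column.
\<close>
lemma edge_ideal_corner:
  assumes rc: "r \<in> U" "c \<in> W" and UW: "U \<times> W \<subseteq> grid m n"
  shows "edge_ideal m n (U \<times> W - {(r, c)}) UNIV
    = (edge_ideal m n (U \<times> (W - {c})) UNIV \<inter> edge_ideal m n ((U - {r}) \<times> W) UNIV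
        :: 'k::field mpoly set)"
proof (rule edge_ideal_Int[OF refl, where X = "{r} \<times> UNIV"])
  let ?J = "edge_ideal m n (U \<times> W - {(r, c)}) UNIV :: 'k mpoly set"
  let ?X = "{r} \<times> UNIV"
  note I = P.is_idealD[OF edge_ideal_ideal[of m n "U \<times> W - {(r, c)}" UNIV, where 'a = 'k]]
  have kill_gen: "kill ?X g = 0 \<or> kill ?X g = g" if "g \<in> edge_gens m n L E" for g :: "'k mpoly" and L E
    using that unfolding edge_gens_def
    by (auto simp: kill_var kill_minor) (auto simp: minor_def)
  have minor: "minor i j k l \<in> ?J" if "(i, k) \<in> grid m n" "(j, l) \<in> grid m n" for i j k l
    using that by (intro minor_in_edge_ideal) auto
  have dead: "var v \<in> ?J" if "v \<in> grid m n" "v \<notin> U \<times> W - {(r, c)}" for v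
    using that by (rule var_in_edge_ideal)
  have new: "\<exists>v. g = var v \<and> v \<in> U \<times> W \<and> v \<notin> L \<and> v \<in> grid m n"
    if "g \<in> edge_gens m n L UNIV" "g \<notin> ?J" for g L
    using that minor dead unfolding edge_gens_def[of m n L] by blast
  show "var v * g \<in> ?J" if v: "v \<in> ?X \<inter> grid m n"
    and g: "g \<in> edge_gens m n (U \<times> (W - {c})) UNIV" for v and g :: "'k mpoly"
  proof -
    obtain q where q: "v = (r, q)" "(r, q) \<in> grid m n" using v by auto
    have vR: "var v \<in> grid_polys m n" using v by (auto intro: var_polys)
    consider (in_J) "g \<in> ?J" | (col) i where "g = var (i, c)" "(i, c) \<in> grid m n"
      using new[OF g] by blast
    then show ?thesis
    proof cases
      case in_J
      then show ?thesis using I(4) vR by blast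
    next
      case (col i)
      have "(r, c) \<in> grid m n" "(i, q) \<in> grid m n" using rc UW col q by (auto simp: grid_iff)
      then have "minor r i q c + var (r, c) * var (i, q) \<in> ?J"
        using col q dead by (intro I(3) I(5) minor var_polys) auto
      then show ?thesis unfolding col q minor_def by simp
    qed
  qed
  show "g - kill ?X g \<in> ?J" if g: "g \<in> edge_gens m n (U \<times> (W - {c})) UNIV" for g :: "'k mpoly"
  proof (cases "g \<in> ?J")
    case True
    then show ?thesis using kill_gen[OF g] I(2) by auto
  next
    case False
    then obtain i where "g = var (i, c)" "i \<noteq> r"
      using new[OF g] rc False dead by blast
    then show ?thesis by (simp add: kill_var I(2))
  qed
  show "kill ?X g \<in> ?J" if g: "g \<in> edge_gens m n ((U - {r}) \<times> W) UNIV" for g :: "'k mpoly"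
  proof (cases "g \<in> ?J")
    case True
    then show ?thesis using kill_gen[OF g] I(2) by auto
  next
    case False
    then obtain j where "g = var (r, j)"
      using new[OF g] by blast
    then show ?thesis by (simp add: kill_var I(2))
  qed
  show "?J \<subseteq> edge_ideal m n (U \<times> (W - {c})) UNIV" "?J \<subseteq> edge_ideal m n ((U - {r}) \<times> W) UNIV"
    by (rule edge_ideal_mono; blast)+
qed

section \<open>Ideals of disjoint unions of cliques\<close>

text \<open>
  Let the vertices be coloured by \<open>\<kappa>\<close>, and consider the graph whose edges join vertices of equal
  colour, a disjoint union of cliques. Its ideal is the kernel of the substitution
  \<open>x\<^sub>i\<^sub>j \<mapsto> s\<^bsub>i,\<kappa>(j)\<^esub> t\<^sub>j\<close>, which has the following effect on exponent vectors. The variable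
  \<open>s\<^sub>i\<^sub>q\<close> is called \<open>(i, q)\<close>, and \<open>t\<^sub>j\<close> is called \<open>(0, j)\<close>; they differ because rows are numbered
  from \<open>1\<close>.
\<close>
definition segre_exp :: "(nat \<Rightarrow> nat) \<Rightarrow> (nat \<times> nat \<Rightarrow>\<^sub>0 nat) \<Rightarrow> (nat \<times> nat \<Rightarrow>\<^sub>0 nat)" where
  "segre_exp \<kappa> t = (\<Sum>v\<in>Poly_Mapping.keys t.
     Poly_Mapping.single (fst v, \<kappa> (snd v)) (Poly_Mapping.lookup t v)
     + Poly_Mapping.single (0, snd v) (Poly_Mapping.lookup t v))"

lemma segre_exp_add: "segre_exp \<kappa> (s + t) = segre_exp \<kappa> s + segre_exp \<kappa> t"
  unfolding segre_exp_def
  by (rule setsum_keys_plus_distrib) (simp_all add: single_add add_ac)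

lemma segre_exp_single:
  "segre_exp \<kappa> (Poly_Mapping.single (i, j) 1)
    = Poly_Mapping.single (i, \<kappa> j) 1 + Poly_Mapping.single (0, j) 1"
  by (simp add: segre_exp_def)

lemma lookup_segre_exp:
  "Poly_Mapping.lookup (segre_exp \<kappa> t) w = (\<Sum>v\<in>Poly_Mapping.keys t.
     (if (fst v, \<kappa> (snd v)) = w then Poly_Mapping.lookup t v else 0)
     + (if (0, snd v) = w then Poly_Mapping.lookup t v else 0))"
  by (simp add: segre_exp_def lookup_sum lookup_add lookup_single when_def)

lemma segre_exp_row:
  assumes "0 < Poly_Mapping.lookup (segre_exp \<kappa> t) (i, q)" "i \<noteq> 0"
  shows "\<exists>j. (i, j) \<in> Poly_Mapping.keys t \<and> \<kappa> j = q"
proof -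
  have "Poly_Mapping.lookup (segre_exp \<kappa> t) (i, q) \<noteq> 0" using assms(1) by simp
  then show ?thesis unfolding lookup_segre_exp
    by (rule sum.not_neutral_contains_not_neutral) (use assms(2) in \<open>auto split: if_splits\<close>)
qed

lemma segre_exp_column:
  assumes "0 < Poly_Mapping.lookup (segre_exp \<kappa> t) (0, j)" "\<And>v. v \<in> Poly_Mapping.keys t \<Longrightarrow> fst v \<noteq> 0"
  shows "\<exists>i. (i, j) \<in> Poly_Mapping.keys t"
proof -
  have "Poly_Mapping.lookup (segre_exp \<kappa> t) (0, j) \<noteq> 0" using assms(1) by simp
  then show ?thesis unfolding lookup_segre_exp
    by (rule sum.not_neutral_contains_not_neutral) (use assms(2) in \<open>auto split: if_splits\<close>)
qed

lemma segre_exp_pos: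
  assumes "(i, j) \<in> Poly_Mapping.keys t"
  shows "0 < Poly_Mapping.lookup (segre_exp \<kappa> t) (i, \<kappa> j)" "0 < Poly_Mapping.lookup (segre_exp \<kappa> t) (0, j)"
proof -
  obtain u where u: "t = Poly_Mapping.single (i, j) 1 + u" using monomial_split[OF assms] .
  show "0 < Poly_Mapping.lookup (segre_exp \<kappa> t) (i, \<kappa> j)" "0 < Poly_Mapping.lookup (segre_exp \<kappa> t) (0, j)"
    unfolding u segre_exp_add segre_exp_single by (simp_all add: lookup_add)
qed

definition total_degree :: "('v \<Rightarrow>\<^sub>0 nat) \<Rightarrow> nat" where
  "total_degree t = (\<Sum>v\<in>Poly_Mapping.keys t. Poly_Mapping.lookup t v)"

lemma total_degree_add: "total_degree (s + t) = total_degree s + total_degree t"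
  unfolding total_degree_def by (rule setsum_keys_plus_distrib) simp_all

text \<open>
  Inside each clique the live variables form a product of a set of rows and a set of columns.
  Otherwise a minor could have one live and one dead term, and the substitution would not
  kill it.
\<close>
definition rectangular :: "(nat \<Rightarrow> nat) \<Rightarrow> (nat \<times> nat) set \<Rightarrow> bool" where
  "rectangular \<kappa> L \<longleftrightarrow>
    (\<forall>i j i' j'. (i, j) \<in> L \<longrightarrow> (i', j') \<in> L \<longrightarrow> \<kappa> j = \<kappa> j' \<longrightarrow> (i, j') \<in> L)"

definition same_colour :: "(nat \<Rightarrow> nat) \<Rightarrow> (nat \<times> nat) set" where
  "same_colour \<kappa> = {(k, l). \<kappa> k = \<kappa> l}"

lemma single_add_var: "Poly_Mapping.single (Poly_Mapping.single v 1 + t) 1 = var v * Poly_Mapping.single t 1"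
  by (simp add: var_def mult_single)

text \<open>
  Two monomials with the same image are congruent. Let \<open>x\<^sub>i\<^sub>j\<close> divide the first one. Since the images
  agree, the second one is divisible by some \<open>x\<^sub>i\<^sub>j'\<close> with \<open>\<kappa> j' = \<kappa> j\<close> and by some \<open>x\<^sub>i'\<^sub>j\<close>. One exchange
  replaces \<open>x\<^sub>i\<^sub>j' x\<^sub>i'\<^sub>j\<close> by \<open>x\<^sub>i\<^sub>j x\<^sub>i'\<^sub>j'\<close>, and then \<open>x\<^sub>i\<^sub>j\<close> can be cancelled.
\<close>
lemma monomial_congruence:
  fixes t t' :: "nat \<times> nat \<Rightarrow>\<^sub>0 nat"
  assumes L: "L \<subseteq> grid m n" "rectangular \<kappa> L"
    and "t \<in> monomials L" "t' \<in> monomials L" "segre_exp \<kappa> t = segre_exp \<kappa> t'"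
  shows "Poly_Mapping.single t 1 - Poly_Mapping.single t' 1 \<in> (edge_ideal m n L (same_colour \<kappa>) :: 'k::field mpoly set)"
  using assms(3-)
proof (induction "total_degree t" arbitrary: t t' rule: less_induct)
  case less
  let ?J = "edge_ideal m n L (same_colour \<kappa>) :: 'k mpoly set"
  let ?x = "\<lambda>t. Poly_Mapping.single t 1 :: 'k mpoly"
  note I = P.is_idealD[OF edge_ideal_ideal[of m n L "same_colour \<kappa>", where 'a = 'k]]
  have row: "0 < i" if "(i, j) \<in> L" for i j using that L(1) by (auto simp: grid_iff)
  have vR: "var v \<in> grid_polys m n" if "v \<in> L" for v using that L(1) by (auto intro: var_polys)
  show ?case
  proof (cases "t = 0")
    case True
    have "t' = 0"
    proof (rule ccontr)
      assume "t' \<noteq> 0"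
      then obtain v where v: "v \<in> Poly_Mapping.keys t'" by (meson equals0I keys_eq_empty)
      have "segre_exp \<kappa> t' = 0" using less.prems(3) True by (simp add: segre_exp_def)
      then show False using segre_exp_pos(2)[of "fst v" "snd v" t' \<kappa>] v by simp
    qed
    then show ?thesis using True I(2) by simp
  next
    case False
    then obtain i j where v: "(i, j) \<in> Poly_Mapping.keys t"
      by (metis equals0I keys_eq_empty surj_pair)
    obtain t0 where t0: "t = Poly_Mapping.single (i, j) 1 + t0" using monomial_split[OF v] .
    have t0L: "t0 \<in> monomials L" using less.prems(1) by (simp add: t0 monomials_def keys_add_nat)
    have ijL: "(i, j) \<in> L" using less.prems(1) v by (auto simp: monomials_def)
    have deg: "total_degree t0 < total_degree t"
      unfolding t0 total_degree_add by (simp add: total_degree_def)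
    have cancel: "?x t - ?x s \<in> ?J"
      if s: "s = Poly_Mapping.single (i, j) 1 + s0" "s \<in> monomials L" "segre_exp \<kappa> t = segre_exp \<kappa> s" for s s0
    proof -
      have "s0 \<in> monomials L" using s(1,2) by (simp add: monomials_def keys_add_nat)
      moreover have "segre_exp \<kappa> t0 = segre_exp \<kappa> s0"
        using s(3) unfolding s(1) t0 segre_exp_add by simp
      ultimately have "?x t0 - ?x s0 \<in> ?J" using less.hyps[OF deg t0L] by blast
      then have "var (i, j) * (?x t0 - ?x s0) \<in> ?J" using I(4) vR[OF ijL] by blast
      then show ?thesis
        unfolding s(1) t0 single_add_var by (simp add: right_diff_distrib)
    qed
    have "0 < Poly_Mapping.lookup (segre_exp \<kappa> t') (i, \<kappa> j)"
      using segre_exp_pos(1)[OF v] less.prems(3) by metis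
    from segre_exp_row[OF this] obtain j' where j': "(i, j') \<in> Poly_Mapping.keys t'" "\<kappa> j' = \<kappa> j"
      using row[OF ijL] by auto
    have "0 < Poly_Mapping.lookup (segre_exp \<kappa> t') (0, j)"
      using segre_exp_pos(2)[OF v] less.prems(3) by metis
    moreover have "fst u \<noteq> 0" if "u \<in> Poly_Mapping.keys t'" for u
      using row[of "fst u" "snd u"] that less.prems(2) by (auto simp: monomials_def)
    ultimately obtain i' where i': "(i', j) \<in> Poly_Mapping.keys t'"
      using segre_exp_column[of \<kappa> t' j] by blast
    define w where "w = (i, j')"
    define u where "u = (i', j)"
    have w: "w \<in> Poly_Mapping.keys t'" and w': "w = (i, j')" "\<kappa> j' = \<kappa> j" using j' by (simp_all add: w_def)
    have u: "u \<in> Poly_Mapping.keys t'" and u': "u = (i', j)" using i' by (simp_all add: u_def)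
    show ?thesis
    proof (cases "w = u")
      case True
      then have "(i, j) \<in> Poly_Mapping.keys t'" using w w' u' by simp
      then obtain s0 where "t' = Poly_Mapping.single (i, j) 1 + s0" by (rule monomial_split)
      then show ?thesis using cancel less.prems by blast
    next
      case False
      obtain t1 where t1: "t' = Poly_Mapping.single w 1 + t1" using monomial_split[OF w] .
      have "u \<in> Poly_Mapping.keys t1" using u False unfolding t1 by (auto simp: keys_add_nat)
      then obtain q where "t1 = Poly_Mapping.single u 1 + q" by (rule monomial_split)
      then have q: "t' = Poly_Mapping.single w 1 + (Poly_Mapping.single u 1 + q)"
        using t1 by simp
      define s where "s = Poly_Mapping.single (i, j) 1 + (Poly_Mapping.single (i', j') 1 + q)"
      have uwL: "w \<in> L" "u \<in> L" using w u less.prems(2) by (auto simp: monomials_def)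
      have new: "(i', j') \<in> L"
        using L(2) uwL w' u' unfolding rectangular_def by metis
      have qL: "q \<in> monomials L" using less.prems(2) unfolding q by (simp add: monomials_def keys_add_nat)
      have sL: "s \<in> monomials L"
        using qL new ijL unfolding s_def by (simp add: monomials_def keys_add_nat)
      have "segre_exp \<kappa> t' = segre_exp \<kappa> s"
        unfolding q s_def segre_exp_add w'(1) u' segre_exp_single w'(2) by (simp add: add_ac)
      then have "?x t - ?x s \<in> ?J" using cancel[OF s_def sL] less.prems(3) by simp
      moreover have "?x s - ?x t' \<in> ?J"
      proof -
        have "minor i i' j j' \<in> ?J"
          using uwL new ijL L(1) w' by (intro minor_in_edge_ideal) (auto simp: same_colour_def u')
        moreover have "?x q \<in> grid_polys m n"
          using qL L(1) by (intro single_in_polys) (auto simp: monomials_def)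
        ultimately have "?x q * minor i i' j j' \<in> ?J" using I(4) by blast
        moreover have "?x s - ?x t' = ?x q * minor i i' j j'"
          unfolding q s_def single_add_var minor_def w'(1) u' by (simp add: algebra_simps)
        ultimately show ?thesis by simp
      qed
      ultimately have "(?x t - ?x s) + (?x s - ?x t') \<in> ?J" by (rule I(3))
      then show ?thesis by simp
    qed
  qed
qed

text \<open>The substitution itself, with the dead variables sent to zero.\<close>
definition segre :: "(nat \<Rightarrow> nat) \<Rightarrow> (nat \<times> nat) set \<Rightarrow> 'k::field mpoly \<Rightarrow> 'k mpoly" where
  "segre \<kappa> L = lin (\<lambda>t. if t \<in> monomials L then Poly_Mapping.single (segre_exp \<kappa> t) 1 else 0)"

lemma monomials_add_iff: "s + t \<in> monomials L \<longleftrightarrow> s \<in> monomials L \<and> t \<in> monomials (L :: 'v set)"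
  by (simp add: monomials_def keys_add_nat)

lemma segre_mult: "segre \<kappa> L (p * q) = segre \<kappa> L p * segre \<kappa> L q"
  unfolding segre_def
  by (rule lin_mult) (simp add: monomials_add_iff segre_exp_add mult_single)

lemma segre_var:
  "segre \<kappa> L (var v) = (if v \<in> L then Poly_Mapping.single (segre_exp \<kappa> (Poly_Mapping.single v 1)) 1 else 0)"
  by (simp add: segre_def var_def lin_single monomials_def mult_single)

lemma segre_kernel_subset:
  assumes p: "(p :: 'k::field mpoly) \<in> edge_ideal m n L (same_colour \<kappa>)"
    and L: "rectangular \<kappa> L"
  shows "segre \<kappa> L p = 0"
  using p
proof induction
  case (gen_step g r p)
  have "segre \<kappa> L (minor i j k l) = 0" if "\<kappa> k = \<kappa> l" for i j k l
  proof -
    have "(i, k) \<in> L \<and> (j, l) \<in> L \<longleftrightarrow> (i, l) \<in> L \<and> (j, k) \<in> L"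
      using L that unfolding rectangular_def by metis
    then show ?thesis
      unfolding minor_def segre_def lin_diff
      unfolding segre_def[symmetric]
      using that by (auto simp: segre_mult segre_var segre_exp_single[simplified] mult_single add_ac)
  qed
  then have "segre \<kappa> L g = 0"
    using gen_step(1) by (auto simp: edge_gens_def same_colour_def segre_var)
  then show ?case
    using gen_step(4) by (simp add: segre_mult segre_def lin_add) (simp add: segre_def[symmetric] segre_mult)
qed (simp add: segre_def)

text \<open>
  Modulo the ideal, each live monomial equals a chosen representative of its fibre, and the
  coefficients in each fibre add up to a coefficient of the image.
\<close>
lemma segre_kernel:
  assumes L: "L \<subseteq> grid m n" "rectangular \<kappa> L" and p: "(p :: 'k::field mpoly) \<in> grid_polys m n"
    and 0: "segre \<kappa> L p = 0"
  shows "p \<in> edge_ideal m n L (same_colour \<kappa>)"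
proof -
  let ?J = "edge_ideal m n L (same_colour \<kappa>) :: 'k mpoly set"
  note I = P.is_idealD[OF edge_ideal_ideal[of m n L "same_colour \<kappa>", where 'a = 'k]]
  define rep where "rep b = (SOME t. t \<in> monomials L \<and> segre_exp \<kappa> t = b)" for b
  have rep: "rep (segre_exp \<kappa> t) \<in> monomials L" "segre_exp \<kappa> (rep (segre_exp \<kappa> t)) = segre_exp \<kappa> t"
    if "t \<in> monomials L" for t
    using someI[of "\<lambda>s. s \<in> monomials L \<and> segre_exp \<kappa> s = segre_exp \<kappa> t" t] that
    unfolding rep_def by auto
  let ?n = "\<lambda>t. if t \<in> monomials L then Poly_Mapping.single (rep (segre_exp \<kappa> t)) 1 else 0 :: 'k mpoly"
  let ?c = "\<lambda>t. Poly_Mapping.single 0 (Poly_Mapping.lookup p t) :: 'k mpoly"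
  have "0 = lin (\<lambda>b. Poly_Mapping.single (rep b) 1) (segre \<kappa> L p)" by (simp add: 0)
  also have "\<dots> = (\<Sum>t\<in>Poly_Mapping.keys p. ?c t * ?n t)"
    unfolding segre_def lin_def[of _ p] lin_sum
    by (intro sum.cong refl) (auto simp: mult_single lin_single)
  finally have "p = p - (\<Sum>t\<in>Poly_Mapping.keys p. ?c t * ?n t)" by simp
  also have "\<dots> = (\<Sum>t\<in>Poly_Mapping.keys p. ?c t * (Poly_Mapping.single t 1 - ?n t))"
    by (subst poly_mapping_expand[of p]) (simp add: sum_subtractf right_diff_distrib mult_single)
  finally have p_eq: "p = (\<Sum>t\<in>Poly_Mapping.keys p. ?c t * (Poly_Mapping.single t 1 - ?n t))" .
  have in_J: "?c t * (Poly_Mapping.single t 1 - ?n t) \<in> ?J" if t: "t \<in> Poly_Mapping.keys p" for t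
  proof -
    have tG: "t \<in> monomials (grid m n)" using p t by (auto simp: polys_def)
    have cR: "?c t \<in> grid_polys m n" by (intro single_in_polys) (simp add: monomials_def)
    have "Poly_Mapping.single t 1 - ?n t \<in> ?J"
    proof (cases "t \<in> monomials L")
      case True
      then show ?thesis using monomial_congruence[OF L True rep(1)[OF True]] rep(2)[OF True] by simp
    next
      case False
      then obtain v where v: "v \<in> Poly_Mapping.keys t" "v \<notin> L" by (auto simp: monomials_def)
      have vG: "v \<in> grid m n" using v tG by (auto simp: monomials_def)
      have "P.gen m n {var v} \<subseteq> ?J"
        using var_in_edge_ideal[OF vG v(2)] by (intro P.gen_least edge_ideal_ideal) auto
      then show ?thesis using single_in_gen_vars[OF tG v(1)] False by auto
    qed
    then show ?thesis using I(4) cR by blast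
  qed
  show ?thesis
    by (subst p_eq, rule P.is_ideal_sum_mem[OF edge_ideal_ideal in_J])
qed

text \<open>The ideal is a kernel into a domain, hence prime, and a live variable is not in it.\<close>
lemma live_var_regular:
  assumes L: "L \<subseteq> grid m n" "rectangular \<kappa> L" and v: "v \<in> L"
  shows "P.regular_on m n (edge_ideal m n L (same_colour \<kappa>) :: 'k::field mpoly set) (var v)"
  unfolding P.regular_on_def
proof (intro ballI impI)
  fix u :: "'k mpoly" assume u: "u \<in> grid_polys m n" "var v * u \<in> edge_ideal m n L (same_colour \<kappa>)"
  have "segre \<kappa> L (var v) * segre \<kappa> L u = 0"
    using segre_kernel_subset[OF u(2) L(2)] by (simp add: segre_mult)
  moreover have "segre \<kappa> L (var v :: 'k mpoly) \<noteq> 0"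
    using v by (simp add: segre_var) (metis lookup_single_eq lookup_zero zero_neq_one)
  ultimately have "segre \<kappa> L u = 0" by simp
  then show "u \<in> edge_ideal m n L (same_colour \<kappa>)" using segre_kernel[OF L u(1)] by blast
qed

section \<open>The depth of the pieces\<close>

locale variable_list =
  fixes m n :: nat and xs :: "'k::field mpoly list"
  assumes xs: "set xs = variables m n"
begin

lemma xs_polys: "set xs \<subseteq> grid_polys m n"
  unfolding xs by (rule variables_polys)

lemma variables_var: "variables m n = (var ` grid m n :: 'k mpoly set)"
  by (auto simp: variables_def xvar_def var_def)

text \<open>
  By depth sensitivity these say that the quotient by the edge ideal has depth at least \<open>e\<close>,
  respectively exactly \<open>e\<close>.
\<close>
definition depth_ge :: "(nat \<times> nat) set \<Rightarrow> (nat \<times> nat) set \<Rightarrow> nat \<Rightarrow> bool" where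
  "depth_ge L E e \<longleftrightarrow> P.koszul_vanish m n xs (edge_ideal m n L E) e"

definition depth_eq :: "(nat \<times> nat) set \<Rightarrow> (nat \<times> nat) set \<Rightarrow> nat \<Rightarrow> bool" where
  "depth_eq L E e \<longleftrightarrow> depth_ge L E e \<and> \<not> depth_ge L E (Suc e)"

lemma depth_ge_antimono: "depth_ge L E e \<Longrightarrow> e' \<le> e \<Longrightarrow> depth_ge L E e'"
  unfolding depth_ge_def by (rule P.koszul_vanish_antimono)

lemma depth_ge_cong:
  assumes "\<And>k l. k \<in> {1..n} \<Longrightarrow> l \<in> {1..n} \<Longrightarrow>
      (\<forall>i. (i, k) \<notin> L) \<or> (\<forall>i. (i, l) \<notin> L) \<or> ((k, l) \<in> E \<longleftrightarrow> (k, l) \<in> E')"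
  shows "depth_ge L E e \<longleftrightarrow> depth_ge L E' e"
proof -
  have "edge_ideal m n L E = (edge_ideal m n L E' :: 'k mpoly set)"
    by (rule edge_ideal_cong[OF assms])
  then show ?thesis by (simp add: depth_ge_def)
qed

lemma depth_ge_kill_var:
  assumes L: "L \<subseteq> grid m n" "rectangular \<kappa> L" and v: "v \<in> L"
  shows "depth_ge L (same_colour \<kappa>) (Suc e) \<longleftrightarrow> depth_ge (L - {v}) (same_colour \<kappa>) e"
proof -
  let ?J = "edge_ideal m n L (same_colour \<kappa>) :: 'k mpoly set"
  have vG: "v \<in> grid m n" using L v by auto
  have "var v \<in> P.gen m n (set xs)"
    using P.gen_incl[of "var v" "set xs" m n] vG unfolding xs variables_var by auto
  then show ?thesis
    unfolding depth_ge_def edge_ideal_adjoin[OF vG, symmetric]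
    using P.koszul_vanish_regular_step[OF edge_ideal_ideal xs_polys var_polys[OF vG] live_var_regular[OF L v]]
      P.koszul_vanish_regular_step_converse[OF edge_ideal_ideal xs_polys _ live_var_regular[OF L v]]
    by blast
qed

text \<open>
  Deleting regular variables one at a time; each intermediate ideal has to be prime.
\<close>
lemma depth_ge_kill_vars:
  assumes "finite Y" "Y \<subseteq> L" "L \<subseteq> grid m n" "\<And>Z. Z \<subseteq> Y \<Longrightarrow> rectangular \<kappa> (L - Z)"
  shows "depth_ge L (same_colour \<kappa>) (e + card Y) \<longleftrightarrow> depth_ge (L - Y) (same_colour \<kappa>) e"
  using assms
proof (induction Y arbitrary: e rule: finite_induct)
  case (insert v Y)
  have "depth_ge L (same_colour \<kappa>) (Suc e + card Y) \<longleftrightarrow> depth_ge (L - Y) (same_colour \<kappa>) (Suc e)"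
  proof (rule insert.IH)
    show "rectangular \<kappa> (L - Z)" if "Z \<subseteq> Y" for Z using that by (intro insert.prems(3)) auto
  qed (use insert.prems in auto)
  also have "\<dots> \<longleftrightarrow> depth_ge (L - Y - {v}) (same_colour \<kappa>) e"
    using insert.prems insert.hyps by (intro depth_ge_kill_var) auto
  also have "L - Y - {v} = L - insert v Y" by auto
  finally show ?case using insert by simp
qed simp

lemma edge_ideal_subset_max_ideal: "(edge_ideal m n L E :: 'k mpoly set) \<subseteq> P.gen m n (variables m n)"
proof (rule P.gen_least[OF P.gen_ideal[OF variables_polys]])
  note I = P.is_idealD[OF P.gen_ideal[OF variables_polys[of m n, where 'a = 'k]]]
  have v: "var v \<in> P.gen m n (variables m n :: 'k mpoly set)" if "v \<in> grid m n" for v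
    using that unfolding variables_var by (intro P.gen_incl) auto
  have "minor i j k l \<in> P.gen m n (variables m n :: 'k mpoly set)"
    if "(i, k) \<in> grid m n" "(j, l) \<in> grid m n" for i j k l
    using that unfolding minor_def
    by (intro I(7) I(4) v var_polys) (auto simp: grid_iff)
  then show "edge_gens m n L E \<subseteq> P.gen m n (variables m n :: 'k mpoly set)"
    using v unfolding edge_gens_def by blast
qed

text \<open>With all variables dead the quotient is the field, whose socle is not zero.\<close>
lemma depth_eq_empty: "depth_eq {} E 0"
proof -
  let ?J = "edge_ideal m n {} E :: 'k mpoly set"
  have "1 \<notin> ?J"
    using edge_ideal_subset_max_ideal[of "{}" E] constant_term_max_ideal[of "1 :: 'k mpoly" m n] by auto
  moreover have "x * 1 \<in> ?J" if "x \<in> set xs" for x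
    using that var_in_edge_ideal[of _ m n "{}" E] unfolding xs variables_var by auto
  ultimately have "\<not> P.koszul_vanish m n xs ?J 1"
    using P.socle_free_if_koszul_vanish[OF edge_ideal_ideal, of m n xs "{}" E 1] P.one_mem by blast
  then show ?thesis by (simp add: depth_eq_def depth_ge_def)
qed

text \<open>
  When all sets of live variables are rectangular, the variables can be deleted in any order,
  down to the field. This happens for a single live row, for a single live column, and when the
  live columns have different colours.
\<close>
lemma depth_eq_free:
  assumes "L \<subseteq> grid m n" "\<And>Z. Z \<subseteq> L \<Longrightarrow> rectangular \<kappa> Z"
  shows "depth_eq L (same_colour \<kappa>) (card L)"
proof -
  have "finite L" using assms(1) finite_grid finite_subset by blast
  then have "depth_ge L (same_colour \<kappa>) (e + card L) \<longleftrightarrow> depth_ge {} (same_colour \<kappa>) e" for e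
    using depth_ge_kill_vars[of L L \<kappa> e] assms by auto
  from this[of 0] this[of 1] depth_eq_empty[of "same_colour \<kappa>"] show ?thesis
    by (simp add: depth_eq_def)
qed

lemma depth_ge_Int:
  assumes "edge_ideal m n L E = (edge_ideal m n L1 E1 \<inter> edge_ideal m n L2 E2 :: 'k mpoly set)"
    and "depth_ge L1 E1 e" "depth_ge L2 E2 e" "depth_ge (L1 \<inter> L2) (E1 \<union> E2) (e - 1)"
  shows "depth_ge L E e"
  using P.koszul_vanish_Int[OF edge_ideal_ideal edge_ideal_ideal xs_polys] assms
  unfolding depth_ge_def edge_ideal_sum by metis

lemma depth_eq_Int:
  assumes *: "edge_ideal m n L E = (edge_ideal m n L1 E1 \<inter> edge_ideal m n L2 E2 :: 'k mpoly set)"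
    and V: "depth_ge L1 E1 (Suc e)" "depth_ge L2 E2 (Suc e)" "depth_eq (L1 \<inter> L2) (E1 \<union> E2) e"
  shows "depth_eq L E (Suc e)"
proof -
  have "depth_ge L E (Suc e)"
    using V by (intro depth_ge_Int[OF *]) (auto simp: depth_eq_def)
  moreover have "depth_ge (L1 \<inter> L2) (E1 \<union> E2) (Suc e)" if "depth_ge L E (Suc (Suc e))"
    using P.koszul_vanish_ideal_sum[OF edge_ideal_ideal edge_ideal_ideal xs_polys] V that *
    unfolding depth_ge_def edge_ideal_sum by metis
  ultimately show ?thesis using V(3) unfolding depth_eq_def by blast
qed

lemma same_colour_const: "same_colour (\<lambda>_. 0) = UNIV"
  by (auto simp: same_colour_def)

text \<open>
  The ideal of \<open>2\<close>-minors of a generic matrix with rows \<open>U\<close> and columns \<open>W\<close>. A variable is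
  regular, and adjoining it gives the intersection of the ideals of the matrices without its row
  and without its column, whose sum is the ideal of the matrix without both. By induction these
  have depth \<open>|U| + |W| - 2\<close> and \<open>|U| + |W| - 3\<close>. A matrix with a single row or column has no
  minors and gives a polynomial ring.
\<close>
lemma depth_eq_segre:
  assumes "U \<times> W \<subseteq> grid m n" "finite U" "finite W" "U \<noteq> {}" "W \<noteq> {}"
  shows "depth_eq (U \<times> W) UNIV (card U + card W - 1)"
  using assms
proof (induction "card U + card W" arbitrary: U W rule: less_induct)
  case less
  obtain r c where rc: "r \<in> U" "c \<in> W" using less.prems by blast
  have pos: "card U > 0" "card W > 0" using less.prems by (auto simp: card_gt_0_iff)
  show ?case
  proof (cases "U = {r} \<or> W = {c}")
    case True
    have "rectangular (\<lambda>_. 0) Z" if "Z \<subseteq> U \<times> W" for Z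
      using that True unfolding rectangular_def by blast
    moreover have "card U * card W = card U + card W - 1" using True by auto
    ultimately show ?thesis
      using depth_eq_free[OF less.prems(1), of "\<lambda>_. 0"] by (simp add: same_colour_const card_cartesian_product)
  next
    case False
    let ?U = "U - {r}" and ?W = "W - {c}"
    have ne: "?U \<noteq> {}" "?W \<noteq> {}" using False rc by auto
    have card: "card U = Suc (card ?U)" "card W = Suc (card ?W)"
      using rc less.prems card_Suc_Diff1 by metis+
    have pos': "card ?U > 0" "card ?W > 0" using ne less.prems by (auto simp: card_gt_0_iff)
    have 1: "depth_eq (U \<times> ?W) UNIV (card U + card ?W - 1)"
      using less.prems ne card by (intro less.hyps) auto
    have 2: "depth_eq (?U \<times> W) UNIV (card ?U + card W - 1)"
      using less.prems ne card by (intro less.hyps) auto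
    have 3: "depth_eq (?U \<times> ?W) UNIV (card ?U + card ?W - 1)"
      using less.prems ne card by (intro less.hyps) auto
    have "depth_eq (U \<times> W - {(r, c)}) UNIV (Suc (card ?U + card ?W - 1))"
    proof (rule depth_eq_Int[OF edge_ideal_corner[OF rc less.prems(1)]])
      have "U \<times> ?W \<inter> ?U \<times> W = ?U \<times> ?W" by blast
      then show "depth_eq (U \<times> ?W \<inter> ?U \<times> W) (UNIV \<union> UNIV) (card ?U + card ?W - 1)" using 3 by simp
    qed (use 1 2 card pos' in \<open>simp_all add: depth_eq_def\<close>)
    moreover have "rectangular (\<lambda>_. 0) (U \<times> W)" by (auto simp: rectangular_def)
    from depth_ge_kill_var[OF less.prems(1) this, of "(r, c)"]
    have "depth_ge (U \<times> W) UNIV (Suc e) \<longleftrightarrow> depth_ge (U \<times> W - {(r, c)}) UNIV e" for e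
      using rc by (simp add: same_colour_const)
    ultimately have "depth_eq (U \<times> W) UNIV (Suc (Suc (card ?U + card ?W - 1)))"
      by (simp add: depth_eq_def)
    then show ?thesis using card pos' by simp
  qed
qed

end

section \<open>The graph\<close>

text \<open>
  Three cliques in a row, where \<open>1\<close> and \<open>3\<close> are the two ends: \<open>{1, 2}\<close> and \<open>{2, 4, 5, \<dots>}\<close> meet in the
  cut vertex \<open>2\<close>, and \<open>{2, 4, 5, \<dots>}\<close> and \<open>{3, 4, 5, \<dots>}\<close> meet in all vertices from \<open>4\<close> on.
\<close>
definition adjacent :: "nat \<Rightarrow> nat \<Rightarrow> bool" where
  "adjacent a b \<longleftrightarrow> {a, b} \<subseteq> {1, 2} \<or> {a, b} \<subseteq> insert 2 {4..} \<or> {a, b} \<subseteq> {3..}"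

definition cliques_graph :: "nat \<Rightarrow> nat pair_pre_digraph" where
  "cliques_graph n = \<lparr>pverts = {1..n}, parcs = {(a, b) \<in> {1..n} \<times> {1..n}. a \<noteq> b \<and> adjacent a b}\<rparr>"

lemma cliques_graph_simps [simp]:
  "pverts (cliques_graph n) = {1..n}"
  "(a, b) \<in> parcs (cliques_graph n) \<longleftrightarrow> a \<in> {1..n} \<and> b \<in> {1..n} \<and> a \<noteq> b \<and> adjacent a b"
  by (auto simp: cliques_graph_def)

lemma adjacent_sym: "adjacent a b \<longleftrightarrow> adjacent b a"
  by (auto simp: adjacent_def)

lemma sym_cliques_graph: "sym (parcs (cliques_graph n))"
  by (rule symI) (auto simp: adjacent_sym)

lemma pair_graph_cliques_graph: "pair_graph (cliques_graph n)"
proof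
  have "parcs (cliques_graph n) \<subseteq> {1..n} \<times> {1..n}" by (auto simp: cliques_graph_def)
  then show "finite (parcs (cliques_graph n))" by (rule finite_subset) simp
  show "symmetric (with_proj (cliques_graph n))"
    using sym_cliques_graph by (simp add: symmetric_def)
qed (auto simp: cliques_graph_def)

lemma induce_subgraph_with_proj:
  "with_proj G \<restriction> S = with_proj \<lparr>pverts = S, parcs = parcs G \<inter> S \<times> S\<rparr>"
  by (auto simp: induce_subgraph_def with_proj_def)

lemma mk_symmetric_with_proj:
  "sym (parcs G) \<Longrightarrow> mk_symmetric (with_proj G) = (G :: 'v pair_pre_digraph)"
  by (cases G) (auto simp: mk_symmetric_def dest: symD)

lemma connected_with_proj:
  "sym (parcs G) \<Longrightarrow> Digraph_Component.connected (with_proj G) \<longleftrightarrow> strongly_connected (with_proj G)"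
  by (simp add: Digraph_Component.connected_def mk_symmetric_with_proj)

lemma neighbours_with_proj: "neighbours (with_proj G) v = {u. (v, u) \<in> parcs G}"
  by (simp add: neighbours_def)

lemma complete_induce_subgraph:
  assumes "finite S"
  shows "complete (with_proj G \<restriction> S) \<longleftrightarrow> parcs G \<inter> S \<times> S = {(u, v) \<in> S \<times> S. u \<noteq> v}"
  unfolding induce_subgraph_with_proj complete_digraph_pair_def using assms by auto

context
  fixes n :: nat
  assumes n: "n \<ge> 5"
begin

private abbreviation (input) "G \<equiv> cliques_graph n"
private abbreviation (input) "D \<equiv> with_proj (cliques_graph n)"

interpretation pair_graph G by (rule pair_graph_cliques_graph)

text \<open>The vertex \<open>4\<close> is adjacent to all others but \<open>1\<close>, which is two steps away from it.\<close>
lemma short_walk: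
  assumes "a \<in> {1..n}" "b \<in> {1..n}"
  shows "\<exists>p. pre_digraph.awalk D a p b \<and> length p \<le> 3"
proof -
  have e: "\<exists>p. awalk a p b \<and> length p \<le> 1" if "(a, b) \<in> parcs G" for a b
    using that by (intro exI[of _ "[(a, b)]"]) (auto simp: awalk_def)
  have comp: "\<exists>p. awalk a p c \<and> length p \<le> i + j"
    if pq: "\<exists>p. awalk a p b \<and> length p \<le> i" "\<exists>p. awalk b p c \<and> length p \<le> j" for a b c i j
  proof -
    obtain p q where "awalk a p b" "length p \<le> i" "awalk b q c" "length q \<le> j" using pq by blast
    then show ?thesis by (intro exI[of _ "p @ q"]) auto
  qed
  have weak: "\<exists>p. awalk a p c \<and> length p \<le> j"
    if "\<exists>p. awalk a p c \<and> length p \<le> i" "i \<le> j" for a c i j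
    using that le_trans by blast
  have T: "\<exists>p. awalk a p 4 \<and> length p \<le> (if a = 1 then 2 else 1)" 
      "\<exists>p. awalk 4 p a \<and> length p \<le> (if a = 1 then 2 else 1)" if "a \<in> {1..n}" for a
  proof -
    consider "a = 1" | "a = 4" | "a \<noteq> 1" "a \<noteq> 4" by blast
    then have "(\<exists>p. awalk a p 4 \<and> length p \<le> (if a = 1 then 2 else 1)) \<and>
      (\<exists>p. awalk 4 p a \<and> length p \<le> (if a = 1 then 2 else 1))"
    proof cases
      case 1
      have "(1, 2) \<in> parcs G" "(2, 1) \<in> parcs G" "(2, 4) \<in> parcs G" "(4, 2) \<in> parcs G"
        using n by (auto simp: adjacent_def)
      then have "\<exists>p. awalk 1 p 4 \<and> length p \<le> 1 + 1" "\<exists>p. awalk 4 p 1 \<and> length p \<le> 1 + 1"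
        using comp[OF e[of 1 2] e[of 2 4]] comp[OF e[of 4 2] e[of 2 1]] by blast+
      then show ?thesis using 1 by (simp add: numeral_2_eq_2)
    next
      case 2
      have "awalk 4 [] 4" using n by (simp add: awalk_def)
      then show ?thesis using 2 by auto
    next
      case 3
      have "(a, 4) \<in> parcs G" "(4, a) \<in> parcs G" using n 3 that by (auto simp: adjacent_def)
      then show ?thesis using e 3 by auto
    qed
    then show "\<exists>p. awalk a p 4 \<and> length p \<le> (if a = 1 then 2 else 1)"
      "\<exists>p. awalk 4 p a \<and> length p \<le> (if a = 1 then 2 else 1)" by auto
  qed
  show ?thesis
  proof (cases "a = 1 \<and> b = 1")
    case True
    then show ?thesis using n by (intro exI[of _ "[]"]) (simp add: awalk_def)
  next
    case False
    then show ?thesis using weak[OF comp[OF T(1)[OF assms(1)] T(2)[OF assms(2)]], of 3] by auto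
  qed
qed

lemma distance_le_3:
  assumes "a \<in> {1..n}" "b \<in> {1..n}"
  shows "distance D a b \<le> 3"
proof -
  obtain p where p: "awalk a p b" "length p \<le> 3" using short_walk[OF assms] by blast
  have "distance D a b \<le> length p" unfolding distance_def by (rule Least_le) (use p in blast)
  then show ?thesis using p by simp
qed

text \<open>
  Along an arc, the level function \<open>1 \<mapsto> 0, 2 \<mapsto> 1, t \<mapsto> 2, 3 \<mapsto> 3\<close> grows by at most one.
\<close>
lemma distance_1_3: "distance D 1 3 = 3"
proof -
  define level :: "nat \<Rightarrow> nat" where "level a = (if a = 1 then 0 else if a = 2 then 1 else if a = 3 then 3 else 2)" for a
  have step: "level b \<le> level a + 1" if "(a, b) \<in> parcs G" for a b
    using that by (auto simp: level_def adjacent_def)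
  have "level b \<le> level a + length p" if "awalk a p b" for a p b
    using that
  proof (induction p arbitrary: a)
    case (Cons e p)
    then have "e \<in> parcs G" "fst e = a" "awalk (snd e) p b" by (auto simp: awalk_Cons_iff)
    then show ?case using Cons.IH[of "snd e"] step[of a "snd e"] by (cases e) auto
  qed (simp add: awalk_Nil_iff)
  from this[of 1 _ 3] have low: "3 \<le> length p" if "awalk 1 p 3" for p using that by (simp add: level_def)
  obtain p where "awalk 1 p 3" using short_walk[of 1 3] n by auto
  then have "\<exists>p. awalk 1 p 3 \<and> length p = distance D 1 3"
    unfolding distance_def by (intro LeastI[of "\<lambda>l. \<exists>p. awalk 1 p 3 \<and> length p = l" "length p"]) blast
  then obtain q where q: "awalk 1 q 3" "length q = distance D 1 3" by blast
  have "3 \<le> distance D 1 3" using low[OF q(1)] unfolding q(2) .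
  then show ?thesis using distance_le_3[of 1 3] n by simp
qed

lemma diam_cliques_graph: "diam D = 3"
proof -
  let ?S = "{distance D a b | a b. a \<in> verts D \<and> b \<in> verts D}"
  have "?S \<subseteq> {..3}" using distance_le_3 by auto
  then have fin: "finite ?S" by (rule finite_subset) simp
  have "3 = distance D 1 3 \<and> 1 \<in> verts D \<and> 3 \<in> verts D" using n distance_1_3 by simp
  then have "3 \<in> ?S" by blast
  then show ?thesis
    unfolding diam_def using distance_le_3 by (intro Max_eqI fin) auto
qed

lemma strongly_connected_cliques_graph: "strongly_connected D"
proof
  show "u \<rightarrow>\<^sup>*\<^bsub>D\<^esub> v" if "u \<in> verts D" "v \<in> verts D" for u v
    using short_walk[of u v] that reachable_awalkI by auto
qed (use n in simp)

lemma connected_cliques_graph: "Digraph_Component.connected D"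
  using strongly_connected_cliques_graph sym_cliques_graph by (simp add: connected_with_proj)

lemma sccs_cliques_graph: "pre_digraph.sccs D = {D}"
proof -
  have wf: "wf_digraph D" by unfold_locales
  have ind: "induced_subgraph D D" by (auto simp: induced_subgraph_def subgraph_def compatible_def wf)
  have "H = D" if H: "H \<in> pre_digraph.sccs D" for H
  proof -
    have "induced_subgraph H D" "\<not> verts H \<subset> verts D"
      using H ind strongly_connected_cliques_graph unfolding pre_digraph.sccs_def by blast+
    then have "verts H = verts D" unfolding induced_subgraph_def subgraph_def by blast
    then show ?thesis using induced_eq_verts_imp_eq[OF \<open>induced_subgraph H D\<close> ind] by simp
  qed
  moreover have "D \<in> pre_digraph.sccs D"
    using ind strongly_connected_cliques_graph
    unfolding pre_digraph.sccs_def induced_subgraph_def subgraph_def by auto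
  ultimately show ?thesis by blast
qed

lemma d_inv_cliques_graph: "d_inv D = 3"
proof -
  have "neighbours D v \<noteq> {}" if v: "v \<in> {1..n}" for v
  proof -
    have "(v, if v = 1 then 2 else if v = 2 then 1 else if v = 4 then 5 else 4) \<in> parcs G"
      using v n by (auto simp: adjacent_def)
    then show ?thesis unfolding neighbours_with_proj by blast
  qed
  then have "isolated_vertices D = {}" by (auto simp: isolated_vertices_def)
  then show ?thesis by (simp add: d_inv_def sccs_cliques_graph diam_cliques_graph)
qed

lemma free_vertices_cliques_graph: "free_vertices D = {1, 3}"
proof -
  have N: "finite (neighbours D v)" "neighbours D v \<subseteq> {1..n}" for v
    unfolding neighbours_with_proj by (auto intro: finite_subset[of _ "{1..n}"])
  have free: "v \<in> free_vertices D \<longleftrightarrow> v \<in> {1..n} \<and>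
      (\<forall>a b. (v, a) \<in> parcs G \<longrightarrow> (v, b) \<in> parcs G \<longrightarrow> a \<noteq> b \<longrightarrow> adjacent a b)" for v
  proof -
    have "complete (D \<restriction> neighbours D v) \<longleftrightarrow>
        (\<forall>a\<in>neighbours D v. \<forall>b\<in>neighbours D v. a \<noteq> b \<longrightarrow> (a, b) \<in> parcs G)"
      unfolding complete_induce_subgraph[OF N(1)] using pair_no_loops by fastforce
    also have "\<dots> \<longleftrightarrow> (\<forall>a\<in>neighbours D v. \<forall>b\<in>neighbours D v. a \<noteq> b \<longrightarrow> adjacent a b)"
      using N(2)[of v] by auto
    finally show ?thesis by (auto simp: free_vertices_def neighbours_with_proj simp del: cliques_graph_simps(2))
  qed
  have "1 \<in> free_vertices D" "3 \<in> free_vertices D"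
    unfolding free using n by (auto simp: adjacent_def)
  moreover have "v \<notin> free_vertices D" if v: "v \<noteq> 1" "v \<noteq> 3" for v
  proof (cases "v = 2")
    case True
    have "(2, 1) \<in> parcs G" "(2, 4) \<in> parcs G" "\<not> adjacent 1 4" using n by (auto simp: adjacent_def)
    then show ?thesis unfolding free True by (metis one_eq_numeral_iff num.distinct(1))
  next
    case False
    have "(v, 2) \<in> parcs G" "(v, 3) \<in> parcs G" if "v \<in> {1..n}"
      using n v False that by (auto simp: adjacent_def)
    moreover have "\<not> adjacent 2 3" by (auto simp: adjacent_def)
    ultimately show ?thesis unfolding free by (metis numeral_eq_iff num.distinct(5))
  qed
  ultimately show ?thesis by blast
qed

lemma f_inv_cliques_graph: "f_inv D = 2"
  by (simp add: f_inv_def free_vertices_cliques_graph)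

lemma vertex_connectivity_cliques_graph: "vertex_connectivity D = 1"
proof -
  have "\<not> complete D"
  proof
    assume "complete D"
    then have "parcs G = {(u, v). (u, v) \<in> {1..n} \<times> {1..n} \<and> u \<noteq> v}"
      unfolding complete_digraph_pair_def by simp
    moreover have "(1, 3) \<in> {(u, v). (u, v) \<in> {1..n} \<times> {1..n} \<and> u \<noteq> v}" using n by simp
    ultimately have "(1, 3) \<in> parcs G" by blast
    then show False by (simp add: adjacent_def)
  qed
  let ?S = "{card T | T. T \<subset> verts D \<and> \<not> Digraph_Component.connected (D \<restriction> (verts D - T))}"
  have fin: "finite ?S"
    by (rule finite_subset[of _ "card ` Pow {1..n}"]) auto
  have ge: "1 \<le> c" if "c \<in> ?S" for c
  proof (rule ccontr)
    assume "\<not> 1 \<le> c"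
    moreover from that obtain T where "c = card T" and T: "T \<subset> verts D"
      "\<not> Digraph_Component.connected (D \<restriction> (verts D - T))"
      by blast
    ultimately have "card T = 0" by simp
    moreover have "finite T" using T(1) finite_subset[of T "{1..n}"] by auto
    ultimately have "T = {}" by simp
    moreover have "parcs G \<inter> {1..n} \<times> {1..n} = parcs G" by auto
    ultimately have "D \<restriction> (verts D - T) = D"
      by (simp add: induce_subgraph_with_proj)
    then show False using T(2) connected_cliques_graph by simp
  qed
  have mem: "1 \<in> ?S"
  proof -
    let ?V = "{1..n} - {2}"
    let ?H = "\<lparr>pverts = ?V, parcs = parcs G \<inter> ?V \<times> ?V\<rparr>"
    have symH: "sym (parcs ?H)"
      by (rule symI) (auto simp: adjacent_sym)
    have "\<not> strongly_connected (with_proj ?H)"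
    proof
      assume "strongly_connected (with_proj ?H)"
      then have "1 \<rightarrow>\<^sup>*\<^bsub>with_proj ?H\<^esub> 3" using n by (auto simp: strongly_connected_def)
      then show False
        by (rule pre_digraph.converse_reachable_cases) (auto simp: adjacent_def)
    qed
    then have "\<not> Digraph_Component.connected (D \<restriction> (verts D - {2}))"
      using symH connected_with_proj[of ?H] by (simp add: induce_subgraph_with_proj)
    moreover have "{2} \<subset> verts D"
    proof (rule psubsetI)
      have "2 \<in> verts D" "3 \<in> verts D" "3 \<notin> {2 :: nat}" using n by simp_all
      then show "{2} \<subseteq> verts D" "{2} \<noteq> verts D" by blast+
    qed
    ultimately show ?thesis by (intro CollectI exI[of _ "{2}"]) simp
  qed
  have "Min ?S = 1"
  proof (rule Min_eqI[OF fin])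
    show "1 \<le> c" if "c \<in> ?S" for c using that by (rule ge)
  qed (rule mem)
  then show ?thesis using \<open>\<not> complete D\<close> by (simp add: vertex_connectivity_def)
qed

end

section \<open>The depth\<close>

text \<open>
  The generators with \<open>i < j\<close> and \<open>k < l\<close> give all the minors, up to sign.
\<close>
lemma gen_binomial_edge_ideal_eq:
  "gen_binomial_edge_ideal m n (cliques_graph n)
    = (edge_ideal m n (grid m n) {(a, b). adjacent a b} :: 'k::field mpoly set)"
proof -
  let ?A = "{xvar i k * xvar j l - xvar i l * xvar j k | i j k l.
       1 \<le> i \<and> i < j \<and> j \<le> m \<and> (k, l) \<in> parcs (cliques_graph n) \<and> k < l} :: 'k mpoly set"
  let ?B = "edge_gens m n (grid m n) {(a, b). adjacent a b} :: 'k mpoly set"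
  have minor: "xvar i k * xvar j l - xvar i l * xvar j k = (minor i j k l :: 'k mpoly)" for i j k l
    by (simp add: minor_def xvar_def var_def)
  have AB: "?A \<subseteq> ?B"
  proof
    fix g assume "g \<in> ?A"
    then obtain i j k l where g: "g = minor i j k l" "1 \<le> i" "i < j" "j \<le> m"
        "(k, l) \<in> parcs (cliques_graph n)" by (auto simp: minor)
    then have "(i, k) \<in> grid m n" "(j, l) \<in> grid m n" "adjacent k l" by (auto simp: grid_iff)
    then show "g \<in> ?B" unfolding g(1) edge_gens_def by blast
  qed
  then have A: "?A \<subseteq> grid_polys m n" using edge_gens_polys by (rule order_trans)
  note I = P.is_idealD[OF P.gen_ideal[OF A]]
  have up: "minor i j k l \<in> P.gen m n ?A"
    if "(i, k) \<in> grid m n" "(j, l) \<in> grid m n" "adjacent k l" "i < j" "k < l" for i j k l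
    using that by (intro P.gen_incl) (auto simp: grid_iff minor simp del: One_nat_def intro!: exI)
  have "minor i j k l \<in> P.gen m n ?A"
    if g: "(i, k) \<in> grid m n" "(j, l) \<in> grid m n" "adjacent k l" for i j k l
  proof -
    have g': "(i, l) \<in> grid m n" "(j, k) \<in> grid m n" "adjacent l k"
      using g adjacent_sym by (auto simp: grid_iff)
    have rows: "minor j i k l = - (minor i j k l :: 'k mpoly)"
      and cols: "minor i j l k = - (minor i j k l :: 'k mpoly)"
      and both: "minor j i l k = (minor i j k l :: 'k mpoly)" by (simp_all add: minor_def)
    consider "i = j" | "k = l" | "i < j" "k < l" | "i < j" "l < k" | "j < i" "k < l" | "j < i" "l < k"
      by linarith
    then show ?thesis
    proof cases
      case 4
      then show ?thesis using I(6)[OF up[of i l j k]] g' cols by simp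
    next
      case 5
      then show ?thesis using I(6)[OF up[of j k i l]] g g' rows by simp
    next
      case 6
      then show ?thesis using up[of j l i k] g g' both by simp
    qed (use up g I(2) in \<open>simp_all add: minor_def\<close>)
  qed
  then have "?B \<subseteq> P.gen m n ?A" unfolding edge_gens_def by auto
  then have "P.gen m n ?A = P.gen m n ?B"
    using AB P.gen_incl by (intro equalityI P.gen_mono A edge_gens_polys) blast+
  then show ?thesis
    unfolding gen_binomial_edge_ideal_def using genideal_poly_ring[OF A] by simp
qed

context variable_list
begin

text \<open>
  Completing the neighbourhood of \<open>2\<close> gives the graph \<open>E'\<close>, in which \<open>T = {4, 5, \<dots>}\<close> is adjacent
  to everything and separates \<open>3\<close> from \<open>1\<close> and \<open>2\<close>. Cutting at \<open>2\<close>, and then cutting \<open>E'\<close> at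
  \<open>T\<close> with and without the vertex \<open>2\<close>, leaves disjoint unions of cliques. The cut at \<open>2\<close> has
  the ideal of \<open>E'\<close> without \<open>2\<close> as its sum, whose cut at \<open>T\<close> has the ideal of the clique
  \<open>{1, 3}\<close> as its sum. These sums determine the depths: \<open>m + 1\<close> for the clique \<open>{1, 3}\<close>, so
  \<open>m + 2\<close> for \<open>E'\<close> without \<open>2\<close>, so \<open>m + 3\<close> for the graph itself. Of the other pieces it
  only matters that their depths are large enough.
\<close>
lemma depth_cliques_graph:
  assumes m: "m \<ge> 2" and n: "n \<ge> 5"
  shows "depth_eq (grid m n) {(a, b). adjacent a b} (m + 3)"
proof -
  define U :: "nat set" where "U = {1..m}"
  define E where "E = {(a, b). adjacent a b}"
  define E' where "E' = {(a :: nat, b :: nat). {a, b} \<subseteq> - {3} \<or> {a, b} \<subseteq> {3..}}"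
  have grid: "grid m n = U \<times> {1..n}" by (simp add: grid_def U_def)
  have U: "finite U" "U \<noteq> {}" "card U = m" using m by (auto simp: U_def)
  have E'_iff: "(a, b) \<in> E' \<longleftrightarrow> a \<noteq> 3 \<and> b \<noteq> 3 \<or> 3 \<le> a \<and> 3 \<le> b" for a b
    by (auto simp: E'_def)
  have live: "depth_ge (U \<times> W) E1 e \<longleftrightarrow> depth_ge (U \<times> W) E2 e"
    if E12: "\<And>k l. k \<in> W \<Longrightarrow> l \<in> W \<Longrightarrow> (k, l) \<in> E1 \<longleftrightarrow> (k, l) \<in> E2" for W E1 E2 e
  proof (rule depth_ge_cong)
    have dead: "(\<forall>i. (i, j) \<notin> U \<times> W) \<longleftrightarrow> j \<notin> W" for j using U(2) by auto
    show "(\<forall>i. (i, k) \<notin> U \<times> W) \<or> (\<forall>i. (i, l) \<notin> U \<times> W) \<or> ((k, l) \<in> E1 \<longleftrightarrow> (k, l) \<in> E2)" for k l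
      unfolding dead using E12 by blast
  qed
  have segre: "depth_eq (U \<times> W) UNIV (m + card W - 1)" if "W \<subseteq> {1..n}" "W \<noteq> {}" for W
    using depth_eq_segre[of U W] U that finite_subset[OF that(1)] by (auto simp: grid)
  have cut_E': "edge_ideal m n L E' =
      (edge_ideal m n L UNIV \<inter> edge_ideal m n (L - UNIV \<times> {4..}) E' :: 'k mpoly set)" for L
    by (rule edge_ideal_cut) (auto simp: E'_def)
  have cut_E: "edge_ideal m n (grid m n) E =
      (edge_ideal m n (grid m n) E' \<inter> edge_ideal m n (grid m n - UNIV \<times> {2}) E :: 'k mpoly set)"
    by (rule edge_ideal_cut) (auto simp: E_def E'_def adjacent_def)
  have pair: "depth_eq (U \<times> {1, 3}) UNIV (m + 1)"
    using segre[of "{1, 3}"] n by simp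
  have free: "depth_ge (U \<times> {1, 3}) E' (m + m)"
  proof -
    have "depth_eq (U \<times> {1, 3}) (same_colour id) (card (U \<times> {1::nat, 3}))"
      using n by (intro depth_eq_free) (auto simp: grid rectangular_def)
    moreover have "depth_ge (U \<times> {1, 3}) E' e \<longleftrightarrow> depth_ge (U \<times> {1, 3}) (same_colour id) e" for e
      by (rule live) (elim insertE emptyE; simp add: E'_iff same_colour_def)
    ultimately show ?thesis using U by (simp add: depth_eq_def card_cartesian_product)
  qed
  have without_2: "depth_eq (U \<times> ({1..n} - {2})) E' (Suc (m + 1))"
  proof (rule depth_eq_Int[OF cut_E'])
    have L: "U \<times> ({1..n} - {2}) - UNIV \<times> {4..} = U \<times> {1, 3}" using n by auto
    have "1 \<in> {1..n} - {2}" using n by simp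
    then have "{1..n} - {2} \<noteq> {}" by blast
    then show "depth_ge (U \<times> ({1..n} - {2})) UNIV (Suc (m + 1))"
      using segre[of "{1..n} - {2}"] n by (auto simp: depth_eq_def intro: depth_ge_antimono)
    show "depth_ge (U \<times> ({1..n} - {2}) - UNIV \<times> {4..}) E' (Suc (m + 1))"
      unfolding L using free m by (auto intro: depth_ge_antimono)
    have "U \<times> ({1..n} - {2}) \<inter> U \<times> {1, 3} = U \<times> {1, 3}" using n by auto
    then show "depth_eq (U \<times> ({1..n} - {2}) \<inter> (U \<times> ({1..n} - {2}) - UNIV \<times> {4..})) (UNIV \<union> E') (m + 1)"
      unfolding L using pair by simp
  qed
  have completed: "depth_ge (grid m n) E' (m + 3)"
  proof (rule depth_ge_Int[OF cut_E'])
    have L: "grid m n - UNIV \<times> {4..} = U \<times> {1, 2, 3}" using n by (auto simp: grid)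
    show "depth_ge (grid m n) UNIV (m + 3)"
      using segre[of "{1..n}"] n by (auto simp: grid depth_eq_def intro: depth_ge_antimono)
    have "grid m n \<inter> U \<times> {1, 2, 3} = U \<times> {1, 2, 3}" using n by (auto simp: grid)
    then show "depth_ge (grid m n \<inter> (grid m n - UNIV \<times> {4..})) (UNIV \<union> E') (m + 3 - 1)"
      unfolding L using segre[of "{1, 2, 3}"] n by (simp add: depth_eq_def)
    let ?\<kappa> = "\<lambda>j :: nat. if j = 3 then 1 else 0 :: nat"
    have rect: "rectangular ?\<kappa> (U \<times> {1, 2, 3} - Z)" if "Z \<subseteq> U \<times> {3}" for Z
      using that unfolding rectangular_def by (auto split: if_splits)
    have "depth_ge (U \<times> {1, 2, 3}) (same_colour ?\<kappa>) (m + 1 + card (U \<times> {3::nat}))"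
    proof (subst depth_ge_kill_vars[OF _ _ _ rect])
      have "U \<times> {1, 2, 3} - U \<times> {3} = U \<times> {1, 2::nat}" by auto
      moreover have "depth_ge (U \<times> {1, 2}) (same_colour ?\<kappa>) (m + 1) \<longleftrightarrow> depth_ge (U \<times> {1, 2}) UNIV (m + 1)"
        by (rule live) (auto simp: same_colour_def)
      ultimately show "depth_ge (U \<times> {1, 2, 3} - U \<times> {3}) (same_colour ?\<kappa>) (m + 1)"
        using segre[of "{1, 2}"] n by (simp add: depth_eq_def)
    qed (use U n in \<open>auto simp: grid\<close>)
    moreover have "depth_ge (U \<times> {1, 2, 3}) E' e \<longleftrightarrow> depth_ge (U \<times> {1, 2, 3}) (same_colour ?\<kappa>) e" for e
      by (rule live) (elim insertE emptyE; simp add: E'_iff same_colour_def)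
    ultimately have "depth_ge (U \<times> {1, 2, 3}) E' (m + 1 + m)"
      by (simp add: card_cartesian_product U(3))
    then show "depth_ge (grid m n - UNIV \<times> {4..}) E' (m + 3)"
      unfolding L by (rule depth_ge_antimono) (use m in simp)
  qed
  have separated: "depth_ge (grid m n - UNIV \<times> {2}) E (m + 3)"
  proof -
    have L: "grid m n - UNIV \<times> {2} = U \<times> ({1..n} - {2})" by (auto simp: grid)
    let ?L = "U \<times> ({1..n} - {2})"
    let ?\<kappa> = "\<lambda>j :: nat. if j = 1 then 1 else 0 :: nat"
    have rect: "rectangular ?\<kappa> (?L - Z)" if "Z \<subseteq> U \<times> {1}" for Z
      using that unfolding rectangular_def by (auto simp: grid split: if_splits)
    have "depth_ge ?L (same_colour ?\<kappa>) (m + (n - 2) - 1 + card (U \<times> {1::nat}))"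
    proof (subst depth_ge_kill_vars[OF _ _ _ rect])
      have "?L - U \<times> {1} = U \<times> {3..n}" by (auto simp: grid)
      moreover have "depth_ge (U \<times> {3..n}) (same_colour ?\<kappa>) e \<longleftrightarrow> depth_ge (U \<times> {3..n}) UNIV e" for e
        by (rule live) (auto simp: same_colour_def)
      ultimately show "depth_ge (?L - U \<times> {1}) (same_colour ?\<kappa>) (m + (n - 2) - 1)"
        using segre[of "{3..n}"] n by (simp add: depth_eq_def)
    qed (use U n in \<open>auto simp: grid\<close>)
    moreover have "depth_ge ?L E e \<longleftrightarrow> depth_ge ?L (same_colour ?\<kappa>) e" for e
      by (rule live) (auto simp: same_colour_def E_def adjacent_def)
    ultimately have "depth_ge ?L E (m + (n - 2) - 1 + m)"
      by (simp add: card_cartesian_product U(3))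
    then show ?thesis
      unfolding L by (rule depth_ge_antimono) (use m n in simp)
  qed
  have "depth_eq (grid m n) E (Suc (m + 2))"
  proof (rule depth_eq_Int[OF cut_E])
    have "grid m n \<inter> (grid m n - UNIV \<times> {2}) = U \<times> ({1..n} - {2})" by (auto simp: grid)
    moreover have "E' \<union> E = E'" by (auto simp: E_def E'_def adjacent_def)
    ultimately show "depth_eq (grid m n \<inter> (grid m n - UNIV \<times> {2})) (E' \<union> E) (m + 2)"
      using without_2 by simp
    show "depth_ge (grid m n) E' (Suc (m + 2))" "depth_ge (grid m n - UNIV \<times> {2}) E (Suc (m + 2))"
      using completed separated by (simp_all add: numeral_3_eq_3)
  qed
  then show ?thesis by (simp add: E_def numeral_3_eq_3)
qed

end

theorem theorem5p5:
  fixes m k :: nat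
  assumes "m \<ge> 2" and "k \<ge> 1"
  shows "\<exists>(n::nat) (G :: nat pair_pre_digraph).
    pair_graph G \<and> pverts G = {1..n} \<and> Digraph_Component.connected (with_proj G) \<and>
    depth (poly_ring m n :: 'k::field mpoly ring) (max_ideal m n)
      (quot_module (poly_ring m n) (gen_binomial_edge_ideal m n G))
      = enat ((m - 2) + f_inv (with_proj G) + d_inv (with_proj G)) \<and>
    int ((m - 2) + f_inv (with_proj G) + d_inv (with_proj G))
      = int m + int n - int (vertex_connectivity (with_proj G)) - int k"
proof -
  define n where "n = k + 4"
  have n: "n \<ge> 5" using assms by (simp add: n_def)
  let ?D = "with_proj (cliques_graph n)"
  let ?J = "gen_binomial_edge_ideal m n (cliques_graph n) :: 'k mpoly set"
  have inv: "(m - 2) + f_inv ?D + d_inv ?D = m + 3"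
    using assms by (simp add: f_inv_cliques_graph[OF n] d_inv_cliques_graph[OF n])
  have "finite (variables m n :: 'k mpoly set)"
    unfolding variables_def using finite_grid by blast
  then obtain xs :: "'k mpoly list" where xs: "set xs = variables m n"
    using finite_list by blast
  interpret variable_list m n xs by unfold_locales (rule xs)
  have "depth (poly_ring m n) (max_ideal m n) (quot_module (poly_ring m n) ?J) = enat (m + 3)"
  proof (rule depth_quot_module[OF _ _ xs])
    show "P.is_ideal m n ?J"
      unfolding gen_binomial_edge_ideal_eq by (rule edge_ideal_ideal)
    show "?J \<subseteq> max_ideal m n"
      unfolding gen_binomial_edge_ideal_eq max_ideal_eq_gen by (rule edge_ideal_subset_max_ideal)
    show "P.koszul_vanish m n xs ?J (m + 3)" "\<not> P.koszul_vanish m n xs ?J (Suc (m + 3))"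
      using depth_cliques_graph[OF assms(1) n]
      unfolding gen_binomial_edge_ideal_eq depth_eq_def depth_ge_def by auto
  qed
  moreover have "int (m + 3) = int m + int n - int (vertex_connectivity ?D) - int k"
    using vertex_connectivity_cliques_graph[OF n] by (simp add: n_def)
  ultimately show ?thesis
    using pair_graph_cliques_graph connected_cliques_graph[OF n] inv
    by (intro exI[of _ n] exI[of _ "cliques_graph n"]) simp
qed

end
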